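(* There is a polynomial-time algorithm which, given any instance of the vertex-weighted grade-of-service Steiner tree (V-GSST) problem (as defined in the context) with arbitrary non-negative costs $c_i(v)$ for each vertex $v$ and grade $i$, satisfying $0\le c_1(v)\le\cdots\le c_\ell(v)$, outputs a feasible solution whose cost is at most $2\ln|T|\cdot \mathrm{OPT}$, where $T$ is the set of terminals and $\mathrm{OPT}$ is the minimum cost of a feasible solution.
   Context: V-GSST problem: the input is a connected undirected graph $G=(V,E)$, a set of terminals $T\subseteq V$, required grades of service $R:T\to\{1,2,\ldots,\ell\}$, and installation costs $c_i(v)\ge 0$ for $v\in V$, $1\le i\le \ell$, with $0\le c_1(v)\le c_2(v)\le\cdots\le c_\ell(v)$ for every $v$. Edges have zero cost. A feasible solution is a subtree $G'$ of $G$ spanning $T$ together with integer grades $y(v)\in\{1,\ldots,\ell\}$ for $v\in V(G')$ such that (i) $y(v)\ge R(v)$ for every $v\in T$, and (ii) for all $u,v\in T$, every vertex $w$ on the $u$-$v$ path in $G'$ satisfies $y(w)\ge \min(R(u),R(v))$. Its cost is $\sum_{v\in V(G')} c_{y(v)}(v)$; $\mathrm{OPT}$ denotes the minimum cost of a feasible solution. Standing convention of the paper: terminals have zero cost up to their required grade, i.e. $c_1(v)=\cdots=c_{R(v)}(v)=0$ for every $v\in T$. *)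

theory Defs
  imports Complex_Main "HOL-Library.FuncSet" "HOL-Computational_Algebra.Polynomial"
begin

section \<open>Graphs and trees\<close>

text \<open>Finite simple undirected graphs, given by a vertex set and a set of two-element edges.\<close>

definition ugraph :: "'v set \<Rightarrow> 'v set set \<Rightarrow> bool" where
  "ugraph V E \<longleftrightarrow> finite V \<and> (\<forall>e\<in>E. e \<subseteq> V \<and> card e = 2)"

definition simple_path :: "'v set \<Rightarrow> 'v set set \<Rightarrow> 'v \<Rightarrow> 'v list \<Rightarrow> 'v \<Rightarrow> bool" where
  "simple_path V E u p v \<longleftrightarrow>
     p \<noteq> [] \<and> hd p = u \<and> last p = v \<and> distinct p \<and> set p \<subseteq> V \<and>
     successively (\<lambda>x y. {x, y} \<in> E) p"

definition connected_graph :: "'v set \<Rightarrow> 'v set set \<Rightarrow> bool" where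
  "connected_graph V E \<longleftrightarrow>
     ugraph V E \<and> V \<noteq> {} \<and> (\<forall>u\<in>V. \<forall>v\<in>V. \<exists>p. simple_path V E u p v)"

definition acyclic_graph :: "'v set \<Rightarrow> 'v set set \<Rightarrow> bool" where
  "acyclic_graph V E \<longleftrightarrow>
     \<not> (\<exists>u p v. simple_path V E u p v \<and> length p \<ge> 3 \<and> {v, u} \<in> E)"

definition tree_graph :: "'v set \<Rightarrow> 'v set set \<Rightarrow> bool" where
  "tree_graph V E \<longleftrightarrow> connected_graph V E \<and> acyclic_graph V E"


section \<open>The vertex-weighted grade-of-service Steiner tree problem\<close>

text \<open>Vertices are named by natural numbers and costs are rational, so that instances have finite
  encodings. \<^term>\<open>icost I i v\<close> stands for $c_i(v)$.\<close>

record gsst =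
  verts :: "nat set"
  edges :: "nat set set"
  terminals :: "nat set"
  req :: "nat \<Rightarrow> nat"
  levels :: nat
  icost :: "nat \<Rightarrow> nat \<Rightarrow> rat"

definition gsst_instance :: "gsst \<Rightarrow> bool" where
  "gsst_instance I \<longleftrightarrow>
     connected_graph (verts I) (edges I) \<and>
     terminals I \<subseteq> verts I \<and> terminals I \<noteq> {} \<and>
     (\<forall>v\<in>terminals I. req I v \<in> {1..levels I}) \<and>
     (\<forall>v\<in>verts I. \<forall>i\<in>{1..levels I}. 0 \<le> icost I i v) \<and>
     (\<forall>v\<in>verts I. \<forall>i j. 1 \<le> i \<and> i \<le> j \<and> j \<le> levels I \<longrightarrow> icost I i v \<le> icost I j v) \<and>
     (\<forall>v\<in>terminals I. \<forall>i\<in>{1..req I v}. icost I i v = 0)"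

record gsst_solution =
  tverts :: "nat set"
  tedges :: "nat set set"
  grade :: "nat \<Rightarrow> nat"

text \<open>The path between two vertices of a tree is unique, so quantifying over all simple paths is
  quantifying over the vertices of that path.\<close>

definition feasible :: "gsst \<Rightarrow> gsst_solution \<Rightarrow> bool" where
  "feasible I S \<longleftrightarrow>
     tree_graph (tverts S) (tedges S) \<and>
     tverts S \<subseteq> verts I \<and> tedges S \<subseteq> edges I \<and> terminals I \<subseteq> tverts S \<and>
     (\<forall>v\<in>tverts S. grade S v \<in> {1..levels I}) \<and>
     (\<forall>v\<in>terminals I. req I v \<le> grade S v) \<and>
     (\<forall>u\<in>terminals I. \<forall>v\<in>terminals I. \<forall>p. simple_path (tverts S) (tedges S) u p v \<longrightarrow>
        (\<forall>w\<in>set p. min (req I u) (req I v) \<le> grade S w))"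

definition sol_cost :: "gsst \<Rightarrow> gsst_solution \<Rightarrow> rat" where
  "sol_cost I S = (\<Sum>v\<in>tverts S. icost I (grade S v) v)"

definition OPT :: "gsst \<Rightarrow> rat" where
  "OPT I = Min (sol_cost I ` {S. feasible I S})"

text \<open>Only finitely many costs occur, so \<^const>\<open>Min\<close> is meaningful here.\<close>

lemma finite_feasible_costs:
  assumes "gsst_instance I"
  shows "finite (sol_cost I ` {S. feasible I S})"
proof -
  let ?D = "SIGMA W:Pow (verts I). W \<rightarrow>\<^sub>E {1..levels I}"
  have fin: "finite (verts I)"
    using assms by (simp add: gsst_instance_def connected_graph_def ugraph_def)
  have "finite ?D"
    using fin by (intro finite_SigmaI finite_PiE) (auto intro: finite_subset)
  moreover have "sol_cost I ` {S. feasible I S} \<subseteq> (\<lambda>(W, y). \<Sum>v\<in>W. icost I (y v) v) ` ?D"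
  proof
    fix c assume "c \<in> sol_cost I ` {S. feasible I S}"
    then obtain S where S: "feasible I S" "c = sol_cost I S" by blast
    have "(tverts S, restrict (grade S) (tverts S)) \<in> ?D"
      using S(1) by (auto simp: feasible_def)
    moreover have "c = (\<Sum>v\<in>tverts S. icost I (restrict (grade S) (tverts S) v) v)"
      by (simp add: S(2) sol_cost_def)
    ultimately show "c \<in> (\<lambda>(W, y). \<Sum>v\<in>W. icost I (y v) v) ` ?D"
      by (intro image_eqI[where x = "(tverts S, restrict (grade S) (tverts S))"]) auto
  qed
  ultimately show ?thesis by (rule finite_surj)
qed


section \<open>Model of computation\<close>

text \<open>Algorithms are programs of Jones's WHILE language over binary trees (N. D. Jones,
  Computability and Complexity from a Programming Perspective). The running time charges every
  expression for the full size of the trees it reads, copies or compares, so a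
  run of time t can be simulated by a multi-tape Turing machine, with one tape per variable, in time
  polynomial in t and the input length, and conversely a Turing machine step costs time polynomial
  in the size of the tapes.\<close>

datatype sexp = Atom | Node sexp sexp

datatype exp = Var nat | Const sexp | Join exp exp | Hd exp | Tl exp | Eq exp exp

datatype com = Assign nat exp | Seq com com | If exp com com | While exp com

type_synonym store = "nat \<Rightarrow> sexp"

fun left :: "sexp \<Rightarrow> sexp" where
  "left Atom = Atom"
| "left (Node a b) = a"

fun right :: "sexp \<Rightarrow> sexp" where
  "right Atom = Atom"
| "right (Node a b) = b"

text \<open>\<^const>\<open>Atom\<close> is false; every other tree is true.\<close>

definition enc_bool :: "bool \<Rightarrow> sexp" where
  "enc_bool b = (if b then Node Atom Atom else Atom)"

fun eval_exp :: "exp \<Rightarrow> store \<Rightarrow> sexp" where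
  "eval_exp (Var x) s = s x"
| "eval_exp (Const d) s = d"
| "eval_exp (Join e f) s = Node (eval_exp e s) (eval_exp f s)"
| "eval_exp (Hd e) s = left (eval_exp e s)"
| "eval_exp (Tl e) s = right (eval_exp e s)"
| "eval_exp (Eq e f) s = enc_bool (eval_exp e s = eval_exp f s)"

text \<open>The size of a tree is its number of \<^const>\<open>Node\<close>s.\<close>

fun time_exp :: "exp \<Rightarrow> store \<Rightarrow> nat" where
  "time_exp (Var x) s = 1 + size (s x)"
| "time_exp (Const d) s = 1 + size d"
| "time_exp (Join e f) s = 1 + time_exp e s + time_exp f s"
| "time_exp (Hd e) s = 1 + time_exp e s"
| "time_exp (Tl e) s = 1 + time_exp e s"
| "time_exp (Eq e f) s = 1 + time_exp e s + time_exp f s"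

text \<open>\<open>exec c s t s'\<close>: started in store \<open>s\<close>, program \<open>c\<close> halts in store \<open>s'\<close> after time \<open>t\<close>.\<close>

inductive exec :: "com \<Rightarrow> store \<Rightarrow> nat \<Rightarrow> store \<Rightarrow> bool" where
  Assign: "exec (Assign x e) s (1 + time_exp e s) (s(x := eval_exp e s))"
| Seq: "exec c1 s t1 s' \<Longrightarrow> exec c2 s' t2 s'' \<Longrightarrow> exec (Seq c1 c2) s (1 + t1 + t2) s''"
| IfTrue: "eval_exp e s \<noteq> Atom \<Longrightarrow> exec c1 s t s' \<Longrightarrow>
    exec (If e c1 c2) s (1 + time_exp e s + t) s'"
| IfFalse: "eval_exp e s = Atom \<Longrightarrow> exec c2 s t s' \<Longrightarrow>
    exec (If e c1 c2) s (1 + time_exp e s + t) s'"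
| WhileTrue: "eval_exp e s \<noteq> Atom \<Longrightarrow> exec c s t1 s' \<Longrightarrow> exec (While e c) s' t2 s'' \<Longrightarrow>
    exec (While e c) s (1 + time_exp e s + t1 + t2) s''"
| WhileFalse: "eval_exp e s = Atom \<Longrightarrow> exec (While e c) s (1 + time_exp e s) s"

lemma exec_deterministic:
  "exec c s t s' \<Longrightarrow> exec c s u s'' \<Longrightarrow> t = u \<and> s' = s''"
proof (induction arbitrary: u s'' rule: exec.induct)
  case (Assign x e s)
  then show ?case by (auto elim: exec.cases)
next
  case (Seq c1 s t1 s' c2 t2 s2)
  from Seq.prems show ?case
    by (cases rule: exec.cases) (use Seq.IH in blast)
next
  case (IfTrue e s c1 t s' c2)
  from IfTrue.prems show ?case
    by (cases rule: exec.cases) (use IfTrue.IH IfTrue.hyps in blast)+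
next
  case (IfFalse e s c2 t s' c1)
  from IfFalse.prems show ?case
    by (cases rule: exec.cases) (use IfFalse.IH IfFalse.hyps in blast)+
next
  case (WhileTrue e s c t1 s' t2 s2)
  from WhileTrue.prems show ?case
    by (cases rule: exec.cases) (use WhileTrue.IH WhileTrue.hyps in blast)+
next
  case (WhileFalse e s c)
  from WhileFalse.prems show ?case
    by (cases rule: exec.cases) (use WhileFalse.hyps in blast)+
qed

text \<open>Input and output are passed in variable 0; all other variables are initially \<^const>\<open>Atom\<close>.\<close>

definition outputs_in_time :: "com \<Rightarrow> sexp \<Rightarrow> nat \<Rightarrow> sexp \<Rightarrow> bool" where
  "outputs_in_time c inp t out \<longleftrightarrow> (\<exists>s. exec c ((\<lambda>_. Atom)(0 := inp)) t s \<and> s 0 = out)"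


section \<open>Encodings\<close>

text \<open>Numbers are written in binary, least significant bit first, so the size of an encoded
  instance is proportional to its usual bit length.\<close>

fun enc_nat :: "nat \<Rightarrow> sexp" where
  "enc_nat n = (if n = 0 then Atom else Node (enc_bool (odd n)) (enc_nat (n div 2)))"

declare enc_nat.simps [simp del]

definition enc_list :: "('a \<Rightarrow> sexp) \<Rightarrow> 'a list \<Rightarrow> sexp" where
  "enc_list f xs = foldr (\<lambda>x d. Node (f x) d) xs Atom"

definition enc_pair :: "('a \<Rightarrow> sexp) \<Rightarrow> ('b \<Rightarrow> sexp) \<Rightarrow> 'a \<times> 'b \<Rightarrow> sexp" where
  "enc_pair f g = (\<lambda>(a, b). Node (f a) (g b))"

text \<open>Numerator and denominator in lowest terms; only used for non-negative numbers, hence no sign.\<close>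

definition enc_rat :: "rat \<Rightarrow> sexp" where
  "enc_rat q = enc_pair (enc_nat \<circ> nat) (enc_nat \<circ> nat) (quotient_of q)"

text \<open>Each undirected edge is listed once, as the pair of its endpoints in increasing order.\<close>

definition enc_edges :: "nat set \<Rightarrow> nat set set \<Rightarrow> sexp" where
  "enc_edges V E =
     (let vs = sorted_list_of_set V in
      enc_list (enc_pair enc_nat enc_nat)
        (filter (\<lambda>(u, v). u < v \<and> {u, v} \<in> E) (List.product vs vs)))"

text \<open>Vertex list, edge list, terminals with their required grades, number of grades, and for
  every vertex (in the order of the vertex list) the list of its costs for the grades 1, 2, ...\<close>

definition enc_instance :: "gsst \<Rightarrow> sexp" where
  "enc_instance I =
     Node (enc_list enc_nat (sorted_list_of_set (verts I)))
    (Node (enc_edges (verts I) (edges I))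
    (Node (enc_list (\<lambda>v. Node (enc_nat v) (enc_nat (req I v))) (sorted_list_of_set (terminals I)))
    (Node (enc_nat (levels I))
          (enc_list (\<lambda>v. enc_list (\<lambda>i. enc_rat (icost I i v)) [1..<Suc (levels I)])
             (sorted_list_of_set (verts I))))))"

definition enc_solution :: "gsst_solution \<Rightarrow> sexp" where
  "enc_solution S =
     Node (enc_list (\<lambda>v. Node (enc_nat v) (enc_nat (grade S v))) (sorted_list_of_set (tverts S)))
          (enc_edges (tverts S) (tedges S))"

end

theory Submission
  imports Defs
begin

text \<open>The algorithm is the greedy method of Klein and Ravi for node-weighted Steiner trees. While at least
  two terminals are active, it buys a spider of minimal ratio of cost to number of joined terminals,
  after which only the terminal of highest grade of the spider stays active. With respect to a spider
  with center \<open>x\<close>, root terminal \<open>r\<close> and further terminals \<open>t\<close>, the leg of each \<open>t\<close> needs its own grade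
  \<open>R t\<close>, while \<open>x\<close> and the leg of \<open>r\<close> only need the second highest grade of the spider. An optimal tree
  contains vertex-disjoint spiders, each with at least two terminals, that cover the \<open>k\<close> active
  terminals; hence a spider that leaves \<open>k'\<close> terminals active costs at most
  $2 (k - k') / k \cdot \mathrm{OPT} \le 2 \ln (k / k') \cdot \mathrm{OPT}$, and these bounds telescope. A tree is then grown
  from the last active terminal inside the bought vertices, highest grades first.

  Polynomial running time is obtained compositionally: the functions computed by programs in time
  polynomial in the size of their encoded argument are closed under composition, pairing, case
  distinction, and iteration over lists as long as the accumulator stays polynomially bounded.\<close>

section \<open>Functions computable in polynomial time\<close>

text \<open>A pair of terminals asks only for the smaller of its two grades along its path, so no
  pair within a spider needs more than the second highest grade; the higher grade of the root is
  left to later spiders. The disjoint spiders of an optimal tree are never computed: by averaging,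
  one of them costs at most OPT / k per terminal, and the best ratio found is no worse. The factor 2
  arises because a spider with m + 1 terminals deactivates only m of them, and m + 1 <= 2 m; the
  logarithm comes from ln z <= z - 1 at z = k' / k. One and the same optimal tree serves in all
  rounds. The bought vertices may contain cycles, and an arbitrary spanning tree of them could link
  two terminals of high grade through a vertex of low grade. Preferring high grades avoids this: for
  each g, the tree contains the component of the root among the vertices of grade at least g as a
  subtree. The obstacle for the running time is that a polynomial step, iterated polynomially often,
  can still produce exponentially large values. Every loop therefore comes with a size bound for its
  accumulator after each prefix of its list.\<close>

definition runs :: "com \<Rightarrow> store \<Rightarrow> nat \<Rightarrow> (store \<Rightarrow> bool) \<Rightarrow> bool" where
  "runs c s T Q \<longleftrightarrow> (\<exists>t s'. exec c s t s' \<and> t \<le> T \<and> Q s')"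

lemma runs_Assign:
  "Q (s(x := eval_exp e s)) \<Longrightarrow> 1 + time_exp e s \<le> T \<Longrightarrow> runs (Assign x e) s T Q"
  unfolding runs_def by (blast intro: exec.Assign)

lemma runs_Seq:
  "runs c1 s T1 (\<lambda>s'. runs c2 s' T2 Q) \<Longrightarrow> 1 + T1 + T2 \<le> T \<Longrightarrow> runs (Seq c1 c2) s T Q"
  unfolding runs_def
  by (meson exec.Seq add_le_mono le_trans order_refl)

lemma runs_If:
  assumes "eval_exp e s \<noteq> Atom \<Longrightarrow> runs c1 s T' Q" "eval_exp e s = Atom \<Longrightarrow> runs c2 s T' Q"
    and "1 + time_exp e s + T' \<le> T"
  shows "runs (If e c1 c2) s T Q"
proof (cases "eval_exp e s = Atom")
  case True
  then obtain t s' where "exec c2 s t s'" "t \<le> T'" "Q s'" using assms(2) by (auto simp: runs_def)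
  then show ?thesis using exec.IfFalse[OF True, of c2 t s' c1] assms(3) by (force simp: runs_def)
next
  case False
  then obtain t s' where "exec c1 s t s'" "t \<le> T'" "Q s'" using assms(1) by (auto simp: runs_def)
  then show ?thesis using exec.IfTrue[OF False, of c1 t s' c2] assms(3) by (force simp: runs_def)
qed

lemma runs_While_Atom:
  "eval_exp e s = Atom \<Longrightarrow> Q s \<Longrightarrow> 1 + time_exp e s \<le> T \<Longrightarrow> runs (While e c) s T Q"
  unfolding runs_def by (blast intro: exec.WhileFalse)

lemma runs_While_Node:
  assumes "eval_exp e s \<noteq> Atom" "runs c s T1 (\<lambda>s'. runs (While e c) s' T2 Q)"
    and "1 + time_exp e s + T1 + T2 \<le> T"
  shows "runs (While e c) s T Q"
proof -
  obtain t1 s' t2 s'' where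
    "exec c s t1 s'" "t1 \<le> T1" "exec (While e c) s' t2 s''" "t2 \<le> T2" "Q s''"
    using assms(2) by (auto simp: runs_def)
  moreover from this have "exec (While e c) s (1 + time_exp e s + t1 + t2) s''"
    using exec.WhileTrue[OF assms(1)] by blast
  ultimately show ?thesis using assms(3) unfolding runs_def by fastforce
qed

lemma runs_mono:
  "runs c s T Q \<Longrightarrow> (\<And>s'. Q s' \<Longrightarrow> Q' s') \<Longrightarrow> T \<le> T' \<Longrightarrow> runs c s T' Q'"
  unfolding runs_def by (meson le_trans)

lemma size_left: "size (left d) \<le> size d" by (cases d) auto
lemma size_right: "size (right d) \<le> size d" by (cases d) auto

lemma size_eval_le: "size (eval_exp e s) \<le> time_exp e s"
  by (induction e) (auto simp: enc_bool_def intro: le_trans[OF size_left] le_trans[OF size_right] le_SucI)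

text \<open>An assignment is charged at least the size of the tree that it stores, so trees cannot
  outgrow the time.\<close>

lemma exec_size: "exec c s t s' \<Longrightarrow> size (s' x) \<le> size (s x) + t"
proof (induction rule: exec.induct)
  case (Assign y e s)
  then show ?case using size_eval_le[of e s] by auto
qed auto

text \<open>The reason for taking polynomials over \<open>nat\<close>: all of them are monotone, so
  bounds can be substituted into each other.\<close>

lemma poly_nat_mono: "m \<le> n \<Longrightarrow> poly p m \<le> poly p n" for p :: "nat poly"
  by (induction p) (auto intro: add_mono mult_mono)

definition pbound :: "('a \<Rightarrow> sexp) \<Rightarrow> ('a \<Rightarrow> nat) \<Rightarrow> bool" where
  "pbound e f \<longleftrightarrow> (\<exists>q. \<forall>x. f x \<le> poly q (size (e x)))"

named_theorems pbound_intros

lemma pbound_le: "pbound e g \<Longrightarrow> (\<And>x. f x \<le> g x) \<Longrightarrow> pbound e f"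
  unfolding pbound_def by (meson le_trans)

lemma pbound_const [pbound_intros]: "pbound e (\<lambda>x. c)"
  unfolding pbound_def by (rule exI[of _ "[:c:]"]) simp

lemma pbound_size_self [pbound_intros]: "pbound e (\<lambda>x. size (e x))"
  unfolding pbound_def by (rule exI[of _ "[:0, 1:]"]) simp

lemma pbound_add [pbound_intros]: "pbound e f \<Longrightarrow> pbound e g \<Longrightarrow> pbound e (\<lambda>x. f x + g x)"
  unfolding pbound_def by (metis add_mono poly_add)

lemma pbound_Suc [pbound_intros]: "pbound e f \<Longrightarrow> pbound e (\<lambda>x. Suc (f x))"
  using pbound_add[OF _ pbound_const[of e 1]] by simp

lemma pbound_mult [pbound_intros]: "pbound e f \<Longrightarrow> pbound e g \<Longrightarrow> pbound e (\<lambda>x. f x * g x)"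
  unfolding pbound_def by (metis mult_mono poly_mult zero_le)

lemma pbound_poly [pbound_intros]: "pbound e f \<Longrightarrow> pbound e (\<lambda>x. poly q (f x))"
  unfolding pbound_def by (metis poly_nat_mono poly_pcompose)

text \<open>The program is started in an arbitrary store, not in one with blank registers, and
  promises to leave all registers from \<open>k\<close> on unchanged. A surrounding program can thus
  save values beyond the registers of its parts, and variables need no renaming.\<close>

definition polyt :: "('a \<Rightarrow> sexp) \<Rightarrow> ('b \<Rightarrow> sexp) \<Rightarrow> ('a \<Rightarrow> 'b) \<Rightarrow> bool" where
  "polyt ea eb f \<longleftrightarrow> (\<exists>c k T. 0 < k \<and> pbound ea T \<and>
     (\<forall>x s. s 0 = ea x \<longrightarrow> runs c s (T x) (\<lambda>s'. s' 0 = eb (f x) \<and> (\<forall>i\<ge>k. s' i = s i))))"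

named_theorems polyt_intros

lemma polytI:
  assumes "0 < k" "pbound ea T"
    "\<And>x s. s 0 = ea x \<Longrightarrow> runs c s (T x) (\<lambda>s'. s' 0 = eb (f x) \<and> (\<forall>i\<ge>k. s' i = s i))"
  shows "polyt ea eb f"
  unfolding polyt_def using assms by blast

text \<open>By \<open>exec_size\<close> the output is no larger than input size plus running time;
  the bound handed out is therefore the original one increased by the input size.\<close>

lemma polytE:
  assumes "polyt ea eb f"
  obtains c k T where "0 < k" "pbound ea T" "\<And>x. size (eb (f x)) \<le> T x"
    "\<And>x s. s 0 = ea x \<Longrightarrow> runs c s (T x) (\<lambda>s'. s' 0 = eb (f x) \<and> (\<forall>i\<ge>k. s' i = s i))"
proof -
  obtain c k T where *: "0 < k" "pbound ea T"
    "\<And>x s. s 0 = ea x \<Longrightarrow> runs c s (T x) (\<lambda>s'. s' 0 = eb (f x) \<and> (\<forall>i\<ge>k. s' i = s i))"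
    using assms unfolding polyt_def by blast
  have "size (eb (f x)) \<le> T x + size (ea x)" for x
  proof -
    obtain t s' where "exec c (\<lambda>_. ea x) t s'" "t \<le> T x" "s' 0 = eb (f x)"
      using *(3)[of "\<lambda>_. ea x" x] by (auto simp: runs_def)
    then show ?thesis using exec_size[of c "\<lambda>_. ea x" t s' 0] by simp
  qed
  moreover have "pbound ea (\<lambda>x. T x + size (ea x))" by (intro pbound_intros *)
  moreover have "runs c s (T x + size (ea x)) (\<lambda>s'. s' 0 = eb (f x) \<and> (\<forall>i\<ge>k. s' i = s i))"
    if "s 0 = ea x" for x s using *(3)[of s x] that by (auto intro: runs_mono)
  ultimately show ?thesis using that *(1) by blast
qed

lemma pbound_size_polyt: "polyt ea eb f \<Longrightarrow> pbound ea (\<lambda>x. size (eb (f x)))"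
  by (erule polytE) (erule pbound_le)

lemma pbound_comp:
  assumes "pbound e' T" "pbound e (\<lambda>x. size (e' (g x)))"
  shows "pbound e (\<lambda>x. T (g x))"
proof -
  obtain q where q: "\<And>x. T x \<le> poly q (size (e' x))" using assms(1) by (auto simp: pbound_def)
  have "pbound e (\<lambda>x. poly q (size (e' (g x))))" by (intro pbound_intros assms)
  then show ?thesis by (rule pbound_le) (rule q)
qed

section \<open>Composition, pairing and case distinction\<close>

lemma polyt_id [polyt_intros]: "polyt e e (\<lambda>x. x)"
proof (rule polytI[of 1 _ "\<lambda>x. 2 + size (e x)" "Assign 0 (Var 0)"])
  show "pbound e (\<lambda>x. 2 + size (e x))" by (intro pbound_intros)
qed (auto intro!: runs_Assign)

text \<open>Encodings that agree as trees are converted by the identity program, so such changes of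
  type are free.\<close>

lemma polyt_reenc: "(\<And>x. e' (f x) = e x) \<Longrightarrow> polyt e e' f"
proof (rule polytI[of 1 _ "\<lambda>x. 2 + size (e x)" "Assign 0 (Var 0)"])
  show "pbound e (\<lambda>x. 2 + size (e x))" by (intro pbound_intros)
qed (auto intro!: runs_Assign)

lemma polyt_const [polyt_intros]: "polyt e e' (\<lambda>x. c)"
proof (rule polytI[of 1 _ "\<lambda>x. 2 + size (e' c)" "Assign 0 (Const (e' c))"])
  show "pbound e (\<lambda>x. 2 + size (e' c))" by (intro pbound_intros)
qed (auto intro!: runs_Assign)

lemma polyt_comp:
  assumes f: "polyt e1 e2 f" and g: "polyt e e1 g"
  shows "polyt e e2 (\<lambda>x. f (g x))"
proof -
  obtain c1 k1 T1 where 1: "0 < k1" "pbound e T1" "\<And>x. size (e1 (g x)) \<le> T1 x"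
    "\<And>x s. s 0 = e x \<Longrightarrow> runs c1 s (T1 x) (\<lambda>s'. s' 0 = e1 (g x) \<and> (\<forall>i\<ge>k1. s' i = s i))"
    using g by (rule polytE) blast
  obtain c2 k2 T2 where 2: "0 < k2" "pbound e1 T2" "\<And>x. size (e2 (f x)) \<le> T2 x"
    "\<And>x s. s 0 = e1 x \<Longrightarrow> runs c2 s (T2 x) (\<lambda>s'. s' 0 = e2 (f x) \<and> (\<forall>i\<ge>k2. s' i = s i))"
    using f by (rule polytE) blast
  show ?thesis
  proof (rule polytI[where k = "max k1 k2" and T = "\<lambda>x. 1 + T1 x + T2 (g x)" and c = "Seq c1 c2"])
    show "pbound e (\<lambda>x. 1 + T1 x + T2 (g x))"
      by (intro pbound_intros 1 pbound_comp[OF 2(2)] pbound_le[OF 1(2)])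
    fix x and s :: store assume "s 0 = e x"
    then show "runs (Seq c1 c2) s (1 + T1 x + T2 (g x))
        (\<lambda>s'. s' 0 = e2 (f (g x)) \<and> (\<forall>i\<ge>max k1 k2. s' i = s i))"
      by (intro runs_Seq[OF runs_mono[OF 1(4)]]) (auto intro!: runs_mono[OF 2(4)])
  qed (use 1 in auto)
qed

lemma polyt_pair [polyt_intros]:
  assumes f: "polyt e e1 f" and g: "polyt e e2 g"
  shows "polyt e (enc_pair e1 e2) (\<lambda>x. (f x, g x))"
proof -
  obtain c1 k1 T1 where 1: "0 < k1" "pbound e T1" "\<And>x. size (e1 (f x)) \<le> T1 x"
    "\<And>x s. s 0 = e x \<Longrightarrow> runs c1 s (T1 x) (\<lambda>s'. s' 0 = e1 (f x) \<and> (\<forall>i\<ge>k1. s' i = s i))"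
    using f by (rule polytE) blast
  obtain c2 k2 T2 where 2: "0 < k2" "pbound e T2" "\<And>x. size (e2 (g x)) \<le> T2 x"
    "\<And>x s. s 0 = e x \<Longrightarrow> runs c2 s (T2 x) (\<lambda>s'. s' 0 = e2 (g x) \<and> (\<forall>i\<ge>k2. s' i = s i))"
    using g by (rule polytE) blast
  define k where "k = max k1 k2"
  have k: "k1 \<le> k" "k2 \<le> k" "0 < k" using 1 by (auto simp: k_def)
  \<comment> \<open>Register \<open>k\<close> saves the input, since \<open>c1\<close> overwrites
    register 0, and register \<open>k+1\<close> saves the first result while \<open>c2\<close> runs.
    Neither \<open>c1\<close> nor \<open>c2\<close> changes these registers.\<close>
  let ?c = "Seq (Assign k (Var 0)) (Seq c1 (Seq (Assign (k+1) (Var 0)) (Seq (Assign 0 (Var k))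
     (Seq c2 (Assign 0 (Join (Var (k+1)) (Var 0)))))))"
  show ?thesis
  proof (rule polytI[where k = "k+2" and c = ?c
        and T = "\<lambda>x. 20 + (2 * T1 x + 2 * T1 x + 2 * T2 x + 2 * size (e x))"])
    show "pbound e (\<lambda>x. 20 + (2 * T1 x + 2 * T1 x + 2 * T2 x + 2 * size (e x)))"
      by (intro pbound_intros 1 2)
    fix x and s :: store assume s: "s 0 = e x"
    let ?Q = "\<lambda>s'. s' 0 = enc_pair e1 e2 (f x, g x) \<and> (\<forall>i\<ge>k+2. s' i = s i)"
    \<comment> \<open>The suffixes of the program are specified one by one, from the last command
      backwards.\<close>
    have a5: "runs (Assign 0 (Join (Var (k+1)) (Var 0))) s' (4 + T1 x + T2 x) ?Q"
      if "s' 0 = e2 (g x)" "s' (k+1) = e1 (f x)" "\<forall>i\<ge>k+2. s' i = s i" for s'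
      using that 1(3)[of x] 2(3)[of x] k by (intro runs_Assign) (auto simp: enc_pair_def)
    have a4: "runs (Seq c2 (Assign 0 (Join (Var (k+1)) (Var 0)))) s' (5 + T1 x + 2 * T2 x) ?Q"
      if "s' 0 = e x" "s' (k+1) = e1 (f x)" "\<forall>i\<ge>k+2. s' i = s i" for s'
      apply (rule runs_Seq[where ?T1.0 = "T2 x" and ?T2.0 = "4 + T1 x + T2 x"])
       apply (rule runs_mono[OF 2(4)[of _ x]])
         apply (rule that(1))
        apply (rule a5)
      using that k by auto
    have a3: "runs (Seq (Assign 0 (Var k)) (Seq c2 (Assign 0 (Join (Var (k+1)) (Var 0))))) s'
        (8 + size (e x) + T1 x + 2 * T2 x) ?Q"
      if "s' k = e x" "s' (k+1) = e1 (f x)" "\<forall>i\<ge>k+2. s' i = s i" for s'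
      apply (rule runs_Seq[OF runs_Assign[where T = "2 + size (e x)"], where ?T2.0 = "5 + T1 x + 2 * T2 x"])
        apply (rule a4)
      using that k by auto
    have a2: "runs (Seq (Assign (k+1) (Var 0)) (Seq (Assign 0 (Var k)) (Seq c2 (Assign 0 (Join (Var (k+1)) (Var 0)))))) s'
        (11 + size (e x) + 2 * T1 x + 2 * T2 x) ?Q"
      if "s' k = e x" "s' 0 = e1 (f x)" "\<forall>i\<ge>k+2. s' i = s i" for s'
      apply (rule runs_Seq[OF runs_Assign[where T = "2 + T1 x"], where ?T2.0 = "8 + size (e x) + T1 x + 2 * T2 x"])
        apply (rule a3)
      using that k 1(3)[of x] by auto
    have a1: "runs (Seq c1 (Seq (Assign (k+1) (Var 0)) (Seq (Assign 0 (Var k)) (Seq c2 (Assign 0 (Join (Var (k+1)) (Var 0))))))) s'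
        (12 + size (e x) + 3 * T1 x + 2 * T2 x) ?Q"
      if "s' k = e x" "s' 0 = e x" "\<forall>i\<ge>k+2. s' i = s i" for s'
      apply (rule runs_Seq[OF runs_mono[OF 1(4)[of s' x, OF that(2)]], where ?T2.0 = "11 + size (e x) + 2 * T1 x + 2 * T2 x"])
        apply (rule a2)
      using that k by auto
    show "runs ?c s (20 + (2 * T1 x + 2 * T1 x + 2 * T2 x + 2 * size (e x))) ?Q"
      apply (rule runs_Seq[OF runs_Assign[where T = "2 + size (e x)"], where ?T2.0 = "12 + size (e x) + 3 * T1 x + 2 * T2 x"])
        apply (rule a1)
      using s k by auto
  qed simp
qed

lemma polyt_fst_prim: "polyt (enc_pair e1 e2) e1 fst"
proof (rule polytI[of 1 _ "\<lambda>x. 3 + size (enc_pair e1 e2 x)" "Assign 0 (Hd (Var 0))"])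
  show "pbound (enc_pair e1 e2) (\<lambda>x. 3 + size (enc_pair e1 e2 x))" by (intro pbound_intros)
qed (auto intro!: runs_Assign simp: enc_pair_def split: prod.splits)

lemma polyt_snd_prim: "polyt (enc_pair e1 e2) e2 snd"
proof (rule polytI[of 1 _ "\<lambda>x. 3 + size (enc_pair e1 e2 x)" "Assign 0 (Tl (Var 0))"])
  show "pbound (enc_pair e1 e2) (\<lambda>x. 3 + size (enc_pair e1 e2 x))" by (intro pbound_intros)
qed (auto intro!: runs_Assign simp: enc_pair_def split: prod.splits)

lemmas polyt_fst [polyt_intros] = polyt_comp[OF polyt_fst_prim]
lemmas polyt_snd [polyt_intros] = polyt_comp[OF polyt_snd_prim]

text \<open>The language compares trees, so injectivity is what turns equality of encodings into
  equality of values.\<close>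

lemma polyt_eq [polyt_intros]:
  assumes "polyt e e1 f" "polyt e e1 g" "inj e1"
  shows "polyt e enc_bool (\<lambda>x. f x = g x)"
proof -
  have "polyt (enc_pair e1 e1) enc_bool (\<lambda>p. fst p = snd p)"
  proof (rule polytI[of 1 _ "\<lambda>x. 8 + 2 * size (enc_pair e1 e1 x)" "Assign 0 (Eq (Hd (Var 0)) (Tl (Var 0)))"])
    show "pbound (enc_pair e1 e1) (\<lambda>x. 8 + 2 * size (enc_pair e1 e1 x))" by (intro pbound_intros)
  qed (auto intro!: runs_Assign simp: enc_pair_def inj_eq[OF assms(3)] split: prod.splits)
  from polyt_comp[OF this polyt_pair[OF assms(1,2)]] show ?thesis by simp
qed

text \<open>Both branches are computed and paired before one of them is selected. Functions of the
  logic are total, so this only costs time.\<close>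

lemma polyt_if [polyt_intros]:
  assumes b: "polyt e enc_bool b" and f: "polyt e e' f" and g: "polyt e e' g"
  shows "polyt e e' (\<lambda>x. if b x then f x else g x)"
proof -
  let ?h = "\<lambda>p. if fst p then fst (snd p) else snd (snd p)"
  have "polyt (enc_pair enc_bool (enc_pair e' e')) e' ?h"
  proof (rule polytI[of 1 _ "\<lambda>x. 20 + 3 * size (enc_pair enc_bool (enc_pair e' e') x)"
        "If (Hd (Var 0)) (Assign 0 (Hd (Tl (Var 0)))) (Assign 0 (Tl (Tl (Var 0))))"])
    show "pbound (enc_pair enc_bool (enc_pair e' e')) (\<lambda>x. 20 + 3 * size (enc_pair enc_bool (enc_pair e' e') x))"
      by (intro pbound_intros)
    fix x and s :: store assume "s 0 = enc_pair enc_bool (enc_pair e' e') x"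
    then show "runs (If (Hd (Var 0)) (Assign 0 (Hd (Tl (Var 0)))) (Assign 0 (Tl (Tl (Var 0))))) s
        (20 + 3 * size (enc_pair enc_bool (enc_pair e' e') x)) (\<lambda>s'. s' 0 = e' (?h x) \<and> (\<forall>i\<ge>1. s' i = s i))"
      by (intro runs_If[where T' = "4 + size (enc_pair enc_bool (enc_pair e' e') x)"])
         (auto intro!: runs_Assign simp: enc_pair_def enc_bool_def split: prod.splits if_splits)
  qed simp
  from polyt_comp[OF this polyt_pair[OF b polyt_pair[OF f g]]] show ?thesis by (simp cong: if_cong)
qed

section \<open>Encoded lists and iteration over them\<close>

lemma enc_list_simps [simp]: "enc_list f [] = Atom" "enc_list f (x # xs) = Node (f x) (enc_list f xs)"
  by (simp_all add: enc_list_def)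

lemma size_enc_pair [simp]: "size (enc_pair f g p) = Suc (size (f (fst p)) + size (g (snd p)))"
  by (cases p) (simp add: enc_pair_def)

lemma size_enc_list: "size (enc_list f xs) = (\<Sum>x\<leftarrow>xs. Suc (size (f x)))"
  by (induction xs) auto

lemma size_enc_list_append [simp]: "size (enc_list f (xs @ ys)) = size (enc_list f xs) + size (enc_list f ys)"
  by (simp add: size_enc_list)

lemma size_enc_list_rev [simp]: "size (enc_list f (rev xs)) = size (enc_list f xs)"
  by (simp add: size_enc_list rev_map flip: rev_map)

lemma length_le_size: "length xs \<le> size (enc_list f xs)"
  by (induction xs) auto

lemma size_elem: "x \<in> set xs \<Longrightarrow> size (f x) < size (enc_list f xs)"
  by (induction xs) auto

lemma size_enc_list_le: "(\<And>x. x \<in> set xs \<Longrightarrow> size (f x) \<le> B) \<Longrightarrow> size (enc_list f xs) \<le> length xs * Suc B"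
proof (induction xs)
  case (Cons x xs)
  have "size (f x) \<le> B" "size (enc_list f xs) \<le> length xs * Suc B" using Cons by auto
  then show ?case by simp
qed simp

lemma size_enc_list_filter: "size (enc_list f (filter P xs)) \<le> size (enc_list f xs)"
  by (induction xs) auto

lemma polyt_Cons [polyt_intros]:
  assumes "polyt e e1 f" "polyt e (enc_list e1) g"
  shows "polyt e (enc_list e1) (\<lambda>x. f x # g x)"
proof -
  have "polyt (enc_pair e1 (enc_list e1)) (enc_list e1) (\<lambda>p. fst p # snd p)"
    by (rule polyt_reenc) (simp add: enc_pair_def split: prod.splits)
  from polyt_comp[OF this polyt_pair[OF assms]] show ?thesis by simp
qed

lemma polyt_case_list_prim:
  assumes "polyt e e2 n" "polyt (enc_pair e (enc_pair e1 (enc_list e1))) e2 (\<lambda>p. c (fst p) (fst (snd p)) (snd (snd p)))"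
  shows "polyt (enc_pair e (enc_list e1)) e2 (\<lambda>p. case snd p of [] \<Rightarrow> n (fst p) | y # ys \<Rightarrow> c (fst p) y ys)"
proof -
  let ?e = "enc_pair e (enc_list e1)"
  obtain c1 k1 T1 where 1: "0 < k1" "pbound e T1" "\<And>x. size (e2 (n x)) \<le> T1 x"
    "\<And>x s. s 0 = e x \<Longrightarrow> runs c1 s (T1 x) (\<lambda>s'. s' 0 = e2 (n x) \<and> (\<forall>i\<ge>k1. s' i = s i))"
    using assms(1) by (rule polytE) blast
  obtain c2 k2 T2 where 2: "0 < k2" "pbound (enc_pair e (enc_pair e1 (enc_list e1))) T2"
    "\<And>x s. s 0 = enc_pair e (enc_pair e1 (enc_list e1)) x \<Longrightarrow> runs c2 s (T2 x) (\<lambda>s'. s' 0 = e2 (c (fst x) (fst (snd x)) (snd (snd x))) \<and> (\<forall>i\<ge>k2. s' i = s i))"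
    using assms(2) by (rule polytE) blast
  obtain q where q: "\<And>x. T2 x \<le> poly q (size (enc_pair e (enc_pair e1 (enc_list e1)) x))"
    using 2(2) unfolding pbound_def by blast
  \<comment> \<open>For a non-empty list the trees of \<open>(x, y # ys)\<close> and
    \<open>(x, (y, ys))\<close> coincide, so \<open>c2\<close> starts on the input as it stands; for
    the empty list the context is extracted first.\<close>
  let ?c = "If (Tl (Var 0)) c2 (Seq (Assign 0 (Hd (Var 0))) c1)"
  define T where "T = (\<lambda>p. 5 + size (?e p) + (3 + size (?e p) + T1 (fst p) + poly q (size (?e p))))"
  show ?thesis
  proof (rule polytI[where k = "max k1 k2" and c = ?c and T = T])
    show "pbound ?e T" unfolding T_def
      by (intro pbound_intros pbound_comp[OF 1(2), of _ fst] pbound_le[OF pbound_size_self[of ?e]]) simp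
    fix p and s :: store assume s: "s 0 = ?e p"
    show "runs ?c s (T p) (\<lambda>s'. s' 0 = e2 (case snd p of [] \<Rightarrow> n (fst p) | y # ys \<Rightarrow> c (fst p) y ys) \<and> (\<forall>i\<ge>max k1 k2. s' i = s i))"
    proof (cases "snd p")
      case Nil
      have p: "p = (fst p, [])" using Nil by (cases p) auto
      show ?thesis unfolding T_def
        apply (rule runs_If[where T' = "4 + size (?e p) + T1 (fst p) + poly q (size (?e p))"])
        subgoal using s Nil by (cases p) (simp add: enc_pair_def)
        subgoal using s 1(1)
          by (intro runs_Seq[OF runs_Assign[where T = "3 + size (?e p)"], where ?T2.0 = "T1 (fst p)"] runs_mono[OF 1(4)[of _ "fst p"]])
             (auto simp: Nil enc_pair_def split: prod.splits)
        subgoal using s by simp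
        done
    next
      case (Cons y ys)
      have p: "p = (fst p, y # ys)" using Cons by (cases p) auto
      have sz: "size (?e p) = size (enc_pair e (enc_pair e1 (enc_list e1)) (fst p, y, ys))"
        by (subst p) simp
      have s0: "s 0 = enc_pair e (enc_pair e1 (enc_list e1)) (fst p, y, ys)"
        using s Cons by (cases p) (simp add: enc_pair_def)
      show ?thesis unfolding T_def
        apply (rule runs_If[where T' = "4 + size (?e p) + T1 (fst p) + poly q (size (?e p))"])
        subgoal using q[of "(fst p, y, ys)"]
          by (intro runs_mono[OF 2(3)[of s "(fst p, y, ys)", OF s0]]) (auto simp: Cons sz)
        subgoal using s0 by (simp add: enc_pair_def)
        subgoal using s by simp
        done
    qed
  qed (use 1 in auto)
qed

lemma polyt_case_list [polyt_intros]:
  assumes "polyt e (enc_list e1) l" "polyt e e2 n"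
    "polyt (enc_pair e (enc_pair e1 (enc_list e1))) e2 (\<lambda>p. c (fst p) (fst (snd p)) (snd (snd p)))"
  shows "polyt e e2 (\<lambda>x. case l x of [] \<Rightarrow> n x | y # ys \<Rightarrow> c x y ys)"
  using polyt_comp[OF polyt_case_list_prim[OF assms(2,3)] polyt_pair[OF polyt_id assms(1)]]
  unfolding fst_conv snd_conv .

text \<open>A polynomial-time step may double the accumulator each time. As \<open>M\<close> holds
  after every prefix of the list, every round works on polynomially large data, and there are at
  most as many rounds as the size of the encoded list.\<close>

lemma polyt_foldl:
  assumes l: "polyt e (enc_list ey) l" and i: "polyt e ea i"
    and F: "polyt (enc_pair (enc_pair e ea) ey) ea (\<lambda>p. F (fst (fst p)) (snd (fst p)) (snd p))"
    and M: "pbound e M" "\<And>x ys zs. l x = ys @ zs \<Longrightarrow> size (ea (foldl (F x) (i x) ys)) \<le> M x"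
  shows "polyt e ea (\<lambda>x. foldl (F x) (i x) (l x))"
proof -
  obtain c1 k1 T1 where 1: "0 < k1" "pbound e T1" "\<And>x. size (enc_list ey (l x)) \<le> T1 x"
    "\<And>x s. s 0 = e x \<Longrightarrow> runs c1 s (T1 x) (\<lambda>s'. s' 0 = enc_list ey (l x) \<and> (\<forall>i\<ge>k1. s' i = s i))"
    using l by (rule polytE) blast
  obtain c2 k2 T2 where 2: "0 < k2" "pbound e T2" "\<And>x. size (ea (i x)) \<le> T2 x"
    "\<And>x s. s 0 = e x \<Longrightarrow> runs c2 s (T2 x) (\<lambda>s'. s' 0 = ea (i x) \<and> (\<forall>i\<ge>k2. s' i = s i))"
    using i by (rule polytE) blast
  obtain c3 k3 T3 where 3: "0 < k3" "pbound (enc_pair (enc_pair e ea) ey) T3"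
    "\<And>x s. s 0 = enc_pair (enc_pair e ea) ey x \<Longrightarrow> runs c3 s (T3 x)
       (\<lambda>s'. s' 0 = ea (F (fst (fst x)) (snd (fst x)) (snd x)) \<and> (\<forall>i\<ge>k3. s' i = s i))"
    using F by (rule polytE) blast
  obtain q where q: "\<And>x. T3 x \<le> poly q (size (enc_pair (enc_pair e ea) ey x))"
    using 3(2) unfolding pbound_def by blast
  define k where "k = max k1 (max k2 k3)"
  have k: "k1 \<le> k" "k2 \<le> k" "k3 \<le> k" "0 < k" using 1 by (auto simp: k_def)
  \<comment> \<open>Register \<open>k\<close> holds the context, \<open>k+1\<close> the rest of the
    list, and register 0 the accumulator.\<close>
  let ?b = "Seq (Assign 0 (Join (Join (Var k) (Var 0)) (Hd (Var (k+1))))) (Seq c3 (Assign (k+1) (Tl (Var (k+1)))))"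
  let ?w = "While (Var (k+1)) ?b"
  let ?c = "Seq (Assign k (Var 0)) (Seq c1 (Seq (Assign (k+1) (Var 0)) (Seq (Assign 0 (Var k)) (Seq c2 ?w))))"
  \<comment> \<open>\<open>W x\<close> bounds one round. The argument of \<open>q\<close> is the
    largest possible size of the triple of context, accumulator and element.\<close>
  define W where "W = (\<lambda>x. 30 + 4 * T1 x + M x + size (e x) + poly q (2 + size (e x) + M x + T1 x))"
  let ?Q = "\<lambda>x s s'. s' 0 = ea (foldl (F x) (i x) (l x)) \<and> (\<forall>i\<ge>k+2. s' i = s i)"
  have loop: "runs ?w s (length zs * W x + 2) (?Q x s0)"
    if "l x = ys @ zs" "s 0 = ea (foldl (F x) (i x) ys)" "s k = e x" "s (k+1) = enc_list ey zs"
      "\<forall>i\<ge>k+2. s i = s0 i" for x ys zs s s0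
    using that
  proof (induction zs arbitrary: ys s)
    case Nil
    then show ?case by (intro runs_While_Atom) auto
  next
    case (Cons z zs)
    let ?a = "foldl (F x) (i x) ys"
    have szl: "size (enc_list ey (z # zs)) \<le> T1 x" using 1(3)[of x] Cons.prems(1) by simp
    have sza: "size (ea ?a) \<le> M x" using M(2)[OF Cons.prems(1)] .
    have t3: "T3 ((x, ?a), z) \<le> poly q (2 + size (e x) + M x + T1 x)"
      by (rule le_trans[OF q poly_nat_mono]) (use szl sza in simp)
    have step3: "runs (Assign (k+1) (Tl (Var (k+1)))) s' (3 + T1 x) (\<lambda>s'. runs ?w s' (length zs * W x + 2) (?Q x s0))"
      if "s' 0 = ea (F x ?a z)" "s' k = e x" "s' (k+1) = enc_list ey (z # zs)" "\<forall>i\<ge>k+2. s' i = s0 i" for s'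
      apply (rule runs_Assign)
      subgoal by (rule Cons.IH[of "ys @ [z]"]) (use that k Cons.prems(1) in auto)
      subgoal using that szl by simp
      done
    have step2: "runs (Seq c3 (Assign (k+1) (Tl (Var (k+1))))) s' (4 + T1 x + T3 ((x, ?a), z)) (\<lambda>s'. runs ?w s' (length zs * W x + 2) (?Q x s0))"
      if "s' 0 = enc_pair (enc_pair e ea) ey ((x, ?a), z)" "s' k = e x" "s' (k+1) = enc_list ey (z # zs)" "\<forall>i\<ge>k+2. s' i = s0 i" for s'
      apply (rule runs_Seq[where ?T1.0 = "T3 ((x, ?a), z)" and ?T2.0 = "3 + T1 x"])
       apply (rule runs_mono[OF 3(3)[of s' "((x, ?a), z)"]])
         apply (rule that(1))
        apply (rule step3)
      using that k by auto
    have "runs ?b s (12 + size (e x) + M x + 2 * T1 x + T3 ((x, ?a), z)) (\<lambda>s'. runs ?w s' (length zs * W x + 2) (?Q x s0))"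
      apply (rule runs_Seq[where ?T1.0 = "7 + size (e x) + M x + T1 x" and ?T2.0 = "4 + T1 x + T3 ((x, ?a), z)"])
       apply (rule runs_mono[OF runs_Assign[where T = "7 + size (e x) + M x + T1 x"]])
          apply (rule step2)
      using Cons.prems k szl sza by (auto simp: enc_pair_def)
    then show ?case
      apply (rule runs_While_Node[rotated])
      using Cons.prems k szl t3 by (auto simp: W_def)
  qed
  define T where "T = (\<lambda>x. 20 + (2 * T1 x + T2 x + 2 * size (e x) + T1 x * W x))"
  show ?thesis
  proof (rule polytI[where k = "k+2" and c = ?c and T = T])
    show "pbound e T" unfolding T_def W_def by (intro pbound_intros 1 2 M)
    fix x and s :: store assume s: "s 0 = e x"
    have len: "length (l x) * W x \<le> T1 x * W x"
      using le_trans[OF length_le_size 1(3)] by (rule mult_le_mono1)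
    have a5: "runs (Seq c2 ?w) s' (3 + T2 x + T1 x * W x) (?Q x s)"
      if "s' 0 = e x" "s' k = e x" "s' (k+1) = enc_list ey (l x)" "\<forall>i\<ge>k+2. s' i = s i" for s'
      apply (rule runs_Seq[where ?T1.0 = "T2 x" and ?T2.0 = "length (l x) * W x + 2"])
       apply (rule runs_mono[OF 2(4)[of _ x]])
         apply (rule that(1))
        apply (rule loop[where ys = "[]"])
      using that k len by auto
    have a4: "runs (Seq (Assign 0 (Var k)) (Seq c2 ?w)) s' (6 + size (e x) + T2 x + T1 x * W x) (?Q x s)"
      if "s' k = e x" "s' (k+1) = enc_list ey (l x)" "\<forall>i\<ge>k+2. s' i = s i" for s'
      apply (rule runs_Seq[OF runs_Assign[where T = "2 + size (e x)"], where ?T2.0 = "3 + T2 x + T1 x * W x"])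
        apply (rule a5)
      using that k by auto
    have a3: "runs (Seq (Assign (k+1) (Var 0)) (Seq (Assign 0 (Var k)) (Seq c2 ?w))) s' (9 + T1 x + size (e x) + T2 x + T1 x * W x) (?Q x s)"
      if "s' k = e x" "s' 0 = enc_list ey (l x)" "\<forall>i\<ge>k+2. s' i = s i" for s'
      apply (rule runs_Seq[OF runs_Assign[where T = "2 + T1 x"], where ?T2.0 = "6 + size (e x) + T2 x + T1 x * W x"])
        apply (rule a4)
      using that k 1(3)[of x] by auto
    have a2: "runs (Seq c1 (Seq (Assign (k+1) (Var 0)) (Seq (Assign 0 (Var k)) (Seq c2 ?w)))) s' (10 + 2 * T1 x + size (e x) + T2 x + T1 x * W x) (?Q x s)"
      if "s' k = e x" "s' 0 = e x" "\<forall>i\<ge>k+2. s' i = s i" for s'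
      apply (rule runs_Seq[OF runs_mono[OF 1(4)[of s' x, OF that(2)]], where ?T2.0 = "9 + T1 x + size (e x) + T2 x + T1 x * W x"])
        apply (rule a3)
      using that k by auto
    show "runs ?c s (T x) (?Q x s)"
      apply (rule runs_Seq[OF runs_Assign[where T = "2 + size (e x)"], where ?T2.0 = "10 + 2 * T1 x + size (e x) + T2 x + T1 x * W x"])
        apply (rule a2)
      using s k by (auto simp: T_def)
  qed simp
qed

lemma polyt_cong: "polyt e e1 f \<Longrightarrow> (\<And>x. e2 (g x) = e1 (f x)) \<Longrightarrow> polyt e e2 g"
  unfolding polyt_def by simp

text \<open>Inside \<open>map\<close>, \<open>filter\<close> or a fold the context is a pair, so a
  fact about a function of the original context has to be composed with a projection. These rules do
  so and leave the arguments to \<open>polyt_intros\<close>.\<close>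

lemma polyt_app1: "polyt e ec F \<Longrightarrow> polyt E e a \<Longrightarrow> polyt E ec (\<lambda>x. F (a x))"
  by (rule polyt_comp)

lemma polyt_app2:
  assumes "polyt (enc_pair e ea) ec (\<lambda>p. F (fst p) (snd p))" "polyt E e a" "polyt E ea b"
  shows "polyt E ec (\<lambda>x. F (a x) (b x))"
  using polyt_comp[OF assms(1) polyt_pair[OF assms(2,3)]] by simp

lemma polyt_app3:
  assumes "polyt (enc_pair e (enc_pair ea eb)) ec (\<lambda>p. F (fst p) (fst (snd p)) (snd (snd p)))"
    "polyt E e a" "polyt E ea b" "polyt E eb c"
  shows "polyt E ec (\<lambda>x. F (a x) (b x) (c x))"
  using polyt_comp[OF assms(1) polyt_pair[OF assms(2) polyt_pair[OF assms(3,4)]]] by simp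

lemma polyt_not [polyt_intros]: "polyt e enc_bool b \<Longrightarrow> polyt e enc_bool (\<lambda>x. \<not> b x)"
  by (rule polyt_cong[OF polyt_if[OF _ polyt_const[of _ enc_bool False] polyt_const[of _ enc_bool True]]]) auto

lemma polyt_conj [polyt_intros]:
  assumes "polyt e enc_bool a" "polyt e enc_bool b" shows "polyt e enc_bool (\<lambda>x. a x \<and> b x)"
proof -
  have "polyt e enc_bool (\<lambda>x. if a x then b x else False)" by (rule polyt_intros assms)+
  then show ?thesis by (rule polyt_cong) simp
qed

lemma polyt_disj [polyt_intros]:
  assumes "polyt e enc_bool a" "polyt e enc_bool b" shows "polyt e enc_bool (\<lambda>x. a x \<or> b x)"
proof -
  have "polyt e enc_bool (\<lambda>x. if a x then True else b x)" by (rule polyt_intros assms)+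
  then show ?thesis by (rule polyt_cong) simp
qed

section \<open>Lists\<close>

lemma polyt_rev_append:
  assumes l: "polyt e (enc_list e1) l" and a: "polyt e (enc_list e1) a"
  shows "polyt e (enc_list e1) (\<lambda>x. rev (l x) @ a x)"
proof -
  have eq: "foldl (\<lambda>a y. y # a) a xs = rev xs @ a" for a xs :: "'b list"
    by (induction xs arbitrary: a) auto
  have "polyt e (enc_list e1) (\<lambda>x. foldl (\<lambda>a y. y # a) (a x) (l x))"
  proof (rule polyt_foldl[OF l a])
    show "pbound e (\<lambda>x. size (enc_list e1 (l x)) + size (enc_list e1 (a x)))"
      by (intro pbound_intros pbound_size_polyt l a)
  qed ((rule polyt_intros)+, simp add: eq)
  then show ?thesis by (simp add: eq)
qed

lemma polyt_rev [polyt_intros]: "polyt e (enc_list e1) l \<Longrightarrow> polyt e (enc_list e1) (\<lambda>x. rev (l x))"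
  using polyt_rev_append[of e e1 l "\<lambda>_. []"] by (simp add: polyt_const)

lemma polyt_append [polyt_intros]:
  "polyt e (enc_list e1) l \<Longrightarrow> polyt e (enc_list e1) a \<Longrightarrow> polyt e (enc_list e1) (\<lambda>x. l x @ a x)"
  using polyt_rev_append[OF polyt_rev] by fastforce

text \<open>The source of the rules for \<open>map\<close> and \<open>filter\<close>. An element has
  a smaller encoding than its list, so one value of the polynomial \<open>q\<close> bounds the
  images of all elements.\<close>

lemma polyt_concat_map [polyt_intros]:
  assumes l: "polyt e (enc_list e1) l"
    and F: "polyt (enc_pair e e1) (enc_list e2) (\<lambda>p. F (fst p) (snd p))"
  shows "polyt e (enc_list e2) (\<lambda>x. concat (map (F x) (l x)))"
proof -
  note F' = polyt_app2[OF F]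
  have eq: "foldl (\<lambda>a y. rev (F x y) @ a) a xs = rev (concat (map (F x) xs)) @ a" for a xs x
    by (induction xs arbitrary: a) auto
  obtain q where q: "\<And>p. size (enc_list e2 (F (fst p) (snd p))) \<le> poly q (size (enc_pair e e1 p))"
    using pbound_size_polyt[OF F] unfolding pbound_def by blast
  define M where "M = (\<lambda>x. size (enc_list e1 (l x)) * Suc (poly q (1 + size (e x) + size (enc_list e1 (l x)))))"
  have b: "size (enc_list e2 (concat (map (F x) ys))) \<le> M x" if "l x = ys @ zs" for x ys zs
  proof -
    have "size (enc_list e2 (F x y)) \<le> poly q (1 + size (e x) + size (enc_list e1 (l x)))" if "y \<in> set ys" for y
    proof -
      have "y \<in> set (l x)" using that \<open>l x = ys @ zs\<close> by simp
      then have "size (e1 y) \<le> size (enc_list e1 (l x))" by (metis size_elem less_imp_le)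
      then show ?thesis by (intro le_trans[OF q[of "(x, y)", simplified] poly_nat_mono]) simp
    qed
    then have "size (enc_list e2 (concat (map (F x) ys))) \<le> length ys * poly q (1 + size (e x) + size (enc_list e1 (l x)))"
      by (induction ys) (auto intro: add_mono)
    also have "\<dots> \<le> M x" unfolding M_def
      using length_le_size[of ys e1] that by (intro mult_mono) auto
    finally show ?thesis .
  qed
  have "polyt e (enc_list e2) (\<lambda>x. foldl (\<lambda>a y. rev (F x y) @ a) [] (l x))"
  proof (rule polyt_foldl[OF l polyt_const])
    show "pbound e M" unfolding M_def by (intro pbound_intros pbound_size_polyt l)
  qed ((rule polyt_intros polyt_rev_append F')+, simp add: eq b)
  from polyt_rev[OF this] show ?thesis by (simp add: eq)
qed

lemma polyt_map [polyt_intros]: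
  assumes "polyt e (enc_list e1) l" "polyt (enc_pair e e1) e2 (\<lambda>p. F (fst p) (snd p))"
  shows "polyt e (enc_list e2) (\<lambda>x. map (F x) (l x))"
proof -
  have "polyt e (enc_list e2) (\<lambda>x. concat (map (\<lambda>y. [F x y]) (l x)))"
    by (rule polyt_intros assms)+
  then show ?thesis by simp
qed

lemma polyt_filter [polyt_intros]:
  assumes "polyt e (enc_list e1) l" "polyt (enc_pair e e1) enc_bool (\<lambda>p. P (fst p) (snd p))"
  shows "polyt e (enc_list e1) (\<lambda>x. filter (P x) (l x))"
proof -
  have eq: "concat (map (\<lambda>y. if P x y then [y] else []) l) = filter (P x) l" for x l
    by (induction l) auto
  have "polyt e (enc_list e1) (\<lambda>x. concat (map (\<lambda>y. if P x y then [y] else []) (l x)))"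
    by (rule polyt_intros assms)+
  then show ?thesis by (simp add: eq)
qed

lemma polyt_member [polyt_intros]:
  assumes "polyt e e1 a" "polyt e (enc_list e1) l" "inj e1"
  shows "polyt e enc_bool (\<lambda>x. a x \<in> set (l x))"
proof -
  note a = polyt_app1[OF assms(1)]
  have eq: "(case filter (\<lambda>y. y = a) l of [] \<Rightarrow> False | y # ys \<Rightarrow> True) \<longleftrightarrow> a \<in> set l" for a l
    by (induction l) auto
  have "polyt e enc_bool (\<lambda>x. case filter (\<lambda>y. y = a x) (l x) of [] \<Rightarrow> False | y # ys \<Rightarrow> True)"
    by (rule polyt_intros assms a)+
  then show ?thesis by (rule polyt_cong) (rule arg_cong[OF eq[symmetric]])
qed

lemma polyt_zip [polyt_intros]:
  assumes a: "polyt e (enc_list e1) a" and b: "polyt e (enc_list e2) b"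
  shows "polyt e (enc_list (enc_pair e1 e2)) (\<lambda>x. zip (a x) (b x))"
proof -
  \<comment> \<open>The fold runs over the second list and carries what remains of the first,
    together with the reversed result.\<close>
  let ?F = "\<lambda>s y. case fst s of [] \<Rightarrow> ([], snd s) | z # zs \<Rightarrow> (zs, (z, y) # snd s)"
  have eq: "foldl ?F (us, acc) ys = (drop (length ys) us, rev (zip us ys) @ acc)"
    for us :: "'b list" and ys :: "'c list" and acc
    by (induction ys arbitrary: us acc) (auto split: list.splits)
  have d: "size (enc_list f (drop n xs)) \<le> size (enc_list f xs)" for n and xs :: "'b list" and f
    by (induction xs arbitrary: n) (auto simp: drop_Cons' intro: le_SucI trans_le_add2)
  have z: "size (enc_list (enc_pair e1 e2) (zip xs ys)) \<le> size (enc_list e1 xs) + size (enc_list e2 ys)" for xs ys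
    by (induction xs ys rule: list_induct2') auto
  have "polyt e (enc_pair (enc_list e1) (enc_list (enc_pair e1 e2))) (\<lambda>x. foldl ?F (a x, []) (b x))"
  proof (rule polyt_foldl[OF b])
    show "pbound e (\<lambda>x. 1 + size (enc_list e1 (a x)) + (size (enc_list e1 (a x)) + size (enc_list e2 (b x))))"
      by (intro pbound_intros pbound_size_polyt a b)
    fix x ys zs assume "b x = ys @ zs"
    then have "size (enc_list e2 ys) \<le> size (enc_list e2 (b x))" by simp
    then show "size (enc_pair (enc_list e1) (enc_list (enc_pair e1 e2)) (foldl ?F (a x, []) ys))
       \<le> 1 + size (enc_list e1 (a x)) + (size (enc_list e1 (a x)) + size (enc_list e2 (b x)))"
      using d[of e1 "length ys" "a x"] z[of "a x" ys] by (simp add: eq)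
  qed (rule polyt_intros a)+
  from polyt_rev[OF polyt_snd[OF this]] show ?thesis by (simp add: eq)
qed

text \<open>At most one element, an empty list standing for the minimum of an empty list.\<close>

definition bestl :: "('a \<Rightarrow> 'a \<Rightarrow> bool) \<Rightarrow> 'a list \<Rightarrow> 'a list" where
  "bestl lt = foldl (\<lambda>acc y. case acc of [] \<Rightarrow> [y] | z # zs \<Rightarrow> if lt y z then [y] else acc) []"

text \<open>The key \<open>f\<close> belongs to the analysis only; the program sees the comparison
  \<open>lt\<close>, which has to agree with \<open>f\<close> just on the elements of the
  list.\<close>

lemma bestl_cases:
  assumes "\<And>a b. a \<in> set xs \<Longrightarrow> b \<in> set xs \<Longrightarrow> lt a b \<longleftrightarrow> f a < (f b :: 'k :: linorder)"
  shows "xs = [] \<and> bestl lt xs = [] \<or> (\<exists>y\<in>set xs. bestl lt xs = [y] \<and> (\<forall>z\<in>set xs. f y \<le> f z))"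
  using assms
proof (induction xs rule: rev_induct)
  case (snoc x xs)
  consider "xs = []" "bestl lt xs = []" | y where "y \<in> set xs" "bestl lt xs = [y]" "\<forall>z\<in>set xs. f y \<le> f z"
    using snoc.IH snoc.prems by fastforce
  then show ?case
  proof cases
    case 2
    have b: "bestl lt (xs @ [x]) = (if lt x y then [x] else [y])" using 2 by (simp add: bestl_def)
    have lt: "lt x y \<longleftrightarrow> f x < f y" using snoc.prems[of x y] 2 by simp
    show ?thesis
    proof (cases "f x < f y")
      case True
      with b lt 2 have "bestl lt (xs @ [x]) = [x] \<and> (\<forall>z\<in>set (xs @ [x]). f x \<le> f z)" by force
      then show ?thesis by auto
    next
      case False
      with b lt 2 have "bestl lt (xs @ [x]) = [y] \<and> (\<forall>z\<in>set (xs @ [x]). f y \<le> f z)" by auto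
      then show ?thesis using 2 by auto
    qed
  qed (simp add: bestl_def)
qed (simp add: bestl_def)

lemma bestl_subset: "bestl lt xs = [] \<or> (\<exists>y\<in>set xs. bestl lt xs = [y])"
proof (induction xs rule: rev_induct)
  case (snoc x xs)
  then show ?case by (auto simp: bestl_def split: list.splits)
qed (simp add: bestl_def)

lemma bestl_in: "y \<in> set (bestl lt xs) \<Longrightarrow> y \<in> set xs"
  using bestl_subset[of lt xs] by auto

lemma polyt_bestl [polyt_intros]:
  assumes l: "polyt e (enc_list e1) l"
    and lt: "polyt (enc_pair e (enc_pair e1 e1)) enc_bool (\<lambda>p. lt (fst p) (fst (snd p)) (snd (snd p)))"
  shows "polyt e (enc_list e1) (\<lambda>x. bestl (lt x) (l x))"
proof -
  note lt' = polyt_app3[OF lt]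
  show ?thesis unfolding bestl_def
  proof (rule polyt_foldl[OF l polyt_const])
    show "pbound e (\<lambda>x. size (enc_list e1 (l x)))" by (intro pbound_size_polyt l)
    fix x ys zs assume *: "l x = ys @ zs"
    show "size (enc_list e1 (foldl (\<lambda>acc y. case acc of [] \<Rightarrow> [y] | z # zs \<Rightarrow> if lt x y z then [y] else acc) [] ys))
       \<le> size (enc_list e1 (l x))"
      using bestl_subset[of "lt x" ys] size_elem[of _ ys e1] unfolding bestl_def * by fastforce
  qed (rule polyt_intros lt')+
qed

section \<open>Binary numbers\<close>

lemma inj_enc_bool: "inj enc_bool"
  by (auto simp: inj_def enc_bool_def split: if_splits)

text \<open>The bit list of \<open>n\<close> has literally the same encoding as \<open>n\<close>, so
  arithmetic can be programmed with list operations.\<close>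

fun bits :: "nat \<Rightarrow> bool list" where
  "bits n = (if n = 0 then [] else odd n # bits (n div 2))"

declare bits.simps [simp del]

lemma enc_list_bits: "enc_list enc_bool (bits n) = enc_nat n"
  by (induction n rule: bits.induct) (simp add: bits.simps enc_nat.simps)

fun nat_of_bits :: "bool list \<Rightarrow> nat" where
  "nat_of_bits [] = 0"
| "nat_of_bits (b # bs) = of_bool b + 2 * nat_of_bits bs"

lemma nat_of_bits_bits [simp]: "nat_of_bits (bits n) = n"
  by (induction n rule: bits.induct) (subst bits.simps, auto simp: of_bool_def)

lemma nat_of_bits_less: "nat_of_bits bs < 2 ^ length bs"
  by (induction bs) auto

lemma nat_of_bits_append: "nat_of_bits (xs @ ys) = nat_of_bits xs + 2 ^ length xs * nat_of_bits ys"
  by (induction xs) (auto simp: algebra_simps)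

lemma inj_enc_list: "inj f \<Longrightarrow> inj (enc_list f)"
proof (rule injI)
  fix xs ys assume "inj f" "enc_list f xs = enc_list f ys"
  then show "xs = ys" by (induction xs ys rule: list_induct2') (auto dest: injD)
qed

lemma inj_enc_nat: "inj enc_nat"
  by (metis enc_list_bits inj_def inj_enc_bool inj_enc_list nat_of_bits_bits)

lemma inj_enc_pair: "inj f \<Longrightarrow> inj g \<Longrightarrow> inj (enc_pair f g)"
  by (auto simp: inj_def enc_pair_def)

lemmas [polyt_intros] = inj_enc_bool inj_enc_nat inj_enc_pair

lemma less_exp_size_enc_nat: "n < 2 ^ size (enc_nat n)"
  using nat_of_bits_less[of "bits n"] length_le_size[of "bits n" enc_bool]
  by (metis nat_of_bits_bits enc_list_bits less_le_trans one_le_numeral power_increasing)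

text \<open>A bit costs one node of the list and, if set, another one of its own; hence the factor
  2.\<close>

lemma size_enc_nat_le: "n < 2 ^ k \<Longrightarrow> size (enc_nat n) \<le> 2 * k"
proof (induction k arbitrary: n)
  case (Suc k)
  then have "size (enc_nat (n div 2)) \<le> 2 * k" by simp
  then show ?case by (subst enc_nat.simps) (simp add: enc_bool_def)
qed (simp add: enc_nat.simps)

text \<open>Sizes themselves are not monotone, because set bits are larger: 7 has size 6, but 8 has
  size 5.\<close>

lemma size_enc_nat_mono: "m \<le> n \<Longrightarrow> size (enc_nat m) \<le> 2 * size (enc_nat n)"
  by (rule size_enc_nat_le) (rule le_less_trans[OF _ less_exp_size_enc_nat])

lemma polyt_bits [polyt_intros]: "polyt e enc_nat f \<Longrightarrow> polyt e (enc_list enc_bool) (\<lambda>x. bits (f x))"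
  by (erule polyt_cong) (rule enc_list_bits)

lemma polyt_odd [polyt_intros]:
  assumes "polyt e enc_nat f" shows "polyt e enc_bool (\<lambda>x. odd (f x))"
proof -
  have "polyt e enc_bool (\<lambda>x. case bits (f x) of [] \<Rightarrow> False | b # bs \<Rightarrow> b)"
    by (rule polyt_intros assms)+
  then show ?thesis by (rule polyt_cong) (simp add: bits.simps[of "f _"])
qed

lemma polyt_div2 [polyt_intros]:
  assumes "polyt e enc_nat f" shows "polyt e enc_nat (\<lambda>x. f x div 2)"
proof -
  have "polyt e (enc_list enc_bool) (\<lambda>x. case bits (f x) of [] \<Rightarrow> [] | b # bs \<Rightarrow> bs)"
    by (rule polyt_intros assms)+
  then show ?thesis by (rule polyt_cong) (simp add: bits.simps[of "f _"] enc_list_bits enc_nat.simps[of 0])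
qed

lemma polyt_double:
  assumes "polyt e enc_bool b" "polyt e enc_nat f"
  shows "polyt e enc_nat (\<lambda>x. of_bool (b x) + 2 * f x)"
proof -
  \<comment> \<open>Zero is encoded by the empty list, so a vanishing top bit must not be
    written.\<close>
  have "polyt e (enc_list enc_bool) (\<lambda>x. if f x = 0 \<and> \<not> b x then [] else b x # bits (f x))"
    by (rule polyt_intros assms)+
  then show ?thesis
    by (rule polyt_cong) (auto simp: enc_list_bits enc_nat.simps[of 0] enc_nat.simps[of "Suc _"] enc_nat.simps[of "2 * _"])
qed

lemma polyt_nat_of_bits [polyt_intros]:
  assumes "polyt e (enc_list enc_bool) l" shows "polyt e enc_nat (\<lambda>x. nat_of_bits (l x))"
proof -
  have eq: "foldl (\<lambda>a b. of_bool b + 2 * a) 0 bs = nat_of_bits (rev bs)" for bs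
    by (induction bs rule: rev_induct) auto
  have "polyt e enc_nat (\<lambda>x. foldl (\<lambda>a b. of_bool b + 2 * a) 0 (rev (l x)))"
  proof (rule polyt_foldl[OF polyt_rev[OF assms] polyt_const])
    show "pbound e (\<lambda>x. 2 * size (enc_list enc_bool (l x)))"
      by (intro pbound_intros pbound_size_polyt assms)
    fix x ys zs assume "rev (l x) = ys @ zs"
    then have "length ys \<le> length (l x)" by (metis length_append length_rev le_add1)
    then have "length ys \<le> size (enc_list enc_bool (l x))" using length_le_size le_trans by blast
    then show "size (enc_nat (foldl (\<lambda>a b. of_bool b + 2 * a) 0 ys)) \<le> 2 * size (enc_list enc_bool (l x))"
      using size_enc_nat_le[OF nat_of_bits_less[of "rev ys"]] by (simp add: eq)
  qed (rule polyt_double polyt_intros)+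
  then show ?thesis by (simp add: eq)
qed

text \<open>A ripple-carry adder. The state holds the rests of both numbers, the carry, and the sum
  bits with the latest in front; the list it is folded over is only a clock. The nested equality is
  the exclusive or of three bits.\<close>

definition add_step :: "nat \<times> nat \<times> bool \<times> bool list \<Rightarrow> bool \<Rightarrow> nat \<times> nat \<times> bool \<times> bool list" where
  "add_step s _ = (fst s div 2, fst (snd s) div 2,
     (if odd (fst s) then odd (fst (snd s)) \<or> fst (snd (snd s)) else odd (fst (snd s)) \<and> fst (snd (snd s))),
     ((odd (fst s) = odd (fst (snd s))) = fst (snd (snd s))) # snd (snd (snd s)))"

lemma add_step_invariant:
  "case foldl add_step (m, n, False, []) l of (m', n', c, res) \<Rightarrow>
     m' \<le> m \<and> n' \<le> n \<and> length res = length l \<and>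
     nat_of_bits (rev res) + 2 ^ length l * (m' + n' + of_bool c) = m + n"
proof (induction l rule: rev_induct)
  case (snoc x l)
  obtain m' n' c res where s: "foldl add_step (m, n, False, []) l = (m', n', c, res)"
    by (metis prod_cases4)
  have IH: "m' \<le> m" "n' \<le> n" "length res = length l"
    "nat_of_bits (rev res) + 2 ^ length l * (m' + n' + of_bool c) = m + n"
    using snoc by (auto simp: s)
  define m2 n2 where "m2 = m' div 2" and "n2 = n' div 2"
  have "m' = of_bool (odd m') + 2 * m2" "n' = of_bool (odd n') + 2 * n2"
    by (auto simp: m2_def n2_def of_bool_def)
  then obtain a b where ab: "odd m' = a" "odd n' = b" "m' = of_bool a + 2 * m2" "n' = of_bool b + 2 * n2" by blast
  have "m2 \<le> m" "n2 \<le> n" using IH(1,2) by (auto simp: m2_def n2_def)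
  then show ?case
    using IH(3,4) ab(1,2) unfolding foldl_append s
    by (cases a; cases b; cases c)
       (simp_all add: add_step_def nat_of_bits_append ab(3,4) algebra_simps flip: m2_def n2_def)
qed simp

lemma polyt_add [polyt_intros]:
  assumes f: "polyt e enc_nat f" and g: "polyt e enc_nat g"
  shows "polyt e enc_nat (\<lambda>x. f x + g x)"
proof -
  \<comment> \<open>The length of the clock only has to satisfy
    \<open>f x + g x < 2 ^ length (?l x)\<close>; the additional element makes room for the last
    carry.\<close>
  let ?l = "\<lambda>x. True # bits (f x) @ bits (g x)"
  let ?s = "\<lambda>x. foldl add_step (f x, g x, False, []) (?l x)"
  have l: "polyt e (enc_list enc_bool) ?l" by (rule polyt_intros f g)+
  have "polyt e (enc_pair enc_nat (enc_pair enc_nat (enc_pair enc_bool (enc_list enc_bool)))) ?s"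
  proof (rule polyt_foldl[OF l])
    show "pbound e (\<lambda>x. 4 + (2 * size (enc_nat (f x)) + 2 * size (enc_nat (g x)) + 2 * size (enc_list enc_bool (?l x))))"
      by (intro pbound_intros pbound_size_polyt f g l)
    fix x ys zs assume "?l x = ys @ zs"
    then have "length ys \<le> size (enc_list enc_bool (?l x))"
      using length_le_size[of "?l x" enc_bool] by (simp only: length_append)
    moreover obtain m' n' c res where s: "foldl add_step (f x, g x, False, []) ys = (m', n', c, res)"
      by (metis prod_cases4)
    moreover have "m' \<le> f x" "n' \<le> g x" "length res = length ys"
      using add_step_invariant[of "f x" "g x" ys] by (auto simp: s)
    moreover have "size (enc_list enc_bool res) \<le> 2 * length res"
      using size_enc_list_le[of res enc_bool 1] by (simp add: enc_bool_def size_enc_list sum_list_mono mult_2)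
    moreover have "size (enc_nat m') \<le> 2 * size (enc_nat (f x))" "size (enc_nat n') \<le> 2 * size (enc_nat (g x))"
      using calculation by (auto intro: size_enc_nat_mono)
    moreover have "size (enc_bool c) \<le> 1" by (simp add: enc_bool_def)
    ultimately show "size (enc_pair enc_nat (enc_pair enc_nat (enc_pair enc_bool (enc_list enc_bool))) (foldl add_step (f x, g x, False, []) ys))
      \<le> 4 + (2 * size (enc_nat (f x)) + 2 * size (enc_nat (g x)) + 2 * size (enc_list enc_bool (?l x)))"
      by (simp only: s size_enc_pair fst_conv snd_conv)
  qed (unfold add_step_def, (rule polyt_intros f g)+)
  note polyt_nat_of_bits[OF polyt_rev[OF polyt_snd[OF polyt_snd[OF polyt_snd[OF this]]]]]
  moreover have "nat_of_bits (rev (snd (snd (snd (?s x))))) = f x + g x" for x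
  proof -
    obtain m' n' c res where s: "?s x = (m', n', c, res)" by (metis prod_cases4)
    have eq: "nat_of_bits (rev res) + 2 ^ length (?l x) * (m' + n' + of_bool c) = f x + g x"
      using add_step_invariant[of "f x" "g x" "?l x"] unfolding s by simp
    have "f x < 2 ^ length (bits (f x))" "g x < 2 ^ length (bits (g x))"
      using nat_of_bits_less[of "bits (f x)"] nat_of_bits_less[of "bits (g x)"] by simp_all
    moreover have "(2::nat) ^ length (bits (f x)) \<le> 2 ^ (length (bits (f x)) + length (bits (g x)))"
      "(2::nat) ^ length (bits (g x)) \<le> 2 ^ (length (bits (f x)) + length (bits (g x)))"
      by (simp_all add: power_increasing)
    ultimately have "f x + g x < 2 ^ (length (bits (f x)) + length (bits (g x))) + 2 ^ (length (bits (f x)) + length (bits (g x)))"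
      by linarith
    then have less: "f x + g x < 2 ^ length (?l x)" by simp
    \<comment> \<open>A non-zero rest would contribute at least \<open>2 ^ length (?l x)\<close>,
      which exceeds the whole sum.\<close>
    have "m' + n' + of_bool c = 0"
    proof (rule ccontr)
      assume "m' + n' + of_bool c \<noteq> 0"
      then have "2 ^ length (?l x) * 1 \<le> 2 ^ length (?l x) * (m' + n' + of_bool c)"
        by (intro mult_le_mono2) linarith
      then show False using eq less by linarith
    qed
    then show ?thesis unfolding s using eq by simp
  qed
  ultimately show ?thesis by simp
qed

text \<open>The comparison starts at the least significant bit, so a differing pair of bits
  overrides the verdict on the lower ones.\<close>

definition le_step :: "nat \<times> nat \<times> bool \<Rightarrow> bool \<Rightarrow> nat \<times> nat \<times> bool" where
  "le_step s _ = (fst s div 2, fst (snd s) div 2,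
     (if odd (fst s) = odd (fst (snd s)) then snd (snd s) else odd (fst (snd s))))"

lemma le_step_invariant:
  "case foldl le_step (m, n, True) l of (m', n', r) \<Rightarrow>
     m' = m div 2 ^ length l \<and> n' = n div 2 ^ length l \<and> (m \<le> n \<longleftrightarrow> m' < n' \<or> m' = n' \<and> r)"
proof (induction l rule: rev_induct)
  case (snoc x l)
  obtain m' n' r where s: "foldl le_step (m, n, True) l = (m', n', r)"
    by (metis prod_cases3)
  have IH: "m' = m div 2 ^ length l" "n' = n div 2 ^ length l" "m \<le> n \<longleftrightarrow> m' < n' \<or> m' = n' \<and> r"
    using snoc by (auto simp: s)
  have 1: "m' div 2 = m div 2 ^ length (l @ [x])" "n' div 2 = n div 2 ^ length (l @ [x])"
    unfolding IH by (simp_all add: div_mult2_eq mult.commute flip: div_mult2_eq)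
  define m2 n2 where "m2 = m' div 2" and "n2 = n' div 2"
  have "m' = of_bool (odd m') + 2 * m2" "n' = of_bool (odd n') + 2 * n2"
    by (auto simp: m2_def n2_def of_bool_def)
  then obtain a b where ab: "odd m' = a" "odd n' = b" "m' = of_bool a + 2 * m2" "n' = of_bool b + 2 * n2" by blast
  show ?case
    unfolding foldl_append s using 1 ab(1,2) IH(3)
    by (cases a; cases b) (auto simp: le_step_def ab(3,4) simp flip: m2_def n2_def)
qed auto

lemma polyt_le [polyt_intros]:
  assumes f: "polyt e enc_nat f" and g: "polyt e enc_nat g"
  shows "polyt e enc_bool (\<lambda>x. f x \<le> g x)"
proof -
  let ?l = "\<lambda>x. bits (f x) @ bits (g x)"
  let ?s = "\<lambda>x. foldl le_step (f x, g x, True) (?l x)"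
  have l: "polyt e (enc_list enc_bool) ?l" by (rule polyt_intros f g)+
  have "polyt e (enc_pair enc_nat (enc_pair enc_nat enc_bool)) ?s"
  proof (rule polyt_foldl[OF l])
    show "pbound e (\<lambda>x. 4 + (2 * size (enc_nat (f x)) + 2 * size (enc_nat (g x))))"
      by (intro pbound_intros pbound_size_polyt f g l)
    fix x ys zs
    obtain m' n' r where s: "foldl le_step (f x, g x, True) ys = (m', n', r)"
      by (metis prod_cases3)
    moreover have "m' \<le> f x" "n' \<le> g x"
      using le_step_invariant[where m = "f x" and n = "g x" and l = ys] by (auto simp: s)
    moreover have "size (enc_nat m') \<le> 2 * size (enc_nat (f x))" "size (enc_nat n') \<le> 2 * size (enc_nat (g x))"
      using calculation by (auto intro: size_enc_nat_mono)
    moreover have "size (enc_bool r) \<le> 1" by (simp add: enc_bool_def)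
    ultimately show "size (enc_pair enc_nat (enc_pair enc_nat enc_bool) (foldl le_step (f x, g x, True) ys))
      \<le> 4 + (2 * size (enc_nat (f x)) + 2 * size (enc_nat (g x)))"
      by (simp only: s size_enc_pair fst_conv snd_conv)
  qed (unfold le_step_def, (rule polyt_intros f g)+)
  note polyt_snd[OF polyt_snd[OF this]]
  moreover have "snd (snd (?s x)) \<longleftrightarrow> f x \<le> g x" for x
  proof -
    obtain m' n' r where s: "?s x = (m', n', r)" by (metis prod_cases3)
    have "f x < 2 ^ length (bits (f x))" "g x < 2 ^ length (bits (g x))"
      using nat_of_bits_less[of "bits (f x)"] nat_of_bits_less[of "bits (g x)"] by simp_all
    moreover have "(2::nat) ^ length (bits (f x)) \<le> 2 ^ length (?l x)"
      "(2::nat) ^ length (bits (g x)) \<le> 2 ^ length (?l x)"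
      by (simp_all add: power_increasing)
    ultimately have "f x div 2 ^ length (?l x) = 0" "g x div 2 ^ length (?l x) = 0"
      by (meson div_less less_le_trans)+
    then show ?thesis using le_step_invariant[where m = "f x" and n = "g x" and l = "?l x"] unfolding s by simp
  qed
  ultimately show ?thesis by simp
qed

lemma polyt_less [polyt_intros]:
  assumes f: "polyt e enc_nat f" and g: "polyt e enc_nat g"
  shows "polyt e enc_bool (\<lambda>x. f x < g x)"
  using polyt_not[OF polyt_le[OF g f]] by (simp add: not_le)

text \<open>Horner's scheme once more: the accumulator is doubled, and \<open>g x\<close> is added
  for each set bit of \<open>f x\<close>.\<close>

lemma polyt_mult [polyt_intros]:
  assumes f: "polyt e enc_nat f" and g: "polyt e enc_nat g"
  shows "polyt e enc_nat (\<lambda>x. f x * g x)"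
proof -
  let ?F = "\<lambda>n a b. (if b then n else 0) + (of_bool False + 2 * a)"
  have eq: "foldl (?F n) 0 bs = nat_of_bits (rev bs) * n" for n bs
    by (induction bs rule: rev_induct) (auto simp: algebra_simps)
  note g' = polyt_app1[OF g]
  have "polyt e enc_nat (\<lambda>x. foldl (?F (g x)) 0 (rev (bits (f x))))"
  proof (rule polyt_foldl)
    show "pbound e (\<lambda>x. 2 * (size (enc_nat (f x)) + size (enc_nat (g x))))"
      by (intro pbound_intros pbound_size_polyt f g)
    fix x ys zs assume "rev (bits (f x)) = ys @ zs"
    then have "length ys \<le> length (bits (f x))" by (metis length_append length_rev le_add1)
    then have "length ys \<le> size (enc_nat (f x))" by (metis length_le_size le_trans enc_list_bits)
    moreover have "nat_of_bits (rev ys) * g x < 2 ^ length ys * 2 ^ size (enc_nat (g x))"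
      using nat_of_bits_less[of "rev ys"] less_exp_size_enc_nat[of "g x"] by (intro mult_strict_mono) auto
    then have "nat_of_bits (rev ys) * g x < 2 ^ (length ys + size (enc_nat (g x)))"
      by (simp add: power_add)
    then have "size (enc_nat (nat_of_bits (rev ys) * g x)) \<le> 2 * (length ys + size (enc_nat (g x)))"
      by (rule size_enc_nat_le)
    ultimately show "size (enc_nat (foldl (?F (g x)) 0 ys)) \<le> 2 * (size (enc_nat (f x)) + size (enc_nat (g x)))"
      unfolding eq by (meson le_trans mult_le_mono2 add_le_mono1)
  qed (rule polyt_double polyt_intros f g')+
  then show ?thesis unfolding eq by simp
qed

lemma polyt_sum_list [polyt_intros]:
  assumes l: "polyt e (enc_list enc_nat) l" shows "polyt e enc_nat (\<lambda>x. sum_list (l x))"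
proof -
  have b: "sum_list xs < 2 ^ size (enc_list enc_nat xs)" for xs
  proof (induction xs)
    case (Cons x xs)
    let ?a = "size (enc_nat x)" and ?b = "size (enc_list enc_nat xs)"
    have "x < 2 ^ ?a" "(2::nat) ^ ?a \<le> 2 ^ (?a + ?b)" "(2::nat) ^ ?b \<le> 2 ^ (?a + ?b)"
      using less_exp_size_enc_nat[of x] by (simp_all add: power_increasing)
    then have "x + sum_list xs < 2 ^ (?a + ?b) + 2 ^ (?a + ?b)" using Cons by linarith
    then show ?case by simp
  qed simp
  have eq: "foldl (+) a xs = a + sum_list xs" for a :: nat and xs
    by (induction xs arbitrary: a) (auto simp: add.assoc)
  have "polyt e enc_nat (\<lambda>x. foldl (+) 0 (l x))"
  proof (rule polyt_foldl[OF l polyt_const])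
    show "pbound e (\<lambda>x. 2 * size (enc_list enc_nat (l x)))"
      by (intro pbound_intros pbound_size_polyt l)
    fix x ys zs assume "l x = ys @ zs"
    then have "size (enc_list enc_nat ys) \<le> size (enc_list enc_nat (l x))" by simp
    then show "size (enc_nat (foldl (+) 0 ys)) \<le> 2 * size (enc_list enc_nat (l x))"
      using size_enc_nat_le[OF b[of ys]] by (simp add: eq)
  qed (rule polyt_intros)+
  then show ?thesis by (simp add: eq)
qed

text \<open>Bit lengths add up under multiplication, so even the product of all denominators of an
  instance has polynomial size.\<close>

lemma polyt_prod_list [polyt_intros]:
  assumes l: "polyt e (enc_list enc_nat) l" shows "polyt e enc_nat (\<lambda>x. prod_list (l x))"
proof -
  have b: "prod_list xs \<le> 2 ^ size (enc_list enc_nat xs)" for xs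
  proof (induction xs)
    case (Cons x xs)
    have "x \<le> 2 ^ size (enc_nat x)" using less_exp_size_enc_nat[of x] by simp
    then have "x * prod_list xs \<le> 2 ^ size (enc_nat x) * 2 ^ size (enc_list enc_nat xs)"
      using Cons by (rule mult_mono) auto
    then show ?case by (simp add: power_add)
  qed simp
  have eq: "foldl (*) a xs = a * prod_list xs" for a :: nat and xs
    by (induction xs arbitrary: a) (auto simp: mult.assoc)
  have "polyt e enc_nat (\<lambda>x. foldl (*) 1 (l x))"
  proof (rule polyt_foldl[OF l polyt_const])
    show "pbound e (\<lambda>x. 2 * Suc (size (enc_list enc_nat (l x))))"
      by (intro pbound_intros pbound_size_polyt l)
    fix x ys zs assume "l x = ys @ zs"
    then have "size (enc_list enc_nat ys) \<le> size (enc_list enc_nat (l x))" by simp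
    moreover have "prod_list ys < 2 ^ Suc (size (enc_list enc_nat ys))"
      using b[of ys] by (rule le_less_trans) simp
    ultimately show "size (enc_nat (foldl (*) 1 ys)) \<le> 2 * Suc (size (enc_list enc_nat (l x)))"
      using size_enc_nat_le[of "prod_list ys"] unfolding eq by fastforce
  qed (rule polyt_intros)+
  then show ?thesis by (simp add: eq)
qed

lemma polyt_length [polyt_intros]:
  assumes "polyt e (enc_list e1) l" shows "polyt e enc_nat (\<lambda>x. length (l x))"
proof -
  have "polyt e enc_nat (\<lambda>x. sum_list (map (\<lambda>_. 1) (l x)))" by (rule polyt_intros assms)+
  then show ?thesis by (simp add: sum_list_triv)
qed

lemma polyt_Suc [polyt_intros]:
  assumes "polyt e enc_nat f" shows "polyt e enc_nat (\<lambda>x. Suc (f x))"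
  using polyt_add[OF assms polyt_const[of e enc_nat 1]] by simp

text \<open>The upper end is given in unary, as the length of a list; from a binary number the
  result could be exponentially long.\<close>

lemma polyt_upt [polyt_intros]:
  assumes l: "polyt e (enc_list e1) l" shows "polyt e (enc_list enc_nat) (\<lambda>x. [1..<Suc (length (l x))])"
proof -
  have eq: "foldl (\<lambda>a _. a @ [Suc (length a)]) [] xs = [1..<Suc (length xs)]" for xs :: "'b list"
    by (induction xs rule: rev_induct) (simp_all del: upt_Suc add: upt_Suc_append)
  have "polyt e (enc_list enc_nat) (\<lambda>x. foldl (\<lambda>a _. a @ [Suc (length a)]) [] (l x))"
  proof (rule polyt_foldl[OF l polyt_const])
    let ?n = "\<lambda>x. size (enc_list e1 (l x))"
    show "pbound e (\<lambda>x. ?n x * Suc (2 * ?n x))"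
      by (intro pbound_intros pbound_size_polyt l)
    fix x ys zs assume "l x = ys @ zs"
    then have len: "length ys \<le> ?n x" using length_le_size[of ys e1] by simp
    have "size (enc_nat i) \<le> 2 * ?n x" if "i \<in> set [1..<Suc (length ys)]" for i
      by (rule size_enc_nat_le) (use that len in \<open>auto intro!: le_less_trans[OF _ less_exp]\<close>)
    then have "size (enc_list enc_nat [1..<Suc (length ys)]) \<le> length ys * Suc (2 * ?n x)"
      using size_enc_list_le[of "[1..<Suc (length ys)]" enc_nat "2 * ?n x"] by (simp del: upt_Suc)
    also have "\<dots> \<le> ?n x * Suc (2 * ?n x)" using len by (rule mult_le_mono1)
    finally show "size (enc_list enc_nat (foldl (\<lambda>a _. a @ [Suc (length a)]) [] ys)) \<le> ?n x * Suc (2 * ?n x)"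
      unfolding eq .
  qed (rule polyt_intros)+
  then show ?thesis by (simp only: eq)
qed

abbreviation "enc_mark \<equiv> enc_pair enc_nat enc_nat"
abbreviation "enc_costs \<equiv> enc_list (enc_pair enc_mark enc_nat)"
abbreviation "enc_marks \<equiv> enc_list enc_mark"

section \<open>The algorithm\<close>

text \<open>Grades are recovered as positions in the cost lists, which bounds their number by the
  size of the input.\<close>

definition cost_entries :: "nat list \<Rightarrow> (nat \<times> nat) list list \<Rightarrow> ((nat \<times> nat) \<times> (nat \<times> nat)) list" where
  "cost_entries vs cs = concat (map (\<lambda>r. map (\<lambda>q. ((fst r, fst q), snd q))
     (zip [1..<Suc (length (snd r))] (snd r))) (zip vs cs))"

text \<open>Multiplying all costs by the product of all denominators makes them natural numbers.\<close>

definition scaled :: "((nat \<times> nat) \<times> (nat \<times> nat)) list \<Rightarrow> ((nat \<times> nat) \<times> nat) list" where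
  "scaled Q = map (\<lambda>e. (fst e,
     prod_list (map (\<lambda>f. if fst f = fst e then fst (snd f) else snd (snd f)) Q))) Q"

text \<open>A mark \<open>(w, g)\<close> is the purchase of vertex \<open>w\<close> at grade \<open>g\<close>.\<close>

definition mcost :: "((nat \<times> nat) \<times> nat) list \<Rightarrow> (nat \<times> nat) list \<Rightarrow> nat" where
  "mcost C ms = sum_list (concat (map (\<lambda>m. map snd (filter (\<lambda>e. fst e = m) C)) ms))"

text \<open>One round of the Bellman-Ford method. A table entry \<open>(v, ms)\<close> is a walk from \<open>v\<close> to a fixed
  center, given by the marks at grade \<open>g\<close> of all its vertices except the center.\<close>

definition relax :: "((nat \<times> nat) \<times> nat) list \<Rightarrow> (nat \<times> nat) list \<Rightarrow> nat list \<Rightarrow> nat \<Rightarrow>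
    (nat \<times> (nat \<times> nat) list) list \<Rightarrow> (nat \<times> (nat \<times> nat) list) list" where
  "relax C arcs vs g tab = concat (map (\<lambda>v. bestl (\<lambda>a b. mcost C (snd a) < mcost C (snd b))
     (filter (\<lambda>e. fst e = v) (tab @ concat (map (\<lambda>e. concat (map (\<lambda>a.
        if fst a = fst e then [(snd a, (snd a, g) # snd e)] else []) arcs)) tab)))) vs)"

text \<open>In the fold \<open>vs\<close> is only a clock: a simple path has fewer than
  \<open>length vs\<close> vertices besides its last one, so that many rounds suffice.\<close>

definition legs :: "((nat \<times> nat) \<times> nat) list \<Rightarrow> (nat \<times> nat) list \<Rightarrow> nat list \<Rightarrow> nat \<Rightarrow> nat \<Rightarrow>
    (nat \<times> (nat \<times> nat) list) list" where
  "legs C arcs vs x g = foldl (\<lambda>tab _. relax C arcs vs g tab) [(x, [])] vs"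

text \<open>A leg omits its final vertex, the center, which the spider adds once for all legs. The
  default \<open>[]\<close> is not reached in a connected graph.\<close>

definition leg :: "((nat \<times> nat) \<times> nat) list \<Rightarrow> (nat \<times> nat) list \<Rightarrow> nat list \<Rightarrow> nat \<Rightarrow> nat \<Rightarrow> nat \<Rightarrow> (nat \<times> nat) list" where
  "leg C arcs vs x g t = (case filter (\<lambda>e. fst e = t) (legs C arcs vs x g) of [] \<Rightarrow> [] | e # es \<Rightarrow> snd e)"

text \<open>A spider with center \<open>x\<close> joins the terminals \<open>ts\<close> to the terminal \<open>r\<close>; only the leg of \<open>r\<close> and the
  center need the grade \<open>g\<close>. Terminals are paired with their required grades.\<close>

definition spider :: "((nat \<times> nat) \<times> nat) list \<Rightarrow> (nat \<times> nat) list \<Rightarrow> nat list \<Rightarrow> nat \<Rightarrow> nat \<Rightarrow> nat \<times> nat \<Rightarrow>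
    (nat \<times> nat) list \<Rightarrow> (nat \<times> nat) list \<times> (nat \<times> nat) list" where
  "spider C arcs vs x g r ts =
     ((x, g) # leg C arcs vs x g (fst r) @ concat (map (\<lambda>t. leg C arcs vs x (snd t) (fst t)) ts), ts)"

text \<open>For fixed \<open>x\<close>, \<open>r\<close> and \<open>g\<close> the best ratio of cost to number of terminals is attained by a
  single terminal or by all eligible terminals whose legs do not exceed some threshold.\<close>

definition spiders :: "((nat \<times> nat) \<times> nat) list \<Rightarrow> (nat \<times> nat) list \<Rightarrow> nat list \<Rightarrow> (nat \<times> nat) list \<Rightarrow>
    ((nat \<times> nat) list \<times> (nat \<times> nat) list) list" where
  "spiders C arcs vs A = concat (map (\<lambda>x. concat (map (\<lambda>r. concat (map (\<lambda>s.
     if snd s \<le> snd r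
     then concat (map (\<lambda>u.
       if u \<noteq> r \<and> snd u \<le> snd s
       then [spider C arcs vs x (snd s) r [u],
             spider C arcs vs x (snd s) r (filter (\<lambda>t. t \<noteq> r \<and> snd t \<le> snd s \<and>
               mcost C (leg C arcs vs x (snd t) (fst t)) \<le> mcost C (leg C arcs vs x (snd u) (fst u))) A)]
       else []) A)
     else []) A)) A)) vs)"

text \<open>Ratios of cost to number of terminals, compared by cross multiplication;
  \<open>Suc\<close> accounts for the root, which the second component leaves out.\<close>

definition ratio_less :: "((nat \<times> nat) \<times> nat) list \<Rightarrow> (nat \<times> nat) list \<times> (nat \<times> nat) list \<Rightarrow>
    (nat \<times> nat) list \<times> (nat \<times> nat) list \<Rightarrow> bool" where
  "ratio_less C a b \<longleftrightarrow> mcost C (fst a) * Suc (length (snd b)) < mcost C (fst b) * Suc (length (snd a))"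

text \<open>A state of the greedy phase consists of the active terminals and the marks bought so far.\<close>

definition merge :: "((nat \<times> nat) \<times> nat) list \<Rightarrow> (nat \<times> nat) list \<Rightarrow> nat list \<Rightarrow>
    (nat \<times> nat) list \<times> (nat \<times> nat) list \<Rightarrow> (nat \<times> nat) list \<times> (nat \<times> nat) list" where
  "merge C arcs vs s = (case bestl (ratio_less C) (spiders C arcs vs (fst s)) of [] \<Rightarrow> s
     | b # bs \<Rightarrow> (filter (\<lambda>t. t \<notin> set (snd b)) (fst s), fst b @ snd s))"

text \<open>\<open>ts\<close> has three parts: all terminals are active at first, all are bought at
  their own grade, which is free, and the list is a clock, since each round deactivates a terminal
  as long as two are left.\<close>

definition greedy :: "((nat \<times> nat) \<times> nat) list \<Rightarrow> (nat \<times> nat) list \<Rightarrow> nat list \<Rightarrow> (nat \<times> nat) list \<Rightarrow>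
    (nat \<times> nat) list \<times> (nat \<times> nat) list" where
  "greedy C arcs vs ts = foldl (\<lambda>s _. merge C arcs vs s) (ts, ts) ts"

text \<open>One step of Prim's method, with priority given to the highest grade: a state consists of the
  vertices of the tree with their grades and of its arcs, directed away from the root.\<close>

definition attach :: "(nat \<times> nat) list \<Rightarrow> (nat \<times> nat) list \<Rightarrow>
    (nat \<times> nat) list \<times> (nat \<times> nat) list \<Rightarrow> (nat \<times> nat) list \<times> (nat \<times> nat) list" where
  "attach arcs Y s = (case bestl (\<lambda>a b. snd (snd b) < snd (snd a)) (concat (map (\<lambda>a. concat (map (\<lambda>m.
       if snd a = fst m \<and> fst a \<in> set (map fst (fst s)) \<and> snd a \<notin> set (map fst (fst s)) then [(a, m)] else []) Y)) arcs))
     of [] \<Rightarrow> s | b # bs \<Rightarrow> (snd b # fst s, fst b # snd s))"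

text \<open>\<open>vs\<close> is a clock with one round per vertex; \<open>A\<close> is meant to
  consist of the last active terminal, the root.\<close>

definition grow :: "(nat \<times> nat) list \<Rightarrow> nat list \<Rightarrow> (nat \<times> nat) list \<Rightarrow> (nat \<times> nat) list \<Rightarrow>
    (nat \<times> nat) list \<times> (nat \<times> nat) list" where
  "grow arcs vs A Y = foldl (\<lambda>s _. attach arcs Y s) (A, []) vs"

definition both_ways :: "(nat \<times> nat) list \<Rightarrow> (nat \<times> nat) list" where
  "both_ways es = es @ map (\<lambda>a. (snd a, fst a)) es"

definition solve :: "nat list \<Rightarrow> (nat \<times> nat) list \<Rightarrow> (nat \<times> nat) list \<Rightarrow> (nat \<times> nat) list list \<Rightarrow>
    (nat \<times> nat) list \<times> (nat \<times> nat) list" where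
  "solve vs es ts cs = (let s = greedy (scaled (cost_entries vs cs)) (both_ways es) vs ts
     in grow (both_ways es) vs (fst s) (snd s))"

text \<open>Solutions are encoded with vertices and edges in ascending order; filtering the ordered
  input lists achieves this without sorting.\<close>

definition answer :: "nat list \<Rightarrow> (nat \<times> nat) list \<Rightarrow> (nat \<times> nat) list \<times> (nat \<times> nat) list \<Rightarrow>
    (nat \<times> nat) list \<times> (nat \<times> nat) list" where
  "answer vs es s = (concat (map (\<lambda>v. filter (\<lambda>m. fst m = v) (fst s)) vs),
     filter (\<lambda>e. e \<in> set (snd s) \<or> (snd e, fst e) \<in> set (snd s)) es)"

section \<open>Running time\<close>

lemma polyt_cost_entries [polyt_intros]:
  assumes "polyt e (enc_list enc_nat) vs" "polyt e (enc_list enc_marks) cs"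
  shows "polyt e (enc_list (enc_pair enc_mark enc_mark)) (\<lambda>x. cost_entries (vs x) (cs x))"
  unfolding cost_entries_def by (rule polyt_intros assms)+

lemma polyt_scaled [polyt_intros]:
  assumes "polyt e (enc_list (enc_pair enc_mark enc_mark)) Q"
  shows "polyt e enc_costs (\<lambda>x. scaled (Q x))"
  unfolding scaled_def by (rule polyt_intros assms assms[THEN polyt_app1])+

lemma polyt_mcost [polyt_intros]:
  assumes "polyt e enc_costs C" "polyt e enc_marks ms"
  shows "polyt e enc_nat (\<lambda>x. mcost (C x) (ms x))"
  unfolding mcost_def by (rule polyt_intros assms assms[THEN polyt_app1])+

lemma polyt_relax [polyt_intros]:
  assumes "polyt e enc_costs C" "polyt e enc_marks arcs" "polyt e (enc_list enc_nat) vs" "polyt e enc_nat g"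
    "polyt e (enc_list (enc_pair enc_nat enc_marks)) tab"
  shows "polyt e (enc_list (enc_pair enc_nat enc_marks)) (\<lambda>x. relax (C x) (arcs x) (vs x) (g x) (tab x))"
  unfolding relax_def by (rule polyt_intros assms assms[THEN polyt_app1])+

lemma relax_entry:
  assumes "e \<in> set (relax C arcs vs g tab)"
  shows "e \<in> set tab \<or> (\<exists>e'\<in>set tab. \<exists>a\<in>set arcs. fst a = fst e' \<and> e = (snd a, (snd a, g) # snd e'))"
proof -
  obtain v where "e \<in> set (bestl (\<lambda>a b. mcost C (snd a) < mcost C (snd b))
     (filter (\<lambda>e. fst e = v) (tab @ concat (map (\<lambda>e. concat (map (\<lambda>a.
        if fst a = fst e then [(snd a, (snd a, g) # snd e)] else []) arcs)) tab))))"
    using assms unfolding relax_def set_concat set_map by blast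
  from bestl_in[OF this] show ?thesis by (auto split: if_splits)
qed

lemma length_concat_map_le: "(\<And>x. length (f x) \<le> 1) \<Longrightarrow> length (concat (map f xs)) \<le> length xs"
proof (induction xs)
  case (Cons x xs)
  then show ?case using add_mono[OF Cons.prems[of x] Cons.IH] by simp
qed simp

text \<open>Keeping one best entry per vertex prevents the table from being multiplied in every
  round.\<close>

lemma length_relax: "length (relax C arcs vs g tab) \<le> length vs"
  unfolding relax_def
proof (rule length_concat_map_le)
  show "length (bestl lt xs) \<le> 1" for lt :: "nat \<times> (nat \<times> nat) list \<Rightarrow> nat \<times> (nat \<times> nat) list \<Rightarrow> bool" and xs
    using bestl_subset[of lt xs] by auto
qed

text \<open>What the size bound for tables needs: an entry gains at most one mark per round, and
  marks are made from heads of arcs and \<open>g\<close>.\<close>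

lemma legs_entry:
  assumes "e \<in> set (foldl (\<lambda>tab _. relax C arcs vs g tab) [(x, [])] ys)"
  shows "(fst e = x \<or> fst e \<in> snd ` set arcs) \<and> length (snd e) \<le> length ys \<and>
    set (snd e) \<subseteq> (snd ` set arcs) \<times> {g}"
  using assms
proof (induction ys arbitrary: e rule: rev_induct)
  case (snoc y ys)
  let ?t = "foldl (\<lambda>tab _. relax C arcs vs g tab) [(x, [])] ys"
  have "e \<in> set (relax C arcs vs g ?t)" using snoc.prems by simp
  from relax_entry[OF this] show ?case
  proof (elim disjE bexE conjE)
    assume "e \<in> set ?t"
    from snoc.IH[OF this] show ?thesis by auto
  next
    fix e' a assume "e' \<in> set ?t" "a \<in> set arcs" "e = (snd a, (snd a, g) # snd e')"
    with snoc.IH[OF this(1)] show ?thesis by auto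
  qed
qed simp

lemma polyt_legs [polyt_intros]:
  assumes C: "polyt e enc_costs C" and arcs: "polyt e enc_marks arcs" and vs: "polyt e (enc_list enc_nat) vs"
    and c: "polyt e enc_nat c" and g: "polyt e enc_nat g"
  shows "polyt e (enc_list (enc_pair enc_nat enc_marks)) (\<lambda>x. legs (C x) (arcs x) (vs x) (c x) (g x))"
  unfolding legs_def
proof (rule polyt_foldl[OF vs])
  define S where "S = (\<lambda>x. size (enc_nat (c x)) + size (enc_nat (g x)) + size (enc_marks (arcs x)) + size (enc_list enc_nat (vs x)))"
  have S: "pbound e S"
    unfolding S_def by (intro pbound_add pbound_size_polyt[OF c] pbound_size_polyt[OF g]
      pbound_size_polyt[OF arcs] pbound_size_polyt[OF vs])
  show "pbound e (\<lambda>x. Suc (S x) * Suc (Suc (S x + S x * Suc (Suc (S x)))))"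
    by (intro pbound_intros S)
  fix x ys zs assume split: "vs x = ys @ zs"
  let ?tab = "foldl (\<lambda>tab _. relax (C x) (arcs x) (vs x) (g x) tab) [(c x, [])] ys"
  have arc: "size (enc_nat v) \<le> size (enc_marks (arcs x))" if v: "v \<in> snd ` set (arcs x)" for v
  proof -
    obtain a where a: "a \<in> set (arcs x)" "v = snd a" using v by blast
    show ?thesis using size_elem[OF a(1), of enc_mark] a(2) by simp
  qed
  have lys: "length ys \<le> S x" "length (vs x) \<le> S x"
    using length_le_size[of "vs x" enc_nat] split by (auto simp: S_def)
  have entry: "size (enc_pair enc_nat enc_marks d) \<le> Suc (S x + S x * Suc (Suc (S x)))" if d: "d \<in> set ?tab" for d
  proof -
    have *: "fst d = c x \<or> fst d \<in> snd ` set (arcs x)" "length (snd d) \<le> length ys"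
      "set (snd d) \<subseteq> (snd ` set (arcs x)) \<times> {g x}"
      using legs_entry[OF d] by blast+
    have "size (enc_mark m) \<le> Suc (S x)" if "m \<in> set (snd d)" for m
    proof -
      have "m \<in> (snd ` set (arcs x)) \<times> {g x}" using *(3) that by blast
      then have "fst m \<in> snd ` set (arcs x)" "snd m = g x" by (simp_all add: mem_Times_iff)
      with arc[OF this(1)] show ?thesis by (simp add: S_def)
    qed
    then have "size (enc_marks (snd d)) \<le> length (snd d) * Suc (Suc (S x))"
      by (rule size_enc_list_le)
    also have "\<dots> \<le> S x * Suc (Suc (S x))"
      using *(2) lys by (intro mult_le_mono1) linarith
    finally have "size (enc_marks (snd d)) \<le> S x * Suc (Suc (S x))" .
    moreover have "size (enc_nat (fst d)) \<le> S x"
      using *(1) arc[of "fst d"] unfolding S_def by (elim disjE) simp_all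
    ultimately show ?thesis unfolding size_enc_pair by linarith
  qed
  have "length ?tab \<le> Suc (S x)"
  proof (cases ys rule: rev_cases)
    case (snoc us u)
    have "length ?tab \<le> length (vs x)" unfolding snoc foldl_append by (simp add: length_relax)
    then show ?thesis using lys by simp
  qed simp
  then have "length ?tab * Suc (Suc (S x + S x * Suc (Suc (S x)))) \<le> Suc (S x) * Suc (Suc (S x + S x * Suc (Suc (S x))))"
    by (rule mult_le_mono1)
  with size_enc_list_le[of ?tab, OF entry]
  show "size (enc_list (enc_pair enc_nat enc_marks) ?tab) \<le> Suc (S x) * Suc (Suc (S x + S x * Suc (Suc (S x))))"
    by (rule le_trans)
qed (rule polyt_intros assms assms[THEN polyt_app1])+

lemma polyt_leg [polyt_intros]:
  assumes "polyt e enc_costs C" "polyt e enc_marks arcs" "polyt e (enc_list enc_nat) vs"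
    "polyt e enc_nat c" "polyt e enc_nat g" "polyt e enc_nat t"
  shows "polyt e enc_marks (\<lambda>x. leg (C x) (arcs x) (vs x) (c x) (g x) (t x))"
  unfolding leg_def by (rule polyt_intros assms assms[THEN polyt_app1])+

lemma polyt_spider [polyt_intros]:
  assumes "polyt e enc_costs C" "polyt e enc_marks arcs" "polyt e (enc_list enc_nat) vs"
    "polyt e enc_nat c" "polyt e enc_nat g" "polyt e enc_mark r" "polyt e enc_marks ts"
  shows "polyt e (enc_pair enc_marks enc_marks) (\<lambda>x. spider (C x) (arcs x) (vs x) (c x) (g x) (r x) (ts x))"
  unfolding spider_def by (rule polyt_intros assms assms[THEN polyt_app1])+

lemma polyt_spiders [polyt_intros]:
  assumes "polyt e enc_costs C" "polyt e enc_marks arcs" "polyt e (enc_list enc_nat) vs" "polyt e enc_marks A"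
  shows "polyt e (enc_list (enc_pair enc_marks enc_marks)) (\<lambda>x. spiders (C x) (arcs x) (vs x) (A x))"
  unfolding spiders_def by (rule polyt_intros assms assms[THEN polyt_app1])+

lemma polyt_ratio_less [polyt_intros]:
  assumes "polyt e enc_costs C" "polyt e (enc_pair enc_marks enc_marks) a" "polyt e (enc_pair enc_marks enc_marks) b"
  shows "polyt e enc_bool (\<lambda>x. ratio_less (C x) (a x) (b x))"
  unfolding ratio_less_def by (rule polyt_intros assms)+

lemma polyt_merge [polyt_intros]:
  assumes "polyt e enc_costs C" "polyt e enc_marks arcs" "polyt e (enc_list enc_nat) vs" "polyt e (enc_pair enc_marks enc_marks) s"
  shows "polyt e (enc_pair enc_marks enc_marks) (\<lambda>x. merge (C x) (arcs x) (vs x) (s x))"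
  unfolding merge_def by (rule polyt_intros assms assms[THEN polyt_app1])+

lemma merge_cases:
  obtains "merge C arcs vs s = s" | b where "b \<in> set (spiders C arcs vs (fst s))"
    "merge C arcs vs s = (filter (\<lambda>t. t \<notin> set (snd b)) (fst s), fst b @ snd s)"
  using bestl_subset[of "ratio_less C" "spiders C arcs vs (fst s)"] unfolding merge_def by fastforce

lemma polyt_greedy [polyt_intros]:
  assumes C: "polyt e enc_costs C" and arcs: "polyt e enc_marks arcs" and vs: "polyt e (enc_list enc_nat) vs"
    and ts: "polyt e enc_marks ts"
  shows "polyt e (enc_pair enc_marks enc_marks) (\<lambda>x. greedy (C x) (arcs x) (vs x) (ts x))"
proof -
  let ?E = "enc_pair enc_costs (enc_pair enc_marks (enc_pair (enc_list enc_nat) enc_marks))"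
  have "polyt ?E (enc_list (enc_pair enc_marks enc_marks)) (\<lambda>p. spiders (fst p) (fst (snd p)) (fst (snd (snd p))) (snd (snd (snd p))))"
    by (rule polyt_intros)+
  from pbound_size_polyt[OF this] obtain q where
    q': "\<And>p. size (enc_list (enc_pair enc_marks enc_marks) (spiders (fst p) (fst (snd p)) (fst (snd (snd p))) (snd (snd (snd p)))))
      \<le> poly q (size (?E p))"
    unfolding pbound_def by blast
  note q = q'[of "(a, b, c, d)" for a b c d, unfolded fst_conv snd_conv]
  \<comment> \<open>The list of active terminals never outgrows \<open>ts x\<close>, so
    \<open>B x\<close> bounds the spiders of every round and hence the growth of the purchases per
    round.\<close>
  define B where "B = (\<lambda>x. poly q (size (?E (C x, arcs x, vs x, ts x))))"
  have E: "polyt e ?E (\<lambda>x. (C x, arcs x, vs x, ts x))"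
    by (rule polyt_intros assms)+
  show ?thesis unfolding greedy_def
  proof (rule polyt_foldl[OF ts])
    show "pbound e (\<lambda>x. 1 + size (enc_marks (ts x)) + size (enc_marks (ts x)) + size (enc_marks (ts x)) * B x)"
      unfolding B_def by (intro pbound_intros pbound_size_polyt[OF E] pbound_size_polyt[OF ts])
    fix x ys zs assume split: "ts x = ys @ zs"
    let ?s = "\<lambda>ys. foldl (\<lambda>s _. merge (C x) (arcs x) (vs x) s) (ts x, ts x) ys"
    have "size (enc_marks (fst (?s ys))) \<le> size (enc_marks (ts x)) \<and>
        size (enc_marks (snd (?s ys))) \<le> size (enc_marks (ts x)) + length ys * B x" for ys :: "(nat \<times> nat) list"
    proof (induction ys rule: rev_induct)
      case (snoc y ys)
      let ?t = "?s ys"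
      have fs: "?s (ys @ [y]) = merge (C x) (arcs x) (vs x) ?t" by simp
      show ?case
      proof (cases rule: merge_cases[of "C x" "arcs x" "vs x" ?t])
        case 1
        then show ?thesis using snoc by (simp add: fs)
      next
        case (2 b)
        have "size (enc_marks (fst b)) \<le> size (enc_list (enc_pair enc_marks enc_marks) (spiders (C x) (arcs x) (vs x) (fst ?t)))"
          using size_elem[OF 2(1), of "enc_pair enc_marks enc_marks"] by simp
        also have "\<dots> \<le> poly q (size (?E (C x, arcs x, vs x, fst ?t)))" by (rule q)
        also have "\<dots> \<le> B x" unfolding B_def by (rule poly_nat_mono) (use snoc in simp)
        finally have "size (enc_marks (fst b)) \<le> B x" .
        then show ?thesis using snoc
            size_enc_list_filter[of enc_mark "\<lambda>t. t \<notin> set (snd b)" "fst ?t"]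
          unfolding fs 2(2) by simp
      qed
    qed simp
    from this[of ys] have
      "size (enc_marks (fst (?s ys))) \<le> size (enc_marks (ts x))"
      "size (enc_marks (snd (?s ys))) \<le> size (enc_marks (ts x)) + length ys * B x" by auto
    moreover have "length ys * B x \<le> size (enc_marks (ts x)) * B x"
      by (rule mult_le_mono1, rule le_trans[OF _ length_le_size]) (simp add: split)
    ultimately show "size (enc_pair enc_marks enc_marks (?s ys)) \<le>
        1 + size (enc_marks (ts x)) + size (enc_marks (ts x)) + size (enc_marks (ts x)) * B x"
      unfolding size_enc_pair by linarith
  qed (rule polyt_intros assms assms[THEN polyt_app1])+
qed

lemma polyt_attach [polyt_intros]:
  assumes "polyt e enc_marks arcs" "polyt e enc_marks Y" "polyt e (enc_pair enc_marks enc_marks) s"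
  shows "polyt e (enc_pair enc_marks enc_marks) (\<lambda>x. attach (arcs x) (Y x) (s x))"
  unfolding attach_def by (rule polyt_intros assms assms[THEN polyt_app1])+

lemma attach_cases:
  obtains "attach arcs Y s = s" | a m where "a \<in> set arcs" "m \<in> set Y" "attach arcs Y s = (m # fst s, a # snd s)"
proof -
  define c where "c = concat (map (\<lambda>a. concat (map (\<lambda>m.
       if snd a = fst m \<and> fst a \<in> set (map fst (fst s)) \<and> snd a \<notin> set (map fst (fst s)) then [(a, m)] else []) Y)) arcs)"
  have sub: "p \<in> set c \<Longrightarrow> fst p \<in> set arcs \<and> snd p \<in> set Y" for p by (auto simp: c_def split: if_splits)
  show thesis
    using bestl_subset[of "\<lambda>a b. snd (snd b) < snd (snd a)" c]
  proof (elim disjE bexE)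
    assume "bestl (\<lambda>a b. snd (snd b) < snd (snd a)) c = []"
    then show thesis using that(1) unfolding attach_def c_def[symmetric] by simp
  next
    fix p assume "p \<in> set c" "bestl (\<lambda>a b. snd (snd b) < snd (snd a)) c = [p]"
    then show thesis using that(2)[of "fst p" "snd p"] sub[of p] unfolding attach_def c_def[symmetric] by simp
  qed
qed

lemma polyt_grow [polyt_intros]:
  assumes arcs: "polyt e enc_marks arcs" and vs: "polyt e (enc_list enc_nat) vs"
    and A: "polyt e enc_marks A" and Y: "polyt e enc_marks Y"
  shows "polyt e (enc_pair enc_marks enc_marks) (\<lambda>x. grow (arcs x) (vs x) (A x) (Y x))"
  unfolding grow_def
proof (rule polyt_foldl[OF vs])
  define S where "S = (\<lambda>x. size (enc_marks (A x)) + size (enc_marks (Y x)) + size (enc_marks (arcs x)))"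
  have S: "pbound e S"
    unfolding S_def by (intro pbound_add pbound_size_polyt[OF A] pbound_size_polyt[OF Y]
      pbound_size_polyt[OF arcs])
  show "pbound e (\<lambda>x. 1 + S x + size (enc_list enc_nat (vs x)) * S x)"
    by (intro pbound_intros S pbound_size_polyt[OF vs])
  fix x and ys zs :: "nat list" assume split: "vs x = ys @ zs"
  let ?s = "\<lambda>ys. foldl (\<lambda>s _. attach (arcs x) (Y x) s) (A x, []) ys"
  \<comment> \<open>A round adds at most one mark of \<open>Y x\<close> and one arc, together of
    size at most \<open>S x\<close>.\<close>
  have "size (enc_marks (fst (?s ys))) + size (enc_marks (snd (?s ys))) \<le> S x + length ys * S x" for ys :: "nat list"
  proof (induction ys rule: rev_induct)
    case (snoc y ys)
    have fs: "?s (ys @ [y]) = attach (arcs x) (Y x) (?s ys)" by simp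
    show ?case
    proof (cases rule: attach_cases[of "arcs x" "Y x" "?s ys"])
      case 1
      then show ?thesis using snoc by (simp add: fs)
    next
      case (2 a m)
      note size_elem[OF 2(1), of enc_mark] size_elem[OF 2(2), of enc_mark]
      then have "Suc (size (enc_mark a)) + Suc (size (enc_mark m)) \<le> S x" unfolding S_def by linarith
      then show ?thesis using snoc unfolding fs 2(3) by simp
    qed
  qed (simp add: S_def)
  from this[of ys] have "size (enc_marks (fst (?s ys))) + size (enc_marks (snd (?s ys))) \<le> S x + length ys * S x" .
  moreover have "length ys * S x \<le> size (enc_list enc_nat (vs x)) * S x"
    by (rule mult_le_mono1, rule le_trans[OF _ length_le_size]) (simp add: split)
  ultimately show "size (enc_pair enc_marks enc_marks (?s ys)) \<le> 1 + S x + size (enc_list enc_nat (vs x)) * S x"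
    unfolding size_enc_pair by linarith
qed (rule polyt_intros assms assms[THEN polyt_app1])+

lemma polyt_both_ways [polyt_intros]:
  assumes "polyt e enc_marks es" shows "polyt e enc_marks (\<lambda>x. both_ways (es x))"
  unfolding both_ways_def by (rule polyt_intros assms)+

lemma polyt_solve [polyt_intros]:
  assumes "polyt e (enc_list enc_nat) vs" "polyt e enc_marks es" "polyt e enc_marks ts" "polyt e (enc_list enc_marks) cs"
  shows "polyt e (enc_pair enc_marks enc_marks) (\<lambda>x. solve (vs x) (es x) (ts x) (cs x))"
  unfolding solve_def Let_def by (rule polyt_intros assms)+

lemma polyt_answer [polyt_intros]:
  assumes "polyt e (enc_list enc_nat) vs" "polyt e enc_marks es" "polyt e (enc_pair enc_marks enc_marks) s"
  shows "polyt e (enc_pair enc_marks enc_marks) (\<lambda>x. answer (vs x) (es x) (s x))"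
  unfolding answer_def by (rule polyt_intros assms assms[THEN polyt_app1])+

abbreviation "enc_input \<equiv> enc_pair (enc_list enc_nat) (enc_pair enc_marks (enc_pair enc_marks
  (enc_pair enc_nat (enc_list enc_marks))))"

text \<open>Each function that occurs has its rule in \<open>polyt_intros\<close>, so the derivation
  follows the syntax of the term.\<close>

lemma polyt_algorithm:
  "polyt enc_input (enc_pair enc_marks enc_marks) (\<lambda>p. answer (fst p) (fst (snd p))
     (solve (fst p) (fst (snd p)) (fst (snd (snd p))) (snd (snd (snd (snd p))))))"
  by (rule polyt_intros)+

section \<open>Connected graphs and spiders\<close>

lemma simple_path_mono: "simple_path V E u p v \<Longrightarrow> V \<subseteq> V' \<Longrightarrow> simple_path V' E u p v"
  by (auto simp: simple_path_def)

lemma successively_crossing: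
  assumes "successively R p" "p \<noteq> []" "hd p \<in> U" "last p \<notin> U"
  shows "\<exists>a b. a \<in> U \<and> b \<notin> U \<and> a \<in> set p \<and> b \<in> set p \<and> R a b"
  using assms
proof (induction p)
  case (Cons x p)
  show ?case
  proof (cases "p = [] \<or> hd p \<notin> U")
    case True
    have "p \<noteq> []" using Cons.prems by auto
    with True Cons.prems show ?thesis by (intro exI[of _ x] exI[of _ "hd p"]) (auto simp: successively_Cons)
  next
    case False
    with Cons.prems have "successively R p" "p \<noteq> []" "hd p \<in> U" "last p \<notin> U"
      by (auto simp: successively_Cons)
    from Cons.IH[OF this] show ?thesis by auto
  qed
qed simp

text \<open>Every vertex of the list is adjacent to a later one, so each suffix induces a connected graph.\<close>

fun grown :: "'v set set \<Rightarrow> 'v list \<Rightarrow> bool" where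
  "grown E [] \<longleftrightarrow> True"
| "grown E (x # xs) \<longleftrightarrow> x \<notin> set xs \<and> (xs = [] \<or> (\<exists>u\<in>set xs. {x, u} \<in> E)) \<and> grown E xs"

text \<open>While a vertex is missing, some edge of a path towards it leaves the listed vertices;
  the outer end of this edge is put in front.\<close>

lemma connected_grown:
  assumes "connected_graph V E"
  shows "\<exists>xs. grown E xs \<and> set xs = V"
proof -
  have fin: "finite V" and ne: "V \<noteq> {}" using assms by (auto simp: connected_graph_def ugraph_def)
  have "\<exists>xs. grown E xs \<and> set xs \<subseteq> V \<and> card (set xs) = n" if "n \<le> card V" for n
    using that
  proof (induction n)
    case 0
    show ?case by (rule exI[of _ "[]"]) simp
  next
    case (Suc n)
    then obtain xs where xs: "grown E xs" "set xs \<subseteq> V" "card (set xs) = n" by auto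
    have "set xs \<noteq> V" using xs Suc.prems by auto
    with xs obtain v where v: "v \<in> V" "v \<notin> set xs" by auto
    show ?case
    proof (cases "xs = []")
      case True
      then show ?thesis using v xs by (intro exI[of _ "[v]"]) auto
    next
      case False
      then have "hd xs \<in> V" using xs by (meson hd_in_set subsetD)
      then obtain p where p: "simple_path V E (hd xs) p v"
        using assms v by (auto simp: connected_graph_def)
      obtain a b where ab: "a \<in> set xs" "b \<notin> set xs" "b \<in> set p" "{a, b} \<in> E"
        using successively_crossing[of "\<lambda>x y. {x, y} \<in> E" p "set xs"] p v False
        by (auto simp: simple_path_def)
      have "b \<in> V" using ab p by (auto simp: simple_path_def)
      moreover have "{b, a} \<in> E" using ab by (simp add: insert_commute)
      ultimately show ?thesis using ab xs False by (intro exI[of _ "b # xs"]) auto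
    qed
  qed
  then obtain xs where "grown E xs" "set xs \<subseteq> V" "card (set xs) = card V" by blast
  with fin show ?thesis by (metis card_subset_eq)
qed

lemma grown_path:
  assumes "grown E xs" "u \<in> set xs" "v \<in> set xs"
  shows "\<exists>p. simple_path (set xs) E u p v"
  using assms
proof (induction xs arbitrary: u v)
  case (Cons x xs)
  consider "u = v" | "u = x" "v \<in> set xs" | "v = x" "u \<in> set xs" | "u \<in> set xs" "v \<in> set xs"
    using Cons.prems by auto
  then show ?case
  proof cases
    case 1
    then show ?thesis using Cons.prems by (intro exI[of _ "[u]"]) (auto simp: simple_path_def)
  next
    case 2
    then obtain y where y: "y \<in> set xs" "{x, y} \<in> E" using Cons.prems by auto
    then obtain p where "simple_path (set xs) E y p v" using Cons 2 by auto
    then show ?thesis using 2 y Cons.prems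
      by (intro exI[of _ "x # p"]) (auto simp: simple_path_def successively_Cons)
  next
    case 3
    then obtain y where y: "y \<in> set xs" "{x, y} \<in> E" using Cons.prems by auto
    then obtain p where "simple_path (set xs) E u p y" using Cons 3 by auto
    then show ?thesis using 3 y Cons.prems
      by (intro exI[of _ "p @ [x]"]) (auto simp: simple_path_def successively_append_iff insert_commute)
  next
    case 4
    then show ?thesis using Cons.IH[of u v] Cons.prems by (auto intro: simple_path_mono)
  qed
qed simp

text \<open>\<open>butlast\<close> removes the center, the only vertex that two paths may share. The
  center may be a terminal itself; its path is then a single vertex.\<close>

definition spider_in :: "'v set \<Rightarrow> 'v set set \<Rightarrow> 'v \<Rightarrow> 'v set \<Rightarrow> ('v \<Rightarrow> 'v list) \<Rightarrow> bool" where
  "spider_in V E x B p \<longleftrightarrow> x \<in> V \<and> (\<forall>a\<in>B. simple_path V E a (p a) x) \<and>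
     (\<forall>a\<in>B. \<forall>b\<in>B. a \<noteq> b \<longrightarrow> set (butlast (p a)) \<inter> set (butlast (p b)) = {})"

text \<open>The processed vertices have been distributed to disjoint paths, one for each terminal, which end
  at unprocessed vertices. A vertex at which a single path ends passes it on to a neighbour; a vertex at
  which several paths end becomes the center of a spider. A terminal that would be left alone by this
  is connected to the center through the unprocessed vertices.\<close>

lemma spider_from_paths:
  fixes wt :: "'v \<Rightarrow> real"
  assumes "grown E xs" "set xs \<subseteq> V" "finite A" "2 \<le> card A" and wt: "\<And>v. 0 \<le> wt v"
    and "\<forall>a\<in>A. \<exists>v\<in>set xs. simple_path V E a (q a) v" "\<forall>a\<in>A. set (butlast (q a)) \<inter> set xs = {}"
    and "\<forall>a\<in>A. \<forall>b\<in>A. a \<noteq> b \<longrightarrow> set (butlast (q a)) \<inter> set (butlast (q b)) = {}"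
  shows "\<exists>x B p. B \<subseteq> A \<and> 2 \<le> card B \<and> spider_in V E x B p \<and>
    (wt x + (\<Sum>a\<in>B. \<Sum>w\<in>set (butlast (p a)). wt w)) * card A
      \<le> card B * ((\<Sum>w\<in>set xs. wt w) + (\<Sum>a\<in>A. \<Sum>w\<in>set (butlast (q a)). wt w))"
  using assms(1-4,6-)
proof (induction xs arbitrary: A q)
  case Nil
  then have "A = {}" by auto
  then show ?case using Nil by simp
next
  case (Cons x xs)
  note q = Cons.prems(5) and off = Cons.prems(6) and disj = Cons.prems(7)
  let ?W = "\<lambda>p S. \<Sum>a\<in>S. \<Sum>w\<in>set (butlast (p a)). wt w"
  have sp: "simple_path V E a (q a) (last (q a))" "last (q a) \<in> set (x # xs)" if "a \<in> A" for a
    using q that by (auto simp: simple_path_def)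
  \<comment> \<open>The terminals whose paths have arrived at \<open>x\<close>, the next vertex to
    be processed.\<close>
  define B where "B = {a \<in> A. last (q a) = x}"
  have B: "B \<subseteq> A" "finite B" using \<open>finite A\<close> by (auto simp: B_def)
  have C: "last (q a) \<in> set xs" if "a \<in> A - B" for a using sp(2)[of a] that by (auto simp: B_def)
  have C': "\<exists>v\<in>set xs. simple_path V E a (q a) v" if "a \<in> A - B" for a
    using sp(1)[of a] C[OF that] that by blast
  have cardA: "card A = card B + card (A - B)"
    using B \<open>finite A\<close> by (metis card_Diff_subset card_mono le_add_diff_inverse)
  have W: "?W q A = ?W q B + ?W q (A - B)"
    using B \<open>finite A\<close> by (metis sum.subset_diff add.commute)
  have xs: "x \<notin> set xs" "grown E xs" "set xs \<subseteq> V" "x \<in> V" using Cons.prems by auto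
  have Wnn: "0 \<le> ?W p S" for p S by (intro sum_nonneg wt)
  consider "B = {}" | b where "B = {b}" | "2 \<le> card B"
    using B(2) by (metis One_nat_def Suc_1 card_0_eq card_1_singletonE le_less_linear less_2_cases)
  then show ?case
  proof cases
    case 1
    have "\<exists>x B p. B \<subseteq> A \<and> 2 \<le> card B \<and> spider_in V E x B p \<and>
      (wt x + ?W p B) * card A \<le> card B * (sum wt (set xs) + ?W q A)"
      by (rule Cons.IH) (use Cons.prems C' 1 in auto)
    then obtain x' B' p where *: "B' \<subseteq> A" "2 \<le> card B'" "spider_in V E x' B' p"
      "(wt x' + ?W p B') * card A \<le> card B' * (sum wt (set xs) + ?W q A)" by blast
    have "card B' * (sum wt (set xs) + ?W q A) \<le> card B' * (sum wt (set (x # xs)) + ?W q A)"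
      using xs wt[of x] by (intro mult_left_mono) auto
    with * show ?thesis by (meson order_trans)
  next
    case (2 b)
    then have b: "b \<in> A" "last (q b) = x" "q b \<noteq> []" using sp[of b] by (auto simp: B_def simple_path_def)
    have "A - B \<noteq> {}"
    proof
      assume "A - B = {}"
      then have "card (A - B) = 0" by (simp only: card.empty)
      then show False using cardA 2 \<open>2 \<le> card A\<close> by simp
    qed
    then have "xs \<noteq> []" using C by fastforce
    then obtain u where u: "u \<in> set xs" "{x, u} \<in> E" using Cons.prems by auto
    \<comment> \<open>The only path at \<open>x\<close> moves on to \<open>u\<close>. The weight of
      \<open>x\<close> passes from the unprocessed vertices to the paths, so the total on the
      right-hand side is unchanged.\<close>
    define q' where "q' = q(b := q b @ [u])"
    have qb: "set (q b) = insert x (set (butlast (q b)))"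
      using b by (metis append_butlast_last_id list.simps(15) rotate1.simps(2) set_rotate1)
    have q': "\<exists>v\<in>set xs. simple_path V E a (q' a) v" "set (butlast (q' a)) \<inter> set xs = {}" if "a \<in> A" for a
    proof -
      show "\<exists>v\<in>set xs. simple_path V E a (q' a) v"
      proof (cases "a = b")
        case True
        have "u \<notin> set (q b)" using off b(1) u xs qb by auto
        then have "simple_path V E b (q b @ [u]) u"
          using sp(1)[OF b(1)] u xs b by (auto simp: simple_path_def successively_append_iff)
        then show ?thesis using u True by (auto simp: q'_def)
      next
        case False
        then show ?thesis using sp[OF that] C[of a] that 2 by (auto simp: q'_def)
      qed
      show "set (butlast (q' a)) \<inter> set xs = {}"
        using that off b(1) qb xs by (auto simp: q'_def)
    qed
    have bl: "set (butlast (q' a)) = (if a = b then insert x (set (butlast (q b))) else set (butlast (q a)))" for a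
      using qb by (simp add: q'_def)
    have "\<exists>x B p. B \<subseteq> A \<and> 2 \<le> card B \<and> spider_in V E x B p \<and>
      (wt x + ?W p B) * card A \<le> card B * (sum wt (set xs) + ?W q' A)"
    proof (rule Cons.IH)
      show "\<forall>a\<in>A. \<forall>b\<in>A. a \<noteq> b \<longrightarrow> set (butlast (q' a)) \<inter> set (butlast (q' b)) = {}"
        using disj off b(1) unfolding bl by (auto split: if_splits)
    qed (use Cons.prems q' in auto)
    moreover have "?W q' A = wt x + ?W q A"
    proof -
      have "x \<notin> set (butlast (q b))" using off b(1) by auto
      then have "?W q' A = (\<Sum>a\<in>A. (if a = b then wt x else 0) + (\<Sum>w\<in>set (butlast (q a)). wt w))"
        by (intro sum.cong) (auto simp: bl)
      then show ?thesis using \<open>finite A\<close> b(1) by (simp add: sum.distrib)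
    qed
    ultimately show ?thesis using xs by (simp add: add.assoc add.left_commute)
  next
    case 3
    have spB: "spider_in V E x B q" unfolding spider_in_def
      using sp disj xs by (auto simp: B_def)
    consider "A - B = {}" | c where "A - B = {c}" | "2 \<le> card (A - B)"
      using \<open>finite A\<close> by (metis One_nat_def Suc_1 card_0_eq card_1_singletonE le_less_linear less_2_cases finite_Diff)
    then show ?thesis
    proof cases
      case 1
      then have AB: "A = B" using B by auto
      have "(wt x + ?W q B) * card A \<le> card B * (sum wt (set (x # xs)) + ?W q A)"
        using xs sum_nonneg[of "set xs" wt] wt by (simp add: AB mult.commute mult_left_mono)
      then show ?thesis using 3 B spB by blast
    next
      case (2 c)
      then have c: "c \<in> A" "c \<notin> B" "last (q c) \<in> set xs" using C[of c] by auto
      \<comment> \<open>The single terminal left over is led to \<open>x\<close> through unprocessed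
        vertices. Their weight is counted at most once, so the spider that contains all of
        \<open>A\<close> costs no more than the total weight.\<close>
      obtain r where r: "simple_path (set (x # xs)) E (last (q c)) r x"
        using grown_path[of E "x # xs"] Cons.prems(1) c(3) by (metis list.set_intros(1,2))
      define p where "p = q(c := butlast (q c) @ r)"
      have rne: "r \<noteq> []" using r by (auto simp: simple_path_def)
      have "set r = insert x (set (butlast r))" "x \<notin> set (butlast r)"
        using r rne by (metis append_butlast_last_id list.simps(15) rotate1.simps(2) set_rotate1 simple_path_def,
          metis append_butlast_last_id distinct_append disjoint_insert(1) list.set(2) simple_path_def)
      moreover have "set r \<subseteq> set (x # xs)" using r by (simp add: simple_path_def)
      ultimately have br: "set (butlast r) \<subseteq> set xs" by auto
      have bl: "set (butlast (p a)) = (if a = c then set (butlast (q c)) \<union> set (butlast r) else set (butlast (q a)))" for a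
        using rne by (simp add: p_def butlast_append)
      have qc: "q c = butlast (q c) @ [last (q c)]" "q c \<noteq> []" using sp(1)[OF c(1)] by (auto simp: simple_path_def)
      have "simple_path V E c (butlast (q c) @ r) x"
      proof -
        have "hd (butlast (q c) @ r) = hd (butlast (q c) @ [last (q c)])"
          using r by (cases "butlast (q c)") (auto simp: simple_path_def)
        also have "\<dots> = c" using sp(1)[OF c(1)] qc(1) by (simp add: simple_path_def)
        finally have "hd (butlast (q c) @ r) = c" .
        moreover have "distinct (butlast (q c) @ r)"
          using sp(1)[OF c(1)] r off c(1) by (auto simp: simple_path_def distinct_butlast)
        moreover have "successively (\<lambda>x y. {x, y} \<in> E) (butlast (q c) @ r)"
        proof -
          have "successively (\<lambda>x y. {x, y} \<in> E) (butlast (q c) @ [last (q c)])"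
            using sp(1)[OF c(1)] qc(1) by (simp add: simple_path_def)
          then show ?thesis using r by (auto simp: successively_append_iff simple_path_def)
        qed
        moreover have "set (butlast (q c)) \<subseteq> V" using sp(1)[OF c(1)]
          by (auto simp: simple_path_def dest: in_set_butlastD)
        ultimately show ?thesis using r xs rne by (auto simp: simple_path_def)
      qed
      note pathc = this
      have off': "set (butlast (q a)) \<inter> set (butlast r) = {}" if "a \<in> A" for a
        using off that br by (meson disjoint_iff list.set_intros(2) subsetD)
      have "spider_in V E x A p"
        unfolding spider_in_def
      proof (intro conjI ballI impI)
        fix a assume a: "a \<in> A"
        show "simple_path V E a (p a) x"
        proof (cases "a = c")
          case False
          then have "a \<in> B" using 2 a by blast
          then show ?thesis using sp(1)[OF a] False by (simp add: p_def B_def)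
        qed (use pathc in \<open>simp add: p_def\<close>)
        fix b assume b: "b \<in> A" "a \<noteq> b"
        have "set (butlast (q a)) \<inter> set (butlast (q b)) = {}" using disj a b by blast
        then show "set (butlast (p a)) \<inter> set (butlast (p b)) = {}"
          unfolding bl disjoint_iff using off'[OF a] off'[OF b(1)] b(2) by (simp add: disjoint_iff) blast
      qed (rule xs(4))
      moreover have "(wt x + ?W p A) * card A \<le> card A * (sum wt (set (x # xs)) + ?W q A)"
      proof -
        have "(\<Sum>w\<in>set (butlast (p a)). wt w) \<le> (if a = c then sum wt (set xs) else 0) + (\<Sum>w\<in>set (butlast (q a)). wt w)" for a
        proof (cases "a = c")
          case True
          have "sum wt (set (butlast (q c)) \<union> set (butlast r)) \<le> sum wt (set (butlast (q c))) + sum wt (set (butlast r))"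
            using sum_Un[of "set (butlast (q c))" "set (butlast r)" wt] sum_nonneg[of "set (butlast (q c)) \<inter> set (butlast r)" wt] wt by simp
          also have "sum wt (set (butlast r)) \<le> sum wt (set xs)" using br wt by (intro sum_mono2) auto
          finally show ?thesis using True by (simp add: bl)
        qed (simp add: bl)
        then have "?W p A \<le> (\<Sum>a\<in>A. (if a = c then sum wt (set xs) else 0) + (\<Sum>w\<in>set (butlast (q a)). wt w))"
          by (rule sum_mono)
        also have "\<dots> = sum wt (set xs) + ?W q A" using \<open>finite A\<close> c(1) by (simp add: sum.distrib)
        finally show ?thesis using xs by (simp add: mult.commute mult_left_mono)
      qed
      ultimately show ?thesis using \<open>2 \<le> card A\<close> by blast
    next
      case 4: 3
      have "\<exists>x B' p. B' \<subseteq> A - B \<and> 2 \<le> card B' \<and> spider_in V E x B' p \<and>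
        (wt x + ?W p B') * card (A - B) \<le> card B' * (sum wt (set xs) + ?W q (A - B))"
        by (rule Cons.IH) (use Cons.prems 4 C' in auto)
      then obtain x' B' p where *: "B' \<subseteq> A - B" "2 \<le> card B'" "spider_in V E x' B' p"
        "(wt x' + ?W p B') * card (A - B) \<le> card B' * (sum wt (set xs) + ?W q (A - B))" by blast
      define c1 c2 W2 where "c1 = wt x + ?W q B" and "c2 = wt x' + ?W p B'" and "W2 = sum wt (set xs) + ?W q (A - B)"
      have tot: "sum wt (set (x # xs)) + ?W q A = c1 + W2" using xs by (simp add: W c1_def W2_def)
      \<comment> \<open>Either the spider at \<open>x\<close> costs at most the average per
        terminal, or the average over \<open>A - B\<close> is at most that over \<open>A\<close>,
        and the spider found there by induction meets the bound.\<close>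
      show ?thesis
      proof (cases "c1 * card A \<le> card B * (c1 + W2)")
        case True
        then show ?thesis unfolding tot using spB B 3 c1_def by blast
      next
        case False
        have k: "0 < real (card (A - B))" using 4 by simp
        have "real (card B) * W2 \<le> c1 * card (A - B)"
          using False by (simp add: cardA algebra_simps)
        then have "card B' * (card B * W2) \<le> card B' * (c1 * card (A - B))" by (rule mult_left_mono) simp
        moreover have "(c2 * card (A - B)) * card A \<le> (card B' * W2) * card A"
          using *(4) unfolding c2_def W2_def by (rule mult_right_mono) simp
        moreover have "(card B' * W2) * card A = card B' * (card B * W2) + card B' * W2 * card (A - B)"
          by (simp add: cardA algebra_simps)
        ultimately have "(c2 * card A) * card (A - B) \<le> (card B' * (c1 + W2)) * card (A - B)"
          by (simp add: algebra_simps)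
        then have "c2 * card A \<le> card B' * (c1 + W2)" using mult_right_le_imp_le[OF _ k] by blast
        then show ?thesis unfolding tot using * c2_def by blast
      qed
    qed
  qed
qed

text \<open>Averaging over disjoint spiders that cover \<open>A\<close>. The induction starts from
  the paths \<open>[a]\<close>, which have no weight without their last vertex.\<close>

lemma spider_exists:
  fixes wt :: "'v \<Rightarrow> real"
  assumes "connected_graph V E" "A \<subseteq> V" "2 \<le> card A" "\<And>v. 0 \<le> wt v"
  shows "\<exists>x B p. B \<subseteq> A \<and> 2 \<le> card B \<and> spider_in V E x B p \<and>
    (wt x + (\<Sum>a\<in>B. \<Sum>w\<in>set (butlast (p a)). wt w)) * card A \<le> card B * (\<Sum>w\<in>V. wt w)"
proof -
  obtain xs where xs: "grown E xs" "set xs = V" using connected_grown[OF assms(1)] by blast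
  have "finite A" using assms(2) xs(2) by (metis List.finite_set finite_subset)
  have "\<exists>x B p. B \<subseteq> A \<and> 2 \<le> card B \<and> spider_in V E x B p \<and>
    (wt x + (\<Sum>a\<in>B. \<Sum>w\<in>set (butlast (p a)). wt w)) * card A
      \<le> card B * ((\<Sum>w\<in>set xs. wt w) + (\<Sum>a\<in>A. \<Sum>w\<in>set (butlast [a]). wt w))"
    by (rule spider_from_paths[of E xs V A wt "\<lambda>a. [a]"])
       (use assms xs \<open>finite A\<close> in \<open>auto simp: simple_path_def\<close>)
  then show ?thesis using xs by simp
qed

section \<open>Adding a leaf to a tree\<close>

text \<open>An inner vertex of a path has two distinct neighbours on it, but \<open>w\<close> is
  adjacent to \<open>u\<close> only.\<close>

lemma simple_path_avoids_leaf:
  assumes "ugraph U F" "w \<notin> U" "simple_path (insert w U) (insert {u, w} F) a p b" "a \<noteq> w" "b \<noteq> w"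
  shows "simple_path U F a p b"
proof -
  have only: "y = u" if "{y, w} \<in> insert {u, w} F" for y
    using that assms(1,2) by (auto simp: ugraph_def doubleton_eq_iff)
  have w: "w \<notin> set p"
  proof
    assume "w \<in> set p"
    then obtain xs ys where p: "p = xs @ w # ys" by (meson split_list)
    have "xs \<noteq> []" "ys \<noteq> []" using assms(3-5) by (auto simp: p simple_path_def)
    with assms(3) have "{last xs, w} \<in> insert {u, w} F" "{hd ys, w} \<in> insert {u, w} F"
      by (auto simp: p simple_path_def successively_append_iff successively_Cons insert_commute)
    then have "last xs = u" "hd ys = u" using only by blast+
    then have "u \<in> set xs \<inter> set ys" using \<open>xs \<noteq> []\<close> \<open>ys \<noteq> []\<close> last_in_set hd_in_set by fastforce
    then show False using assms(3) by (auto simp: p simple_path_def)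
  qed
  have "successively (\<lambda>x y. {x, y} \<in> F) p"
    using assms(3) w unfolding simple_path_def
    by (elim conjE) (erule successively_mono, auto simp: doubleton_eq_iff)
  then show ?thesis using assms(3) w by (auto simp: simple_path_def)
qed

lemma tree_add_leaf:
  assumes tree: "tree_graph U F" and u: "u \<in> U" and w: "w \<notin> U"
  shows "tree_graph (insert w U) (insert {u, w} F)"
proof -
  let ?F = "insert {u, w} F" and ?U = "insert w U"
  have ug: "ugraph U F" using tree by (simp add: tree_graph_def connected_graph_def)
  have only: "y = u" if "{y, w} \<in> ?F" for y
    using that ug w by (auto simp: ugraph_def doubleton_eq_iff)
  have mono: "simple_path ?U ?F a p b" if "simple_path U F a p b" for a p b
    using that by (auto simp: simple_path_def elim!: successively_mono)
  have path: "\<exists>p. simple_path U F a p b" if "a \<in> U" "b \<in> U" for a b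
    using tree that by (auto simp: tree_graph_def connected_graph_def)
  have 1: "\<exists>p. simple_path ?U ?F a p b" if ab: "a \<in> ?U" "b \<in> ?U" for a b
  proof -
    consider "a = b" | "a \<in> U" "b \<in> U" | "a = w" "b \<in> U" | "b = w" "a \<in> U" using ab by auto
    then show ?thesis
    proof cases
      case 1
      then show ?thesis using ab by (intro exI[of _ "[a]"]) (auto simp: simple_path_def)
    next
      case 2
      then show ?thesis using path mono by blast
    next
      case 3
      then obtain p where p: "simple_path U F u p b" using path u by blast
      then have "simple_path ?U ?F w (w # p) b" using mono[OF p] w
        by (auto simp: simple_path_def successively_Cons insert_commute)
      then show ?thesis using 3 by blast
    next
      case 4
      then obtain p where p: "simple_path U F a p u" using path u by blast
      then have "simple_path ?U ?F a (p @ [w]) w" using mono[OF p] w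
        by (auto simp: simple_path_def successively_append_iff)
      then show ?thesis using 4 by blast
    qed
  qed
  have "acyclic_graph ?U ?F" unfolding acyclic_graph_def
  proof (intro notI, elim exE conjE)
    fix a p b assume p: "simple_path ?U ?F a p b" "3 \<le> length p" "{b, a} \<in> ?F"
    \<comment> \<open>Both ends of the list are exposed because \<open>w\<close> could be the first
      or the last vertex of the closed path; its two neighbours there would both be
      \<open>u\<close>.\<close>
    obtain x y z zs where xs: "p = x # y # z # zs" using p(2) by (auto simp: numeral_3_eq_3 Suc_le_length_iff)
    obtain zs' y' where ys: "p = zs' @ [y', b]" "zs' \<noteq> []"
    proof -
      obtain b' y' z' zs' where r: "rev p = b' # y' # z' # zs'"
        using p(2) by (metis Suc_le_length_iff length_rev numeral_3_eq_3)
      then have "p = rev (z' # zs') @ [y', b']" by (metis append.assoc append_Cons append_Nil rev.simps(2) rev_rev_ident)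
      moreover from this have "b' = b" using p(1) by (auto simp: simple_path_def)
      ultimately show thesis using that[of "rev (z' # zs')" y'] by simp
    qed
    consider "a = w" | "b = w" | "a \<noteq> w" "b \<noteq> w" by auto
    then show False
    proof cases
      case 1
      have "y = u" "b = u" using p(1,3) 1 only
        by (auto simp: simple_path_def xs insert_commute[of w])
      then show False using p(1) by (auto simp: simple_path_def xs split: if_splits)
    next
      case 2
      have "y' = u" "a = u" using p(1,3) 2 only
        by (auto simp: simple_path_def ys successively_append_iff insert_commute[of w])
      then show False using p(1) ys(2) by (auto simp: simple_path_def ys hd_append split: if_splits)
    next
      case 3
      have "simple_path U F a p b" using simple_path_avoids_leaf[OF ug w p(1) 3] .
      moreover have "{b, a} \<in> F" using p(3) 3 by (auto simp: doubleton_eq_iff)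
      ultimately show False using tree p(2) unfolding tree_graph_def acyclic_graph_def by blast
    qed
  qed
  moreover have "ugraph ?U ?F" using ug u w by (auto simp: ugraph_def card_insert_if)
  ultimately show ?thesis using 1 by (auto simp: tree_graph_def connected_graph_def)
qed

lemma tree_singleton: "tree_graph {r} {}"
  by (auto simp: tree_graph_def connected_graph_def acyclic_graph_def ugraph_def simple_path_def
    intro!: exI[of _ "[r]"])

section \<open>Correctness\<close>

lemma mcost_Nil [simp]: "mcost C [] = 0"
  by (simp add: mcost_def)

lemma mcost_Cons: "mcost C (m # ms) = mcost C [m] + mcost C ms"
  by (simp add: mcost_def)

lemma mcost_append: "mcost C (ms @ ns) = mcost C ms + mcost C ns"
  by (simp add: mcost_def)

lemma mcost_sum_list: "mcost C ms = (\<Sum>m\<leftarrow>ms. mcost C [m])"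
proof (induction ms)
  case (Cons m ms)
  then show ?case using mcost_Cons[of C m ms] by simp
qed simp

lemma mcost_concat: "mcost C (concat xss) = (\<Sum>xs\<leftarrow>xss. mcost C xs)"
  by (induction xss) (auto simp: mcost_append)

lemma mcost_eq_sum: "distinct ms \<Longrightarrow> mcost C ms = (\<Sum>m\<in>set ms. mcost C [m])"
  by (subst mcost_sum_list) (rule sum_list_distinct_conv_sum_set)

text \<open>The greedy phase may buy a mark repeatedly, while the tree uses it at most once; so the
  tree costs no more than what was paid.\<close>

lemma mcost_subset:
  assumes "set ms \<subseteq> set ns" "distinct ms" shows "mcost C ms \<le> mcost C ns"
proof -
  have "sum f (set ns) \<le> (\<Sum>m\<leftarrow>ns. f m)" for f :: "_ \<Rightarrow> nat"
  proof (induction ns)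
    case (Cons n ns)
    then show ?case by (cases "n \<in> set ns") (auto simp: insert_absorb)
  qed simp
  then have "(\<Sum>m\<in>set ns. mcost C [m]) \<le> mcost C ns" by (subst (2) mcost_sum_list)
  moreover have "(\<Sum>m\<in>set ms. mcost C [m]) \<le> (\<Sum>m\<in>set ns. mcost C [m])"
    using assms(1) by (intro sum_mono2) auto
  ultimately show ?thesis using mcost_eq_sum[OF assms(2)] by simp
qed

lemma ex_max: "finite B \<Longrightarrow> B \<noteq> {} \<Longrightarrow> \<exists>r\<in>B. \<forall>a\<in>B. f a \<le> (f r :: 'k :: linorder)"
  using Max_in[of "f ` B"] Max_ge[of "f ` B"] by fastforce

text \<open>Adding \<open>d t\<close> to the sum lowers the ratio exactly if \<open>d t\<close> is below it.\<close>

lemma best_threshold: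
  fixes d :: "'a \<Rightarrow> real" and c \<rho> :: real
  assumes "finite L" "B \<subseteq> L" "B \<noteq> {}" "c + sum d B \<le> \<rho> * Suc (card B)"
  shows "\<exists>u\<in>L. c + d u \<le> \<rho> * 2 \<or> c + sum d {t \<in> L. d t \<le> d u} \<le> \<rho> * Suc (card {t \<in> L. d t \<le> d u})"
proof -
  have fB: "finite B" using assms finite_subset by blast
  have B: "c + (\<Sum>t\<in>B. d t - \<rho>) \<le> \<rho>"
    using assms(4) by (simp add: sum_subtractf algebra_simps)
  \<comment> \<open>This set minimizes the sum of \<open>d t - \<rho>\<close> over all subsets of
    \<open>L\<close>. The largest value of \<open>d\<close> on it is the required threshold.\<close>
  let ?M = "{t \<in> L. d t \<le> \<rho>}"
  have fM: "finite ?M" using assms(1) by simp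
  show ?thesis
  proof (cases "?M = {}")
    \<comment> \<open>All these differences are positive, so a single element of \<open>B\<close>
      does at least as well as \<open>B\<close>.\<close>
    case True
    obtain u where u: "u \<in> B" using assms(3) by blast
    have "(\<Sum>t\<in>{u}. d t - \<rho>) \<le> (\<Sum>t\<in>B. d t - \<rho>)"
      using True u fB assms(2) by (intro sum_mono2) force+
    then have "c + d u \<le> \<rho> * 2" using B by simp
    then show ?thesis using u assms(2) by blast
  next
    case False
    then obtain u where u: "u \<in> ?M" "\<forall>t\<in>?M. d t \<le> d u" using ex_max[OF fM, of d] by blast
    then have M: "{t \<in> L. d t \<le> d u} = ?M" by auto
    have "(\<Sum>t\<in>?M. d t - \<rho>) \<le> (\<Sum>t\<in>?M \<inter> B. d t - \<rho>)"
      using sum_nonneg[of "?M - B" "\<lambda>t. \<rho> - d t"] sum.Int_Diff[OF fM, of "\<lambda>t. d t - \<rho>" B]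
      by (simp add: sum_subtractf)
    also have "\<dots> \<le> (\<Sum>t\<in>B. d t - \<rho>)"
      using fB assms(2) by (intro sum_mono2) force+
    finally have "c + sum d ?M \<le> \<rho> * Suc (card ?M)"
      using B by (simp add: sum_subtractf algebra_simps)
    then show ?thesis using u(1) unfolding M[symmetric] by blast
  qed
qed

lemma simple_path_join:
  assumes p: "simple_path V E a p x" and q: "simple_path V E b q x"
    and "set (butlast p) \<inter> set (butlast q) = {}"
  shows "simple_path V E a (butlast p @ x # rev (butlast q)) b"
proof -
  have pq: "p = butlast p @ [x]" "q = butlast q @ [x]"
    using p q by (metis append_butlast_last_id simple_path_def)+
  define p' q' where "p' = butlast p" and "q' = butlast q"
  note pq' = pq[folded p'_def q'_def]
  have "simple_path V E a (p' @ [x]) x" "simple_path V E b (q' @ [x]) x" "set p' \<inter> set q' = {}"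
    using p q pq' assms(3) by (auto simp: p'_def[symmetric] q'_def[symmetric])
  then have "simple_path V E a (p' @ x # rev q') b"
    by (cases q'; cases p')
       (auto simp: simple_path_def successively_append_iff successively_Cons successively_rev
         insert_commute last_rev hd_rev hd_append)
  then show ?thesis by (simp add: p'_def q'_def)
qed

lemma in_set_concat_map: "y \<in> set (concat (map f xs)) \<longleftrightarrow> (\<exists>x\<in>set xs. y \<in> set (f x))"
  by auto

lemma in_set_if: "y \<in> set (if c then xs else []) \<longleftrightarrow> c \<and> y \<in> set xs"
  by simp

lemma length_eq_1: "length xs = 1 \<Longrightarrow> \<exists>x. xs = [x]"
  by (cases xs) auto

text \<open>The combinatorial part works with natural costs that are monotone in the grade and
  vanish for terminals at their own grade; scaling an instance provides them.\<close>

locale gsst_run =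
  fixes V :: "nat set" and E :: "nat set set" and R :: "nat \<Rightarrow> nat" and l :: nat
    and C :: "((nat \<times> nat) \<times> nat) list" and arcs :: "(nat \<times> nat) list" and vs tl :: "nat list"
  assumes connected: "connected_graph V E"
    and vs: "set vs = V" "distinct vs"
    and arcs: "\<And>u v. (u, v) \<in> set arcs \<longleftrightarrow> {u, v} \<in> E"
    and tl: "distinct tl" "set tl \<subseteq> V" "tl \<noteq> []" "\<And>t. t \<in> set tl \<Longrightarrow> R t \<in> {1..l}"
    and mono: "\<And>w i j. w \<in> V \<Longrightarrow> 1 \<le> i \<Longrightarrow> i \<le> j \<Longrightarrow> j \<le> l \<Longrightarrow> mcost C [(w, i)] \<le> mcost C [(w, j)]"
    and zero: "\<And>t. t \<in> set tl \<Longrightarrow> mcost C [(t, R t)] = 0"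
begin

definition "ts = map (\<lambda>v. (v, R v)) tl"

lemma ts: "t \<in> set ts \<longleftrightarrow> fst t \<in> set tl \<and> snd t = R (fst t)"
  by (cases t) (auto simp: ts_def)

lemma edge_in: "{u, v} \<in> E \<Longrightarrow> u \<in> V \<and> v \<in> V"
  using connected by (auto simp: connected_graph_def ugraph_def)

lemma finV: "finite V" using vs by auto

section \<open>Cheapest legs\<close>

definition legwalk :: "nat \<Rightarrow> nat \<Rightarrow> nat list \<Rightarrow> bool" where
  "legwalk x v q \<longleftrightarrow> hd (q @ [x]) = v \<and> successively (\<lambda>a b. {a, b} \<in> E) (q @ [x]) \<and> set q \<subseteq> V"

lemma legwalk_Cons: "legwalk x v q \<Longrightarrow> {u, v} \<in> E \<Longrightarrow> legwalk x u (u # q)"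
  using edge_in[of u v] by (cases q) (auto simp: legwalk_def)

text \<open>Entries are walks, possibly with repeated vertices; this is harmless, as a leg matters
  only through its cost and the connection that it provides.\<close>

lemma legs_sound:
  assumes "e \<in> set (foldl (\<lambda>tab _. relax C arcs vs g tab) [(x, [])] ys)"
  shows "\<exists>q. snd e = map (\<lambda>w. (w, g)) q \<and> legwalk x (fst e) q"
  using assms
proof (induction ys arbitrary: e rule: rev_induct)
  case Nil
  then show ?case by (auto simp: legwalk_def)
next
  case (snoc y ys)
  let ?t = "foldl (\<lambda>tab _. relax C arcs vs g tab) [(x, [])] ys"
  have "e \<in> set (relax C arcs vs g ?t)" using snoc.prems by simp
  from relax_entry[OF this] show ?case
  proof (elim disjE bexE conjE)
    assume "e \<in> set ?t"
    then show ?thesis by (rule snoc.IH)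
  next
    fix e' a assume *: "e' \<in> set ?t" "a \<in> set arcs" "fst a = fst e'" "e = (snd a, (snd a, g) # snd e')"
    obtain q where "snd e' = map (\<lambda>w. (w, g)) q" "legwalk x (fst e') q" using snoc.IH[OF *(1)] by blast
    moreover have "{snd a, fst e'} \<in> E" using arcs[of "fst e'" "snd a"] *(2,3) by (metis insert_commute prod.collapse)
    ultimately show ?thesis using legwalk_Cons *(4) by (intro exI[of _ "snd a # q"]) auto
  qed
qed

lemma relax_best:
  assumes v: "v \<in> set vs"
    and d: "d \<in> set tab \<or> (\<exists>e\<in>set tab. \<exists>a\<in>set arcs. fst a = fst e \<and> d = (snd a, (snd a, g) # snd e))" "fst d = v"
  shows "(\<exists>e\<in>set (relax C arcs vs g tab). fst e = v) \<and>
    (\<forall>e\<in>set (relax C arcs vs g tab). fst e = v \<longrightarrow> mcost C (snd e) \<le> mcost C (snd d))"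
proof -
  define cand where "cand = tab @ concat (map (\<lambda>e. concat (map (\<lambda>a.
        if fst a = fst e then [(snd a, (snd a, g) # snd e)] else []) arcs)) tab)"
  define best where "best = (\<lambda>v. bestl (\<lambda>a b. mcost C (snd a) < mcost C (snd b)) (filter (\<lambda>e. fst e = v) cand))"
  have relax: "set (relax C arcs vs g tab) = (\<Union>v\<in>set vs. set (best v))"
    unfolding relax_def best_def cand_def set_concat set_map by blast
  have "d \<in> set cand" using d(1)
  proof
    assume "\<exists>e\<in>set tab. \<exists>a\<in>set arcs. fst a = fst e \<and> d = (snd a, (snd a, g) # snd e)"
    then obtain e a where e: "e \<in> set tab" "a \<in> set arcs" "fst a = fst e" "d = (snd a, (snd a, g) # snd e)"
      by blast
    then have "d \<in> set (concat (map (\<lambda>a. if fst a = fst e then [(snd a, (snd a, g) # snd e)] else []) arcs))"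
      by (auto intro!: bexI[of _ a])
    then show ?thesis using e(1) unfolding cand_def set_append set_concat[of "map _ tab"] set_map[of _ tab] by blast
  qed (simp add: cand_def)
  then have dc: "d \<in> set (filter (\<lambda>e. fst e = v) cand)" using d(2) by simp
  then obtain e where e: "e \<in> set (filter (\<lambda>e. fst e = v) cand)" "best v = [e]"
    "\<forall>z\<in>set (filter (\<lambda>e. fst e = v) cand). mcost C (snd e) \<le> mcost C (snd z)"
    using bestl_cases[of "filter (\<lambda>e. fst e = v) cand" "\<lambda>a b. mcost C (snd a) < mcost C (snd b)" "\<lambda>a. mcost C (snd a)"]
    unfolding best_def by fastforce
  have fst_best: "fst e' = v'" if "e' \<in> set (best v')" for e' v'
    using bestl_in[of e' _ "filter (\<lambda>e. fst e = v') cand"] that unfolding best_def by auto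
  show ?thesis
  proof (intro conjI ballI impI)
    show "\<exists>e\<in>set (relax C arcs vs g tab). fst e = v"
      using e v unfolding relax by (intro bexI[of _ e] UN_I[of v]) auto
    fix e' assume "e' \<in> set (relax C arcs vs g tab)" "fst e' = v"
    then have "e' \<in> set (best v)" unfolding relax using fst_best[of e'] by blast
    then have "e' = e" using e(2) by simp
    then show "mcost C (snd e') \<le> mcost C (snd d)" using e(3) dc by blast
  qed
qed

text \<open>The Bellman-Ford argument: a walk with one more vertex than the earlier rounds can
  handle loses its first vertex, and the next round puts that vertex in front of an optimal entry
  for the rest.\<close>

lemma legs_complete:
  assumes "length q \<le> length ys" "legwalk x v q" "x \<in> V"
  shows "(\<exists>e\<in>set (foldl (\<lambda>tab _. relax C arcs vs g tab) [(x, [])] ys). fst e = v) \<and>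
    (\<forall>e\<in>set (foldl (\<lambda>tab _. relax C arcs vs g tab) [(x, [])] ys). fst e = v \<longrightarrow>
       mcost C (snd e) \<le> mcost C (map (\<lambda>w. (w, g)) q))"
  using assms
proof (induction ys arbitrary: q v rule: rev_induct)
  case Nil
  then show ?case by (auto simp: legwalk_def)
next
  case (snoc y ys)
  let ?t = "foldl (\<lambda>tab _. relax C arcs vs g tab) [(x, [])] ys"
  have v: "v \<in> set vs" using snoc.prems(2,3) vs by (cases q) (auto simp: legwalk_def)
  have "\<exists>d. (d \<in> set ?t \<or> (\<exists>e\<in>set ?t. \<exists>a\<in>set arcs. fst a = fst e \<and> d = (snd a, (snd a, g) # snd e))) \<and>
     fst d = v \<and> mcost C (snd d) \<le> mcost C (map (\<lambda>w. (w, g)) q)"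
  proof (cases "length q \<le> length ys")
    case True
    then show ?thesis using snoc.IH[OF True snoc.prems(2,3)] by blast
  next
    case False
    then obtain q' where q: "q = v # q'" "length q' \<le> length ys"
      using snoc.prems(1,2) by (cases q) (auto simp: legwalk_def)
    define v' where "v' = hd (q' @ [x])"
    have *: "legwalk x v' q'" "{v, v'} \<in> E" using snoc.prems(2) q
      by (auto simp: legwalk_def v'_def successively_Cons)
    obtain e where e: "e \<in> set ?t" "fst e = v'" "mcost C (snd e) \<le> mcost C (map (\<lambda>w. (w, g)) q')"
      using snoc.IH[OF q(2) *(1) snoc.prems(3)] by blast
    have "(v', v) \<in> set arcs" using * arcs by (simp add: insert_commute)
    moreover have "mcost C ((v, g) # snd e) \<le> mcost C (map (\<lambda>w. (w, g)) q)"
      using e(3) q(1) mcost_Cons[of C "(v, g)" "snd e"] mcost_Cons[of C "(v, g)" "map (\<lambda>w. (w, g)) q'"] by simp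
    ultimately show ?thesis using e(1,2)
      by (intro exI[of _ "(v, (v, g) # snd e)"] conjI disjI2 bexI[of _ e] bexI[of _ "(v', v)"]) simp_all
  qed
  then obtain d where d: "d \<in> set ?t \<or> (\<exists>e\<in>set ?t. \<exists>a\<in>set arcs. fst a = fst e \<and> d = (snd a, (snd a, g) # snd e))"
    "fst d = v" "mcost C (snd d) \<le> mcost C (map (\<lambda>w. (w, g)) q)" by blast
  from relax_best[OF v d(1,2)] d(3) show ?case by force
qed

lemma simple_path_legwalk:
  assumes "simple_path V E t p x"
  shows "legwalk x t (butlast p)" "length (butlast p) \<le> length vs"
proof -
  have p: "butlast p @ [x] = p" using assms by (metis append_butlast_last_id simple_path_def)
  then show "legwalk x t (butlast p)" using assms unfolding legwalk_def p
    by (auto simp: simple_path_def dest: in_set_butlastD)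
  have "length p \<le> card V" using assms finV by (metis simple_path_def distinct_card card_mono)
  then show "length (butlast p) \<le> length vs" using vs distinct_card by fastforce
qed

lemma leg:
  assumes "x \<in> V" "t \<in> V"
  shows "\<exists>q. leg C arcs vs x g t = map (\<lambda>w. (w, g)) q \<and> legwalk x t q"
    and "simple_path V E t p x \<Longrightarrow> mcost C (leg C arcs vs x g t) \<le> mcost C (map (\<lambda>w. (w, g)) (butlast p))"
proof -
  obtain p0 where p0: "simple_path V E t p0 x" using connected assms by (auto simp: connected_graph_def)
  let ?f = "filter (\<lambda>e. fst e = t) (legs C arcs vs x g)"
  have "?f \<noteq> []" using legs_complete[OF simple_path_legwalk(2,1)[OF p0] assms(1)]
    by (auto simp: legs_def filter_empty_conv)
  then obtain e es where f: "?f = e # es" by (cases ?f) auto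
  then have "leg C arcs vs x g t = snd e" "e \<in> set ?f" by (simp_all add: leg_def)
  then have e: "leg C arcs vs x g t = snd e" "e \<in> set (legs C arcs vs x g)" "fst e = t"
    by simp_all
  show "\<exists>q. leg C arcs vs x g t = map (\<lambda>w. (w, g)) q \<and> legwalk x t q"
    using legs_sound[of e g x vs] e by (simp add: legs_def)
  show "mcost C (leg C arcs vs x g t) \<le> mcost C (map (\<lambda>w. (w, g)) (butlast p))" if p: "simple_path V E t p x"
    using legs_complete[OF simple_path_legwalk(2,1)[OF p] assms(1)] e by (simp add: legs_def)
qed

text \<open>Connection in the graph induced by the vertices bought at grade at least
  \<open>g\<close>; reflexivity holds at all vertices, bought or not.\<close>

definition conn :: "(nat \<times> nat) list \<Rightarrow> nat \<Rightarrow> (nat \<times> nat) set" where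
  "conn Y g = {(u, v). {u, v} \<in> E \<and> (\<exists>i\<ge>g. (u, i) \<in> set Y) \<and> (\<exists>i\<ge>g. (v, i) \<in> set Y)}\<^sup>*"

lemma conn_mono: "set Y \<subseteq> set Z \<Longrightarrow> h \<le> g \<Longrightarrow> conn Y g \<subseteq> conn Z h"
  unfolding conn_def by (intro rtrancl_mono) (auto intro: order_trans)

lemma conn_sym: "(u, v) \<in> conn Y g \<Longrightarrow> (v, u) \<in> conn Y g"
proof -
  have "sym (conn Y g)" unfolding conn_def by (intro sym_rtrancl) (auto simp: sym_def insert_commute)
  then show "(u, v) \<in> conn Y g \<Longrightarrow> (v, u) \<in> conn Y g" by (auto dest: symD)
qed

lemma conn_trans: "(u, v) \<in> conn Y g \<Longrightarrow> (v, w) \<in> conn Y g \<Longrightarrow> (u, w) \<in> conn Y g"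
  unfolding conn_def by (rule rtrancl_trans)

lemma conn_leg:
  assumes "legwalk x t q" "\<exists>i\<ge>g. (x, i) \<in> set Y" "\<forall>w\<in>set q. \<exists>i\<ge>g. (w, i) \<in> set Y"
  shows "(t, x) \<in> conn Y g"
  using assms
proof (induction q arbitrary: t)
  case (Cons u q)
  then have "legwalk x (hd (q @ [x])) q" "{u, hd (q @ [x])} \<in> E" "u = t"
    by (auto simp: legwalk_def successively_Cons)
  moreover have "\<exists>i\<ge>g. (hd (q @ [x]), i) \<in> set Y" using Cons.prems by (cases q) auto
  ultimately show ?case using Cons.IH[of "hd (q @ [x])"] Cons.prems
    unfolding conn_def by (auto intro: converse_rtrancl_into_rtrancl)
qed (simp add: legwalk_def conn_def)

section \<open>The candidate spiders\<close>

lemma spiders_elem: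
  "b \<in> set (spiders C arcs vs A) \<longleftrightarrow> (\<exists>x\<in>set vs. \<exists>r\<in>set A. \<exists>s\<in>set A. \<exists>u\<in>set A. snd s \<le> snd r \<and> u \<noteq> r \<and> snd u \<le> snd s \<and>
     (b = spider C arcs vs x (snd s) r [u] \<or>
      b = spider C arcs vs x (snd s) r (filter (\<lambda>t. t \<noteq> r \<and> snd t \<le> snd s \<and>
               mcost C (leg C arcs vs x (snd t) (fst t)) \<le> mcost C (leg C arcs vs x (snd u) (fst u))) A)))"
  unfolding spiders_def in_set_concat_map in_set_if list.set insert_iff empty_iff by blast

text \<open>All that the correctness of a purchase depends on; how the terminals of the spider were
  selected matters only for its cost.\<close>

lemma spidersE:
  assumes "b \<in> set (spiders C arcs vs A)" "distinct A"
  obtains x r s ss where "x \<in> V" "r \<in> set A" "s \<in> set A" "snd s \<le> snd r" "b = spider C arcs vs x (snd s) r ss"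
    "ss \<noteq> []" "distinct ss" "set ss \<subseteq> set A - {r}" "\<forall>t\<in>set ss. snd t \<le> snd s"
proof -
  obtain x r s u where *: "x \<in> set vs" "r \<in> set A" "s \<in> set A" "u \<in> set A" "snd s \<le> snd r" "u \<noteq> r" "snd u \<le> snd s"
     "b = spider C arcs vs x (snd s) r [u] \<or>
      b = spider C arcs vs x (snd s) r (filter (\<lambda>t. t \<noteq> r \<and> snd t \<le> snd s \<and>
               mcost C (leg C arcs vs x (snd t) (fst t)) \<le> mcost C (leg C arcs vs x (snd u) (fst u))) A)"
    using assms(1) unfolding spiders_elem by blast
  have x: "x \<in> V" using * vs by auto
  from *(8) show thesis
  proof
    assume b: "b = spider C arcs vs x (snd s) r [u]"
    show thesis by (rule that[OF x *(2,3,5) b]) (use * in auto)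
  next
    assume b: "b = spider C arcs vs x (snd s) r (filter (\<lambda>t. t \<noteq> r \<and> snd t \<le> snd s \<and>
               mcost C (leg C arcs vs x (snd t) (fst t)) \<le> mcost C (leg C arcs vs x (snd u) (fst u))) A)"
    show thesis
      by (rule that[OF x *(2,3,5) b]) (use * assms(2) in \<open>auto simp: filter_empty_conv\<close>)
  qed
qed

lemma mcost_spider:
  "mcost C (fst (spider C arcs vs x g r ss)) = mcost C [(x, g)] + mcost C (leg C arcs vs x g (fst r)) +
     (\<Sum>t\<leftarrow>ss. mcost C (leg C arcs vs x (snd t) (fst t)))"
  unfolding spider_def fst_conv by (subst mcost_Cons) (simp add: mcost_append mcost_concat comp_def)

definition active :: "(nat \<times> nat) list \<Rightarrow> bool" where
  "active A \<longleftrightarrow> distinct A \<and> set A \<subseteq> set ts \<and> A \<noteq> []"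

text \<open>In a tree that is feasible for the active terminals, the leg of a terminal \<open>a\<close> extends to a path to
  the terminal \<open>r\<close> of highest grade, so all its vertices have grade at least \<open>R a\<close>.\<close>

lemma good_spider_exists:
  assumes A: "active A" "2 \<le> length A"
    and U: "connected_graph U F" "U \<subseteq> V" "F \<subseteq> E" "set tl \<subseteq> U"
    and y: "\<forall>w\<in>U. y w \<in> {1..l}"
    and path: "\<forall>u\<in>set tl. \<forall>v\<in>set tl. \<forall>p. simple_path U F u p v \<longrightarrow> (\<forall>w\<in>set p. min (R u) (R v) \<le> y w)"
  shows "\<exists>b\<in>set (spiders C arcs vs A).
    mcost C (fst b) * length A \<le> Suc (length (snd b)) * (\<Sum>w\<in>U. mcost C [(w, y w)])"
proof -
  define wt :: "nat \<Rightarrow> real" where "wt = (\<lambda>w. mcost C [(w, y w)])"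
  define A' where "A' = fst ` set A"
  have At: "t \<in> set A \<Longrightarrow> fst t \<in> set tl \<and> t = (fst t, R (fst t))" for t
    using A(1) ts[of t] by (cases t) (auto simp: active_def)
  have inj: "inj_on fst (set A)" by (rule inj_onI) (metis At)
  have A'A: "(a, R a) \<in> set A" if "a \<in> A'" for a using that At by (auto simp: A'_def)
  have cardA: "card A' = length A" using A(1) inj by (simp add: A'_def card_image active_def distinct_card)
  have A'tl: "A' \<subseteq> set tl" using At by (auto simp: A'_def)
  have "\<exists>x B p. B \<subseteq> A' \<and> 2 \<le> card B \<and> spider_in U F x B p \<and>
    (wt x + (\<Sum>a\<in>B. \<Sum>w\<in>set (butlast (p a)). wt w)) * card A' \<le> card B * (\<Sum>w\<in>U. wt w)"
    by (rule spider_exists) (use U A A'tl cardA in \<open>auto simp: wt_def\<close>)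
  then obtain x B p where B: "B \<subseteq> A'" "2 \<le> card B" "spider_in U F x B p"
    "(wt x + (\<Sum>a\<in>B. \<Sum>w\<in>set (butlast (p a)). wt w)) * card A' \<le> card B * (\<Sum>w\<in>U. wt w)" by blast
  have fB: "finite B" using B(2) card.infinite by fastforce
  have pB: "simple_path U F a (p a) x" if "a \<in> B" for a using B(3) that by (simp add: spider_in_def)
  have x: "x \<in> U" "x \<in> V" using B(3) U by (auto simp: spider_in_def)
  have "B \<noteq> {}" using B(2) by auto
  \<comment> \<open>The root is a terminal of highest grade in the spider; \<open>s\<close>, a
    maximum over the others, then gives the second highest grade, which the center and the leg of
    the root receive.\<close>
  then obtain r where r: "r \<in> B" "\<forall>a\<in>B. R a \<le> R r" using ex_max[OF fB, of R] by blast
  define B' where "B' = B - {r}"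
  have "card B' = card B - 1" using r fB by (simp add: B'_def)
  then have cardB: "card B = Suc (card B')" "B' \<noteq> {}" using B(2) by auto
  have "finite B'" using fB by (simp add: B'_def)
  then obtain s where s: "s \<in> B'" "\<forall>a\<in>B'. R a \<le> R s" using ex_max[OF _ cardB(2), of R] by blast
  have sB: "s \<in> B" "s \<noteq> r" using s by (auto simp: B'_def)
  have Btl: "a \<in> set tl" "a \<in> V" if "a \<in> B" for a using that B(1) A'tl tl(2) by auto
  \<comment> \<open>The legs of \<open>a\<close> and \<open>r\<close> make up the path between them,
    along which feasibility demands at least \<open>min (R a) (R r)\<close>, that is,
    \<open>R a\<close>.\<close>
  have low: "R a \<le> y w" if a: "a \<in> B'" and w: "w \<in> set (p a) \<union> set (p r)" for a w
  proof -
    have aB: "a \<in> B" "a \<noteq> r" using a by (auto simp: B'_def)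
    have sp: "simple_path U F a (butlast (p a) @ x # rev (butlast (p r))) r"
      using simple_path_join[OF pB[OF aB(1)] pB[OF r(1)]] B(3) aB r(1) by (auto simp: spider_in_def)
    have "p b = butlast (p b) @ [x]" if "b \<in> B" for b
      using pB[OF that] by (metis append_butlast_last_id simple_path_def)
    then have "set (p b) = insert x (set (butlast (p b)))" if "b \<in> B" for b
      using that by (metis list.simps(15) rotate1.simps(2) set_rotate1)
    then have "w \<in> set (butlast (p a) @ x # rev (butlast (p r)))"
      using w aB(1) r(1) by auto
    then have "min (R a) (R r) \<le> y w" using path sp Btl[OF aB(1)] Btl[OF r(1)] by blast
    then show ?thesis using r(2) aB(1) by auto
  qed
  have pathV: "simple_path V E a (p a) x" if "a \<in> B" for a
    using pB[OF that] U(2,3) by (auto simp: simple_path_def elim!: successively_mono)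
  \<comment> \<open>The leg inside the tree, lowered to grade \<open>g\<close>, competes with the
    leg chosen by the algorithm.\<close>
  have legcost: "real (mcost C (leg C arcs vs x g a)) \<le> (\<Sum>w\<in>set (butlast (p a)). wt w)"
    if a: "a \<in> B" and g: "1 \<le> g" "\<forall>w\<in>set (p a). g \<le> y w" for a g
  proof -
    let ?q = "butlast (p a)"
    have d: "distinct ?q" using pB[OF a] by (simp add: simple_path_def distinct_butlast)
    have "mcost C (leg C arcs vs x g a) \<le> mcost C (map (\<lambda>w. (w, g)) ?q)"
      using leg(2)[OF x(2) Btl(2)[OF a] pathV[OF a]] .
    also have "\<dots> = (\<Sum>w\<leftarrow>?q. mcost C [(w, g)])"
      by (subst mcost_sum_list) (simp add: comp_def)
    also have "\<dots> = (\<Sum>w\<in>set ?q. mcost C [(w, g)])"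
      using d by (simp add: sum_list_distinct_conv_sum_set)
    also have "\<dots> \<le> (\<Sum>w\<in>set ?q. mcost C [(w, y w)])"
    proof (rule sum_mono)
      fix w assume "w \<in> set ?q"
      then have w: "w \<in> set (p a)" by (rule in_set_butlastD)
      then have "w \<in> U" using pB[OF a] by (auto simp: simple_path_def)
      then show "mcost C [(w, g)] \<le> mcost C [(w, y w)]" using g w y U(2) by (intro mono) auto
    qed
    finally show ?thesis unfolding wt_def by (metis of_nat_mono of_nat_sum)
  qed
  have x_in: "x \<in> set (p a)" if "a \<in> B" for a
    using pB[OF that] by (metis last_in_set simple_path_def)
  have R1: "1 \<le> R a" if "a \<in> B" for a using tl(4)[OF Btl(1)[OF that]] by simp
  define d where "d = (\<lambda>t. real (mcost C (leg C arcs vs x (snd t) (fst t))))"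
  define c0 where "c0 = real (mcost C [(x, R s)]) + real (mcost C (leg C arcs vs x (R s) r))"
  define T' where "T' = (\<lambda>a. (a, R a)) ` B'"
  \<comment> \<open>\<open>L\<close> contains all active terminals that may be joined at grade
    \<open>R s\<close>, including ones outside the spider of the tree. Below, \<open>\<rho>\<close>
    is the cost of the tree per active terminal.\<close>
  define L where "L = {t \<in> set A. t \<noteq> (r, R r) \<and> snd t \<le> R s}"
  define \<rho> where "\<rho> = (\<Sum>w\<in>U. wt w) / length A"
  have lA: "0 < real (length A)" using A(2) by auto
  have injT: "inj_on (\<lambda>a. (a, R a)) B'" by (auto simp: inj_on_def)
  have "c0 + sum d T' \<le> \<rho> * Suc (card T')"
  proof -
    have "mcost C [(x, R s)] \<le> mcost C [(x, y x)]"
      using low[OF s(1), of x] x_in[OF sB(1)] R1[OF sB(1)] y x by (intro mono) auto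
    then have 1: "real (mcost C [(x, R s)]) \<le> wt x" by (simp add: wt_def)
    have 2: "real (mcost C (leg C arcs vs x (R s) r)) \<le> (\<Sum>w\<in>set (butlast (p r)). wt w)"
      using low[OF s(1)] R1[OF sB(1)] r(1) by (intro legcost) auto
    have "sum d T' = (\<Sum>a\<in>B'. d (a, R a))" unfolding T'_def using injT by (simp add: sum.reindex)
    also have "\<dots> \<le> (\<Sum>a\<in>B'. \<Sum>w\<in>set (butlast (p a)). wt w)"
      unfolding d_def fst_conv snd_conv
      using low R1 by (intro sum_mono legcost) (auto simp: B'_def)
    finally have "c0 + sum d T' \<le> wt x + (\<Sum>a\<in>B. \<Sum>w\<in>set (butlast (p a)). wt w)"
      using 1 2 r(1) fB unfolding c0_def B'_def by (simp add: sum.remove)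
    also have "\<dots> \<le> \<rho> * card B"
      using B(4) lA unfolding cardA \<rho>_def by (simp add: field_simps)
    also have "card B = Suc (card T')" using cardB(1) injT by (simp add: T'_def card_image)
    finally show ?thesis .
  qed
  moreover have "T' \<subseteq> L" using s(2) A'A B(1) by (auto simp: T'_def L_def B'_def)
  moreover have fL: "finite L" and T'ne: "T' \<noteq> {}" using cardB(2) by (simp_all add: L_def T'_def)
  ultimately obtain u where u: "u \<in> L" "c0 + d u \<le> \<rho> * 2 \<or>
      c0 + sum d {t \<in> L. d t \<le> d u} \<le> \<rho> * Suc (card {t \<in> L. d t \<le> d u})"
    using best_threshold[of L T' c0 d \<rho>] fL T'ne by blast
  have in_A: "(r, R r) \<in> set A" "(s, R s) \<in> set A" using A'A B(1) r(1) sB(1) by auto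
  have Rsr: "R s \<le> R r" using r(2) sB(1) by simp
  have uA: "u \<in> set A" "u \<noteq> (r, R r)" "snd u \<le> R s" using u(1) by (auto simp: L_def)
  have cost: "\<exists>b\<in>set (spiders C arcs vs A). mcost C (fst b) * length A \<le> Suc (length (snd b)) * (\<Sum>w\<in>U. mcost C [(w, y w)])"
    if b: "spider C arcs vs x (R s) (r, R r) ss \<in> set (spiders C arcs vs A)"
      and le: "c0 + (\<Sum>t\<leftarrow>ss. d t) \<le> \<rho> * Suc (length ss)" for ss
  proof (rule bexI[OF _ b])
    have real_sum: "real (\<Sum>t\<leftarrow>ss. f t) = (\<Sum>t\<leftarrow>ss. real (f t))" for f :: "nat \<times> nat \<Rightarrow> nat"
      by (induction ss) auto
    have sn: "snd (spider C arcs vs x (R s) (r, R r) ss) = ss" by (simp add: spider_def)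
    have "real (mcost C (fst (spider C arcs vs x (R s) (r, R r) ss))) = c0 + (\<Sum>t\<leftarrow>ss. d t)"
      unfolding mcost_spider d_def c0_def by (simp add: real_sum)
    also have "\<dots> \<le> \<rho> * Suc (length ss)" by (rule le)
    finally have "real (mcost C (fst (spider C arcs vs x (R s) (r, R r) ss))) * length A \<le> \<rho> * length A * Suc (length ss)"
      using lA by (simp add: mult.assoc mult.left_commute)
    also have "\<rho> * length A = (\<Sum>w\<in>U. mcost C [(w, y w)])" using lA by (simp add: \<rho>_def wt_def)
    finally show "mcost C (fst (spider C arcs vs x (R s) (r, R r) ss)) * length A
       \<le> Suc (length (snd (spider C arcs vs x (R s) (r, R r) ss))) * (\<Sum>w\<in>U. mcost C [(w, y w)])"
      unfolding sn by (simp only: mult.commute flip: of_nat_mult of_nat_le_iff)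
  qed
  let ?ss = "filter (\<lambda>t. t \<noteq> (r, R r) \<and> snd t \<le> R s \<and>
               mcost C (leg C arcs vs x (snd t) (fst t)) \<le> mcost C (leg C arcs vs x (snd u) (fst u))) A"
  have xs: "x \<in> set vs" using x vs by simp
  from u(2) show ?thesis
  proof
    assume "c0 + d u \<le> \<rho> * 2"
    moreover have "spider C arcs vs x (R s) (r, R r) [u] \<in> set (spiders C arcs vs A)"
      unfolding spiders_elem
      by (rule bexI[OF _ xs], rule bexI[OF _ in_A(1)], rule bexI[OF _ in_A(2)], rule bexI[OF _ uA(1)])
         (use uA Rsr in auto)
    ultimately show ?thesis using cost[of "[u]"] by simp
  next
    assume le: "c0 + sum d {t \<in> L. d t \<le> d u} \<le> \<rho> * Suc (card {t \<in> L. d t \<le> d u})"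
    have dist: "distinct ?ss" using A(1) by (simp add: active_def)
    have set_ss: "set ?ss = {t \<in> L. d t \<le> d u}" by (auto simp: L_def d_def)
    have "c0 + (\<Sum>t\<leftarrow>?ss. d t) \<le> \<rho> * Suc (length ?ss)"
      unfolding sum_list_distinct_conv_sum_set[OF dist] distinct_card[OF dist, symmetric] set_ss by (rule le)
    moreover have "spider C arcs vs x (R s) (r, R r) ?ss \<in> set (spiders C arcs vs A)"
      unfolding spiders_elem
      by (rule bexI[OF _ xs], rule bexI[OF _ in_A(1)], rule bexI[OF _ in_A(2)], rule bexI[OF _ uA(1)])
         (use uA Rsr in auto)
    ultimately show ?thesis using cost[of ?ss] by blast
  qed
qed

text \<open>\<open>W\<close> stands for the cost of an arbitrary feasible solution. It bounds the
  best ratio in every round, because a tree that is feasible for all terminals is so for the active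
  ones.\<close>

definition good_bound :: "nat \<Rightarrow> bool" where
  "good_bound W \<longleftrightarrow> (\<forall>A. active A \<longrightarrow> 2 \<le> length A \<longrightarrow>
     (\<exists>b\<in>set (spiders C arcs vs A). mcost C (fst b) * length A \<le> Suc (length (snd b)) * W))"

text \<open>The invariant that makes it safe to deactivate a terminal: its obligations are taken
  over by an active one. With one active terminal left, it says that all terminals are linked to the
  root at their grades.\<close>

definition linked :: "(nat \<times> nat) list \<Rightarrow> (nat \<times> nat) list \<Rightarrow> bool" where
  "linked A Y \<longleftrightarrow> set ts \<subseteq> set Y \<and> set Y \<subseteq> V \<times> {1..l} \<and>
     (\<forall>t\<in>set tl. \<exists>a\<in>set A. R t \<le> snd a \<and> (t, fst a) \<in> conn Y (R t))"

lemma active_elem: "active A \<Longrightarrow> t \<in> set A \<Longrightarrow> fst t \<in> set tl \<and> fst t \<in> V \<and> snd t = R (fst t) \<and> snd t \<in> {1..l}"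
  using tl(2,4) ts[of t] unfolding active_def by auto

text \<open>The whole graph, with the top grade everywhere, takes the place of the feasible
  tree.\<close>

lemma spiders_nonempty:
  assumes "active A" "2 \<le> length A" shows "spiders C arcs vs A \<noteq> []"
proof -
  obtain t where "t \<in> set tl" using tl(3) by (cases tl) auto
  then have "1 \<le> l" using tl(4)[of t] by simp
  then have "\<exists>b\<in>set (spiders C arcs vs A).
    mcost C (fst b) * length A \<le> Suc (length (snd b)) * (\<Sum>w\<in>V. mcost C [(w, l)])"
    by (intro good_spider_exists[OF assms connected]) (use tl(2,4) in \<open>auto simp: min_le_iff_disj\<close>)
  then show ?thesis by auto
qed

section \<open>The rounds of the greedy phase\<close>

lemma merge_best:
  assumes "active A" "2 \<le> length A"
  shows "\<exists>b\<in>set (spiders C arcs vs A). merge C arcs vs (A, Y) = (filter (\<lambda>t. t \<notin> set (snd b)) A, fst b @ Y) \<and>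
    (\<forall>b'\<in>set (spiders C arcs vs A). mcost C (fst b) * Suc (length (snd b')) \<le> mcost C (fst b') * Suc (length (snd b)))"
proof -
  define f where "f = (\<lambda>b :: (nat \<times> nat) list \<times> (nat \<times> nat) list. real (mcost C (fst b)) / real (Suc (length (snd b))))"
  have less: "ratio_less C a b \<longleftrightarrow> f a < f b" for a b
  proof -
    have "f a < f b \<longleftrightarrow> real (mcost C (fst a)) * real (Suc (length (snd b))) < real (mcost C (fst b)) * real (Suc (length (snd a)))"
      unfolding f_def by (subst divide_less_eq) (simp add: field_simps)
    then show ?thesis unfolding ratio_less_def by (metis of_nat_less_iff of_nat_mult)
  qed
  obtain b where b: "b \<in> set (spiders C arcs vs A)" "bestl (ratio_less C) (spiders C arcs vs A) = [b]"
    "\<forall>z\<in>set (spiders C arcs vs A). f b \<le> f z"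
    using bestl_cases[of "spiders C arcs vs A" "ratio_less C" f] less spiders_nonempty[OF assms] by auto
  have "mcost C (fst b) * Suc (length (snd z)) \<le> mcost C (fst z) * Suc (length (snd b))"
    if "z \<in> set (spiders C arcs vs A)" for z
    using b(3) that less[of z b] unfolding ratio_less_def by force
  then show ?thesis using b by (intro bexI[of _ b]) (auto simp: merge_def)
qed

lemma spider_marks:
  assumes A: "active A" and x: "x \<in> V" and r: "r \<in> set A" and s: "s \<in> set A" and ss: "set ss \<subseteq> set A"
  shows "set (fst (spider C arcs vs x (snd s) r ss)) \<subseteq> V \<times> {1..l}"
proof -
  have leg_marks: "set (leg C arcs vs x (snd t) (fst u)) \<subseteq> V \<times> {1..l}" if "t \<in> set A" "u \<in> set A" for t u
    using leg(1)[of x "fst u" "snd t"] active_elem[OF A that(1)] active_elem[OF A that(2)] x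
    by (auto simp: legwalk_def)
  show ?thesis using leg_marks[OF s r] leg_marks ss active_elem[OF A s] x
    unfolding spider_def by fastforce
qed

text \<open>A terminal \<open>t\<close> that relied on a deactivated \<open>a\<close> continues from
  \<open>a\<close> through the center to \<open>r\<close>: the leg of \<open>a\<close> has grade
  \<open>snd a\<close>, center and leg of \<open>r\<close> have grade \<open>snd s\<close>, and both
  grades are at least \<open>R t\<close>.\<close>

lemma merge_linked:
  assumes A: "active A" and Y: "linked A Y"
    and b: "x \<in> V" "r \<in> set A" "s \<in> set A" "snd s \<le> snd r" "set ss \<subseteq> set A - {r}" "\<forall>t\<in>set ss. snd t \<le> snd s"
  shows "linked (filter (\<lambda>t. t \<notin> set ss) A) (fst (spider C arcs vs x (snd s) r ss) @ Y)"
proof -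
  let ?Y = "fst (spider C arcs vs x (snd s) r ss) @ Y" and ?A = "filter (\<lambda>t. t \<notin> set ss) A"
  have xY: "(x, snd s) \<in> set ?Y" by (simp add: spider_def)
  have link: "(fst t, x) \<in> conn ?Y h"
    if t: "t \<in> set A" and sub: "set (leg C arcs vs x g (fst t)) \<subseteq> set ?Y" and h: "h \<le> g" "h \<le> snd s" for t g h
  proof -
    obtain q where q: "leg C arcs vs x g (fst t) = map (\<lambda>w. (w, g)) q" "legwalk x (fst t) q"
      using leg(1)[OF b(1), of "fst t" g] active_elem[OF A t] by blast
    show ?thesis using q sub xY h by (intro conn_leg[OF q(2)]) auto
  qed
  have "\<exists>a\<in>set ?A. R t \<le> snd a \<and> (t, fst a) \<in> conn ?Y (R t)" if t: "t \<in> set tl" for t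
  proof -
    obtain a where a: "a \<in> set A" "R t \<le> snd a" "(t, fst a) \<in> conn Y (R t)" using Y t by (auto simp: linked_def)
    have ta: "(t, fst a) \<in> conn ?Y (R t)" using a(3) conn_mono[of Y ?Y "R t" "R t"] by auto
    show ?thesis
    proof (cases "a \<in> set ss")
      case False
      then show ?thesis using a ta by (intro bexI[of _ a]) auto
    next
      case True
      have le: "snd a \<le> snd s" using b(6) True by blast
      have "(fst a, x) \<in> conn ?Y (R t)"
        by (rule link[OF a(1), of "snd a"]) (use True a(2) le in \<open>auto simp: spider_def\<close>)
      moreover have "(fst r, x) \<in> conn ?Y (R t)"
        by (rule link[OF b(2), of "snd s"]) (use a(2) le in \<open>auto simp: spider_def\<close>)
      ultimately have "(t, fst r) \<in> conn ?Y (R t)" using ta conn_sym conn_trans by blast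
      moreover have "r \<in> set ?A" using b(2,5) by auto
      ultimately show ?thesis using a(2) le b(4) by (intro bexI[of _ r]) auto
    qed
  qed
  moreover have "set (fst (spider C arcs vs x (snd s) r ss)) \<subseteq> V \<times> {1..l}"
    using spider_marks[OF A b(1-3)] b(5) by blast
  ultimately show ?thesis using Y by (auto simp: linked_def)
qed

text \<open>The inequality ln z <= z - 1 at z = (k - m) / k.\<close>

lemma ratio_le_ln:
  assumes "0 < m" "m < k" shows "real m / real k \<le> ln (real k) - ln (real (k - m))"
proof -
  have "ln (real (k - m) / real k) \<le> real (k - m) / real k - 1" using assms by (intro ln_le_minus_one) auto
  also have "ln (real (k - m) / real k) = ln (real (k - m)) - ln (real k)" using assms by (simp add: ln_div)
  also have "real (k - m) / real k - 1 = - (real m / real k)" using assms by (simp add: of_nat_diff field_simps)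
  finally show ?thesis by linarith
qed

lemma merge_step:
  assumes A: "active A" "2 \<le> length A" and Y: "linked A Y"
  obtains A' Y' where "merge C arcs vs (A, Y) = (A', Y')" "active A'" "linked A' Y'" "length A' < length A"
    "\<And>W. good_bound W \<Longrightarrow> real (mcost C Y') \<le> real (mcost C Y) + 2 * real W * (ln (length A) - ln (length A'))"
proof -
  obtain b where b: "b \<in> set (spiders C arcs vs A)"
    "merge C arcs vs (A, Y) = (filter (\<lambda>t. t \<notin> set (snd b)) A, fst b @ Y)"
    "\<forall>b'\<in>set (spiders C arcs vs A). mcost C (fst b) * Suc (length (snd b')) \<le> mcost C (fst b') * Suc (length (snd b))"
    using merge_best[OF A] by blast
  have dA: "distinct A" using A by (simp add: active_def)
  obtain x r s ss where sp: "x \<in> V" "r \<in> set A" "s \<in> set A" "snd s \<le> snd r" "b = spider C arcs vs x (snd s) r ss"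
    "ss \<noteq> []" "distinct ss" "set ss \<subseteq> set A - {r}" "\<forall>t\<in>set ss. snd t \<le> snd s"
    using spidersE[OF b(1) dA] by blast
  have sb: "snd b = ss" by (simp add: sp(5) spider_def)
  let ?A = "filter (\<lambda>t. t \<notin> set ss) A"
  have "r \<in> set ?A" using sp by auto
  then have "?A \<noteq> []" by (metis empty_iff list.set(1))
  then have act: "active ?A" using A(1) by (auto simp: active_def)
  have "length ?A = card (set A - set ss)" using dA by (simp add: distinct_card[symmetric] set_diff_eq)
  also have "\<dots> = length A - length ss"
    using sp(7,8) dA by (subst card_Diff_subset) (auto simp: distinct_card)
  finally have len: "length ?A = length A - length ss" .
  have "length ?A \<noteq> 0" using \<open>r \<in> set ?A\<close> by (metis length_0_conv list.set(1) empty_iff)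
  then have m: "0 < length ss" "length ss < length A" using len sp(6) by auto
  have cost: "real (mcost C (fst b @ Y)) \<le> real (mcost C Y) + 2 * real W * (ln (length A) - ln (length ?A))"
    if W: "good_bound W" for W
  proof -
    obtain b' where b': "b' \<in> set (spiders C arcs vs A)" "mcost C (fst b') * length A \<le> Suc (length (snd b')) * W"
      using W A by (auto simp: good_bound_def)
    have "mcost C (fst b) * Suc (length (snd b')) * length A \<le> mcost C (fst b') * Suc (length ss) * length A"
      using b(3) b'(1) unfolding sb by (intro mult_le_mono1) blast
    also have "\<dots> = mcost C (fst b') * length A * Suc (length ss)" by (simp only: mult.commute mult.left_commute)
    also have "\<dots> \<le> Suc (length (snd b')) * W * Suc (length ss)" using b'(2) by (rule mult_le_mono1)
    finally have "Suc (length (snd b')) * (mcost C (fst b) * length A) \<le> Suc (length (snd b')) * (W * Suc (length ss))"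
      by (simp only: mult.commute mult.left_commute)
    then have "mcost C (fst b) * length A \<le> W * Suc (length ss)" by (simp only: Suc_mult_le_cancel1)
    \<comment> \<open>The source of the factor 2: the spider has \<open>Suc (length ss)\<close>
      terminals, but only \<open>length ss\<close> of them become inactive.\<close>
    also have "\<dots> \<le> W * (2 * length ss)" using m(1) by (intro mult_le_mono2) linarith
    finally have "real (mcost C (fst b) * length A) \<le> real (W * (2 * length ss))"
      by (rule of_nat_mono)
    then have "real (mcost C (fst b)) * real (length A) \<le> real W * (2 * real (length ss))"
      by (simp only: of_nat_mult of_nat_numeral)
    moreover have "0 < real (length A)" using m(2) by linarith
    ultimately have "real (mcost C (fst b)) \<le> real W * (2 * real (length ss)) / real (length A)"
      by (simp only: pos_le_divide_eq)
    also have "\<dots> = 2 * real W * (real (length ss) / real (length A))" by simp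
    also have "\<dots> \<le> 2 * real W * (ln (length A) - ln (length ?A))"
      unfolding len by (intro mult_left_mono ratio_le_ln m) simp
    finally show ?thesis by (simp add: mcost_append)
  qed
  show thesis
  proof (rule that)
    show "merge C arcs vs (A, Y) = (?A, fst b @ Y)" using b(2) sb by simp
    show "linked ?A (fst b @ Y)" using merge_linked[OF A(1) Y sp(1-4,8,9)] sp(5) by simp
    show "length ?A < length A" using len m by linarith
  qed (fact act cost)+
qed

text \<open>Once a single terminal is active, the remaining ticks of the clock change
  nothing.\<close>

lemma merge_single: "length A \<le> 1 \<Longrightarrow> merge C arcs vs (A, Y) = (A, Y)"
proof -
  assume A: "length A \<le> 1"
  have single: "u = r" if "u \<in> set A" "r \<in> set A" for u r using that A by (cases A) auto
  have "distinct A" using A by (cases A) auto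
  have "b \<notin> set (spiders C arcs vs A)" for b
  proof
    assume "b \<in> set (spiders C arcs vs A)"
    then obtain r ss where "r \<in> set A" "ss \<noteq> []" "set ss \<subseteq> set A - {r}"
      by (rule spidersE[OF _ \<open>distinct A\<close>])
    moreover from this have "hd ss \<in> set A - {r}" using hd_in_set by blast
    ultimately show False using single[of "hd ss" r] by blast
  qed
  then have "spiders C arcs vs A = []" by (metis hd_in_set)
  then show ?thesis by (simp add: merge_def bestl_def)
qed

lemma greedy_loop:
  fixes ys :: "(nat \<times> nat) list"
  obtains A Y where "foldl (\<lambda>s _. merge C arcs vs s) (ts, ts) ys = (A, Y)" "active A" "linked A Y"
    "length A \<le> max 1 (length ts - length ys)"
    "\<And>W. good_bound W \<Longrightarrow> real (mcost C Y) \<le> 2 * real W * (ln (length ts) - ln (length A))"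
proof (induction ys arbitrary: thesis rule: rev_induct)
  case Nil
  show ?case
  proof (rule Nil)
    show "active ts" using tl(1,3) by (auto simp: active_def ts_def distinct_map inj_on_def)
    have "(t, t) \<in> conn ts (R t)" for t by (simp add: conn_def)
    moreover have "m \<in> V \<times> {1..l}" if "m \<in> set ts" for m
      using that tl(2) tl(4)[of "fst m"] ts[of m] by (auto simp: mem_Times_iff)
    moreover have "(t, R t) \<in> set ts" if "t \<in> set tl" for t using that by (simp add: ts)
    ultimately show "linked ts ts" unfolding linked_def by (metis fst_conv order_refl snd_conv subsetI)
    \<comment> \<open>Terminals are free at their required grade, so the initial purchases cost
      nothing.\<close>
    have "mcost C ts = 0" using zero by (subst mcost_sum_list) (simp add: ts_def comp_def sum_list_eq_0_iff)
    then show "real (mcost C ts) \<le> 2 * real W * (ln (length ts) - ln (length ts))" for W by simp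
  qed simp_all
next
  case (snoc y ys)
  obtain A Y where s: "foldl (\<lambda>s _. merge C arcs vs s) (ts, ts) ys = (A, Y)" "active A" "linked A Y"
    "length A \<le> max 1 (length ts - length ys)"
    "\<And>W. good_bound W \<Longrightarrow> real (mcost C Y) \<le> 2 * real W * (ln (length ts) - ln (length A))"
    using snoc.IH by blast
  show ?case
  proof (cases "2 \<le> length A")
    case True
    obtain A' Y' where m: "merge C arcs vs (A, Y) = (A', Y')" "active A'" "linked A' Y'" "length A' < length A"
      "\<And>W. good_bound W \<Longrightarrow> real (mcost C Y') \<le> real (mcost C Y) + 2 * real W * (ln (length A) - ln (length A'))"
      using merge_step[OF s(2) True s(3)] by blast
    show ?thesis
    proof (rule snoc.prems[of A' Y'])
      show "real (mcost C Y') \<le> 2 * real W * (ln (length ts) - ln (length A'))" if "good_bound W" for W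
        using m(5)[OF that] s(5)[OF that] by (simp add: algebra_simps)
      show "length A' \<le> max 1 (length ts - length (ys @ [y]))" using m(4) s(4) True by simp
    qed (use s m in auto)
  next
    case False
    then show ?thesis using s merge_single[of A Y] by (intro snoc.prems[of A Y]) auto
  qed
qed

text \<open>As many rounds as terminals leave one active, and the subtracted logarithm becomes ln 1
  = 0.\<close>

lemma greedy_correct:
  obtains r Y where "greedy C arcs vs ts = ([(r, R r)], Y)" "r \<in> set tl" "linked [(r, R r)] Y"
    "\<And>W. good_bound W \<Longrightarrow> real (mcost C Y) \<le> 2 * real W * ln (length tl)"
proof -
  obtain A Y where s: "foldl (\<lambda>s _. merge C arcs vs s) (ts, ts) ts = (A, Y)" "active A" "linked A Y"
    "length A \<le> max 1 (length ts - length ts)"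
    "\<And>W. good_bound W \<Longrightarrow> real (mcost C Y) \<le> 2 * real W * (ln (length ts) - ln (length A))"
    using greedy_loop[of ts] by blast
  have "length A = 1" using s(2,4) by (cases A) (auto simp: active_def)
  then obtain a where a: "A = [a]" using length_eq_1 by blast
  have r: "fst a \<in> set tl" "a = (fst a, R (fst a))" using active_elem[OF s(2), of a] a by (auto simp: prod_eq_iff)
  show thesis
  proof (rule that[of "fst a" Y])
    show "greedy C arcs vs ts = ([(fst a, R (fst a))], Y)" using s(1) a r(2) by (simp add: greedy_def)
    show "linked [(fst a, R (fst a))] Y" using s(3) a r(2) by simp
    show "real (mcost C Y) \<le> 2 * real W * ln (length tl)" if "good_bound W" for W
      using s(5)[OF that] a by (simp add: ts_def)
  qed (rule r(1))
qed

section \<open>Growing the tree\<close>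

definition edge_set :: "(nat \<times> nat) list \<Rightarrow> nat set set" where
  "edge_set F = (\<lambda>a. {fst a, snd a}) ` set F"

definition candidates :: "(nat \<times> nat) list \<Rightarrow> (nat \<times> nat) list \<Rightarrow> ((nat \<times> nat) \<times> (nat \<times> nat)) set" where
  "candidates Y U = {(a, m). a \<in> set arcs \<and> m \<in> set Y \<and> snd a = fst m \<and> fst a \<in> fst ` set U \<and> snd a \<notin> fst ` set U}"

lemma attach_best:
  "candidates Y (fst s) = {} \<and> attach arcs Y s = s \<or>
   (\<exists>(a, m)\<in>candidates Y (fst s). attach arcs Y s = (m # fst s, a # snd s) \<and>
     (\<forall>(a', m')\<in>candidates Y (fst s). snd m' \<le> snd m))"
proof -
  define c where "c = concat (map (\<lambda>a. concat (map (\<lambda>m.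
       if snd a = fst m \<and> fst a \<in> set (map fst (fst s)) \<and> snd a \<notin> set (map fst (fst s)) then [(a, m)] else []) Y)) arcs)"
  have c: "set c = candidates Y (fst s)"
    by (rule set_eqI) (simp only: c_def candidates_def in_set_concat_map in_set_if, auto)
  \<comment> \<open>\<open>bestl\<close> minimizes, so the key is the negated grade, as an
    integer.\<close>
  have "c = [] \<and> bestl (\<lambda>a b. snd (snd b) < snd (snd a)) c = [] \<or>
    (\<exists>y\<in>set c. bestl (\<lambda>a b. snd (snd b) < snd (snd a)) c = [y] \<and> (\<forall>z\<in>set c. - int (snd (snd y)) \<le> - int (snd (snd z))))"
    by (rule bestl_cases) auto
  then show ?thesis
  proof (elim disjE conjE bexE)
    assume "c = []" "bestl (\<lambda>a b. snd (snd b) < snd (snd a)) c = []"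
    then show ?thesis unfolding attach_def c_def[symmetric] using c by auto
  next
    fix y assume y: "y \<in> set c" "bestl (\<lambda>a b. snd (snd b) < snd (snd a)) c = [y]"
      "\<forall>z\<in>set c. - int (snd (snd y)) \<le> - int (snd (snd z))"
    have "attach arcs Y s = (snd y # fst s, fst y # snd s)"
      unfolding attach_def c_def[symmetric] y(2) by simp
    moreover have "\<forall>(a', m')\<in>candidates Y (fst s). snd m' \<le> snd (snd y)" using y(3) unfolding c by auto
    ultimately show ?thesis using y(1) unfolding c by (intro disjI2 bexI[of _ y]) (auto split: prod.splits)
  qed
qed

text \<open>For each grade \<open>g\<close>, the tree is first extended to the component of the root in the graph of the
  vertices of grade at least \<open>g\<close> before it gets a vertex outside this component.\<close>

definition grow_invariant :: "nat \<Rightarrow> (nat \<times> nat) list \<Rightarrow> (nat \<times> nat) list \<times> (nat \<times> nat) list \<Rightarrow> bool" where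
  "grow_invariant r Y s \<longleftrightarrow> (let N = fst ` set (fst s); F = edge_set (snd s); K = (\<lambda>g. {v. (r, v) \<in> conn Y g}) in
     distinct (map fst (fst s)) \<and> r \<in> N \<and> set (fst s) \<subseteq> set Y \<and> tree_graph N F \<and> F \<subseteq> E \<and>
     (\<forall>g\<le>R r. (K g \<subseteq> N \<or> N \<subseteq> K g) \<and> (\<forall>m\<in>set (fst s). fst m \<in> K g \<longrightarrow> g \<le> snd m) \<and>
       (\<forall>u\<in>N \<inter> K g. \<forall>v\<in>N \<inter> K g. \<forall>p. simple_path N F u p v \<longrightarrow> set p \<subseteq> K g)))"

lemma rtrancl_crossing: "(u, v) \<in> S\<^sup>* \<Longrightarrow> u \<in> N \<Longrightarrow> v \<notin> N \<Longrightarrow> \<exists>a b. (a, b) \<in> S \<and> a \<in> N \<and> b \<notin> N"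
  by (induction rule: rtrancl_induct) auto

text \<open>A connection at grade \<open>g\<close> that leaves the tree crosses its boundary at a
  vertex bought at grade at least \<open>g\<close>. Preferring high grades thus exhausts a component
  before leaving it.\<close>

lemma candidate_exists:
  assumes "(r, v) \<in> conn Y g" "r \<in> fst ` set U" "v \<notin> fst ` set U"
  shows "\<exists>(a, m)\<in>candidates Y U. g \<le> snd m"
proof -
  obtain a b where ab: "{a, b} \<in> E" "\<exists>i\<ge>g. (b, i) \<in> set Y" "a \<in> fst ` set U" "b \<notin> fst ` set U"
    using rtrancl_crossing[OF assms(1)[unfolded conn_def] assms(2,3)] by blast
  then obtain i where "i \<ge> g" "(b, i) \<in> set Y" by blast
  then have "((a, b), (b, i)) \<in> candidates Y U" using ab arcs by (auto simp: candidates_def)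
  then show ?thesis using \<open>i \<ge> g\<close> by (intro bexI[of _ "((a, b), (b, i))"]) auto
qed

lemma grow_invariant_step:
  assumes inv: "grow_invariant r Y s" and am: "(a, m) \<in> candidates Y (fst s)"
    and best: "\<forall>(a', m')\<in>candidates Y (fst s). snd m' \<le> snd m"
  shows "grow_invariant r Y (m # fst s, a # snd s)"
proof -
  define N F K where "N = fst ` set (fst s)" and "F = edge_set (snd s)" and "K = (\<lambda>g. {v. (r, v) \<in> conn Y g})"
  define u w where "u = fst a" and "w = fst m"
  have I: "distinct (map fst (fst s))" "r \<in> N" "set (fst s) \<subseteq> set Y" "tree_graph N F" "F \<subseteq> E"
    "g \<le> R r \<Longrightarrow> K g \<subseteq> N \<or> N \<subseteq> K g" "g \<le> R r \<Longrightarrow> n \<in> set (fst s) \<Longrightarrow> fst n \<in> K g \<Longrightarrow> g \<le> snd n"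
    "g \<le> R r \<Longrightarrow> x \<in> N \<inter> K g \<Longrightarrow> y \<in> N \<inter> K g \<Longrightarrow> simple_path N F x p y \<Longrightarrow> set p \<subseteq> K g" for g n x y p
    using inv unfolding grow_invariant_def Let_def N_def[symmetric] F_def[symmetric] K_def by blast+
  have "a \<in> set arcs \<and> m \<in> set Y \<and> snd a = fst m \<and> fst a \<in> N \<and> snd a \<notin> N"
    using am unfolding candidates_def N_def by blast
  then have am': "a \<in> set arcs" "m \<in> set Y" "snd a = w" "u \<in> N" "w \<notin> N"
    by (auto simp: u_def w_def)
  have uw: "{u, w} \<in> E" using am'(1,3) arcs[of u w] by (metis prod.collapse u_def)
  have N': "fst ` set (m # fst s) = insert w N" by (simp add: N_def w_def)
  have F': "edge_set (a # snd s) = insert {u, w} F" using am'(3) by (simp add: edge_set_def F_def u_def)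
  have ug: "ugraph N F" using I(4) by (simp add: tree_graph_def connected_graph_def)
  have main: "(K g \<subseteq> insert w N \<or> insert w N \<subseteq> K g) \<and> (\<forall>n\<in>set (m # fst s). fst n \<in> K g \<longrightarrow> g \<le> snd n) \<and>
       (\<forall>x\<in>insert w N \<inter> K g. \<forall>y\<in>insert w N \<inter> K g. \<forall>p. simple_path (insert w N) (insert {u, w} F) x p y \<longrightarrow> set p \<subseteq> K g)"
    if g: "g \<le> R r" for g
  proof (cases "K g \<subseteq> N")
    \<comment> \<open>The component is complete, so \<open>w\<close> lies outside it, and a new leaf
      is on no path between older vertices.\<close>
    case True
    then have w: "w \<notin> K g" using am'(5) by auto
    have "set p \<subseteq> K g" if "x \<in> insert w N \<inter> K g" "y \<in> insert w N \<inter> K g"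
      "simple_path (insert w N) (insert {u, w} F) x p y" for x y p
    proof -
      have "x \<noteq> w" "y \<noteq> w" "x \<in> N \<inter> K g" "y \<in> N \<inter> K g" using that w by auto
      then show ?thesis using simple_path_avoids_leaf[OF ug am'(5) that(3)] I(8)[OF g] by blast
    qed
    then show ?thesis using True w I(7)[OF g] by (auto simp: w_def)
  next
    \<comment> \<open>The component is incomplete, so the chosen mark has grade at least
      \<open>g\<close>, and \<open>w\<close> belongs to the component as well.\<close>
    case False
    then have NK: "N \<subseteq> K g" using I(6)[OF g] by blast
    obtain v where "v \<in> K g" "v \<notin> N" using False by blast
    then have "\<exists>(a, m)\<in>candidates Y (fst s). g \<le> snd m"
      using candidate_exists[of r v Y g "fst s"] I(2) by (simp add: K_def N_def)
    then have gm: "g \<le> snd m" using best by fastforce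
    obtain i where "(u, i) \<in> set (fst s)" using am'(4) by (auto simp: N_def)
    then have "(u, i) \<in> set Y" "g \<le> i" using I(3) I(7)[OF g, of "(u, i)"] NK am'(4) by auto
    moreover have "(w, snd m) \<in> set Y" using am'(2) by (simp add: w_def)
    moreover have "(r, u) \<in> conn Y g" using NK am'(4) by (auto simp: K_def)
    ultimately have "(r, w) \<in> conn Y g" using uw gm unfolding conn_def
      by (auto intro!: rtrancl_into_rtrancl[of r u])
    then have sub: "insert w N \<subseteq> K g" using NK by (auto simp: K_def)
    have "set p \<subseteq> K g" if "simple_path (insert w N) (insert {u, w} F) x p y" for x y p
      using that sub by (auto simp: simple_path_def)
    then show ?thesis using sub gm I(7)[OF g] by auto
  qed
  have "distinct (map fst (m # fst s))" using I(1) am'(5) by (simp add: N_def w_def)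
  moreover have "tree_graph (insert w N) (insert {u, w} F)" by (rule tree_add_leaf[OF I(4) am'(4,5)])
  moreover have "set (m # fst s) \<subseteq> set Y" "insert {u, w} F \<subseteq> E" "r \<in> insert w N"
    using I(2,3,5) am'(2) uw by auto
  ultimately show ?thesis
    unfolding grow_invariant_def Let_def fst_conv snd_conv N' F'
    by (intro conjI allI impI main[unfolded K_def, THEN conjunct1] main[unfolded K_def, THEN conjunct2, THEN conjunct1]
      main[unfolded K_def, THEN conjunct2, THEN conjunct2])
qed

text \<open>A round without a candidate changes nothing, and any other round adds a vertex. The
  count includes the root, so that after \<open>length vs\<close> rounds it would exceed the number
  of vertices.\<close>

lemma grow_loop:
  fixes ys :: "nat list"
  assumes "r \<in> set tl" "linked [(r, R r)] Y"
  shows "grow_invariant r Y (foldl (\<lambda>s _. attach arcs Y s) ([(r, R r)], []) ys) \<and>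
    (candidates Y (fst (foldl (\<lambda>s _. attach arcs Y s) ([(r, R r)], []) ys)) = {} \<or>
     length (fst (foldl (\<lambda>s _. attach arcs Y s) ([(r, R r)], []) ys)) = Suc (length ys))"
proof (induction ys rule: rev_induct)
  case Nil
  have "(r, R r) \<in> set Y" using assms ts[of "(r, R r)"] by (auto simp: linked_def)
  moreover have "(r, r) \<in> conn Y g" for g by (simp add: conn_def)
  \<comment> \<open>The root starts with grade \<open>R r\<close>; this is why the invariant is
    confined to \<open>g \<le> R r\<close>.\<close>
  ultimately show ?case using tree_singleton[of r]
    by (auto simp: grow_invariant_def Let_def edge_set_def simple_path_def)
next
  case (snoc y ys)
  let ?s = "foldl (\<lambda>s _. attach arcs Y s) ([(r, R r)], []) ys"
  have fs: "foldl (\<lambda>s _. attach arcs Y s) ([(r, R r)], []) (ys @ [y]) = attach arcs Y ?s" by simp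
  have inv: "grow_invariant r Y ?s" using snoc by blast
  from attach_best[of Y ?s] show ?case unfolding fs
  proof (elim disjE conjE bexE)
    assume "candidates Y (fst ?s) = {}" "attach arcs Y ?s = ?s"
    then show "grow_invariant r Y (attach arcs Y ?s) \<and> (candidates Y (fst (attach arcs Y ?s)) = {} \<or> length (fst (attach arcs Y ?s)) = Suc (length (ys @ [y])))"
      using inv by simp
  next
    fix am assume am: "am \<in> candidates Y (fst ?s)" and *: "case am of (a, m) \<Rightarrow> attach arcs Y ?s = (m # fst ?s, a # snd ?s) \<and>
       (\<forall>(a', m')\<in>candidates Y (fst ?s). snd m' \<le> snd m)"
    obtain a m where [simp]: "am = (a, m)" by (cases am)
    have at: "attach arcs Y ?s = (m # fst ?s, a # snd ?s)" "\<forall>(a', m')\<in>candidates Y (fst ?s). snd m' \<le> snd m"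
      using * by auto
    have "grow_invariant r Y (m # fst ?s, a # snd ?s)"
      using grow_invariant_step[OF inv _ at(2)] am by simp
    then show "grow_invariant r Y (attach arcs Y ?s) \<and> (candidates Y (fst (attach arcs Y ?s)) = {} \<or> length (fst (attach arcs Y ?s)) = Suc (length (ys @ [y])))"
      using snoc am unfolding at(1) by auto
  qed
qed

lemma run_correct:
  fixes s :: "(nat \<times> nat) list \<times> (nat \<times> nat) list"
  defines "s \<equiv> grow arcs vs (fst (greedy C arcs vs ts)) (snd (greedy C arcs vs ts))"
  defines "N \<equiv> fst ` set (fst s)"
  shows "distinct (map fst (fst s))" "tree_graph N (edge_set (snd s))" "N \<subseteq> V" "edge_set (snd s) \<subseteq> E"
    "set tl \<subseteq> N" "\<And>m. m \<in> set (fst s) \<Longrightarrow> snd m \<in> {1..l}"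
    "\<And>m. m \<in> set (fst s) \<Longrightarrow> fst m \<in> set tl \<Longrightarrow> R (fst m) \<le> snd m"
    "\<And>u v p m. u \<in> set tl \<Longrightarrow> v \<in> set tl \<Longrightarrow> simple_path N (edge_set (snd s)) u p v \<Longrightarrow>
       m \<in> set (fst s) \<Longrightarrow> fst m \<in> set p \<Longrightarrow> min (R u) (R v) \<le> snd m"
    "\<And>W. good_bound W \<Longrightarrow> real (mcost C (fst s)) \<le> 2 * real W * ln (length tl)"
proof -
  obtain r Y where g: "greedy C arcs vs ts = ([(r, R r)], Y)" "r \<in> set tl" "linked [(r, R r)] Y"
    and cost: "\<And>W. good_bound W \<Longrightarrow> real (mcost C Y) \<le> 2 * real W * ln (length tl)"
    using greedy_correct by blast
  have s: "s = foldl (\<lambda>s _. attach arcs Y s) ([(r, R r)], []) vs"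
    by (simp add: s_def g grow_def)
  define F K where "F = edge_set (snd s)" and "K = (\<lambda>g. {v. (r, v) \<in> conn Y g})"
  have inv: "grow_invariant r Y s" and stuck: "candidates Y (fst s) = {} \<or> length (fst s) = Suc (length vs)"
    using grow_loop[OF g(2,3), of vs] unfolding s by blast+
  have I: "distinct (map fst (fst s))" "r \<in> N" "set (fst s) \<subseteq> set Y" "tree_graph N F" "F \<subseteq> E"
    "g \<le> R r \<Longrightarrow> n \<in> set (fst s) \<Longrightarrow> fst n \<in> K g \<Longrightarrow> g \<le> snd n"
    "g \<le> R r \<Longrightarrow> x \<in> N \<inter> K g \<Longrightarrow> y \<in> N \<inter> K g \<Longrightarrow> simple_path N F x p y \<Longrightarrow> set p \<subseteq> K g" for g n x y p
    using inv unfolding grow_invariant_def Let_def N_def[symmetric] F_def[symmetric] K_def by blast+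
  show "distinct (map fst (fst s))" "tree_graph N (edge_set (snd s))" "edge_set (snd s) \<subseteq> E"
    using I(1,4,5) by (auto simp: F_def)
  have Y: "set Y \<subseteq> V \<times> {1..l}" using g(3) by (simp add: linked_def)
  show NV: "N \<subseteq> V" using I(3) Y by (auto simp: N_def)
  show "snd m \<in> {1..l}" if "m \<in> set (fst s)" for m using I(3) Y that by auto
  \<comment> \<open>There cannot be more marks than vertices, so no candidate is left and all
    components of the root lie in the tree.\<close>
  have "length (fst s) = card N" using I(1) by (metis N_def distinct_card length_map set_map)
  also have "\<dots> \<le> length vs" using NV finV vs by (metis card_mono distinct_card)
  finally have "candidates Y (fst s) = {}" using stuck by simp
  then have KN: "K g \<subseteq> N" for g
    using candidate_exists[of r _ Y g "fst s"] I(2) by (auto simp: K_def N_def)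
  have K: "R t \<le> R r \<and> t \<in> K (R t)" if "t \<in> set tl" for t
    using g(3) that conn_sym by (auto simp: linked_def K_def)
  show "set tl \<subseteq> N" using K KN by blast
  show "R (fst m) \<le> snd m" if "m \<in> set (fst s)" "fst m \<in> set tl" for m
    using I(6) K that by blast
  show "min (R u) (R v) \<le> snd m" if "u \<in> set tl" "v \<in> set tl" "simple_path N (edge_set (snd s)) u p v"
    "m \<in> set (fst s)" "fst m \<in> set p" for u v p m
  proof -
    let ?g = "min (R u) (R v)"
    \<comment> \<open>Components grow as the grade decreases, so both ends lie in the component of
      the smaller grade, and with them the tree path between them.\<close>
    have "K (R u) \<subseteq> K ?g" "K (R v) \<subseteq> K ?g"
      using conn_mono[of Y Y ?g "R u"] conn_mono[of Y Y ?g "R v"] by (auto simp: K_def)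
    then have "u \<in> N \<inter> K ?g" "v \<in> N \<inter> K ?g" "?g \<le> R r" using K[OF that(1)] K[OF that(2)] KN by auto
    then have "fst m \<in> K ?g" using I(7)[of ?g u v p] that(3,5) by (auto simp: F_def)
    then show ?thesis using I(6)[OF \<open>?g \<le> R r\<close> that(4)] by blast
  qed
  show "real (mcost C (fst s)) \<le> 2 * real W * ln (length tl)" if "good_bound W" for W
  proof -
    have "mcost C (fst s) \<le> mcost C Y" using I(1,3) by (intro mcost_subset) (auto simp: distinct_map)
    then show ?thesis using cost[OF that] by linarith
  qed
qed

end

section \<open>Instances and their encodings\<close>

lemma enc_list_map: "enc_list f (map g xs) = enc_list (\<lambda>x. f (g x)) xs"
  by (induction xs) auto

lemma enc_pair_apply: "enc_pair f g (a, b) = Node (f a) (g b)"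
  by (simp add: enc_pair_def)

definition ratio :: "rat \<Rightarrow> nat \<times> nat" where
  "ratio q = (nat (fst (quotient_of q)), nat (snd (quotient_of q)))"

lemma enc_rat_ratio: "enc_rat q = enc_mark (ratio q)"
  by (simp add: enc_rat_def ratio_def enc_pair_def case_prod_beta)

lemma ratio:
  assumes "0 \<le> q"
  shows "0 < snd (ratio q)" "real_of_rat q = real (fst (ratio q)) / real (snd (ratio q))"
proof -
  obtain a b where ab: "quotient_of q = (a, b)" by fastforce
  then have b: "0 < b" and q: "q = of_int a / of_int b"
    using quotient_of_denom_pos quotient_of_div by blast+
  have "0 \<le> a" using assms b unfolding q by (simp add: zero_le_divide_iff)
  then show "0 < snd (ratio q)" "real_of_rat q = real (fst (ratio q)) / real (snd (ratio q))"
    using b by (simp_all add: ratio_def ab) (simp add: q of_rat_divide)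
qed

definition edge_list :: "nat list \<Rightarrow> nat set set \<Rightarrow> (nat \<times> nat) list" where
  "edge_list vs E = filter (\<lambda>(u, v). u < v \<and> {u, v} \<in> E) (List.product vs vs)"

definition vertex_list :: "gsst \<Rightarrow> nat list" where
  "vertex_list I = sorted_list_of_set (verts I)"

definition terminal_list :: "gsst \<Rightarrow> nat list" where
  "terminal_list I = sorted_list_of_set (terminals I)"

definition cost_lists :: "gsst \<Rightarrow> (nat \<times> nat) list list" where
  "cost_lists I = map (\<lambda>v. map (\<lambda>i. ratio (icost I i v)) [1..<Suc (levels I)]) (vertex_list I)"

lemma enc_instance_eq:
  "enc_instance I = enc_input (vertex_list I, edge_list (vertex_list I) (edges I),
     map (\<lambda>v. (v, req I v)) (terminal_list I), levels I, cost_lists I)"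
  by (simp only: enc_instance_def enc_pair_apply enc_edges_def Let_def edge_list_def vertex_list_def
      terminal_list_def cost_lists_def enc_list_map enc_rat_ratio)

lemma cost_entries_eq:
  "cost_entries (vertex_list I) (cost_lists I) =
     map (\<lambda>k. (k, ratio (icost I (snd k) (fst k)))) (List.product (vertex_list I) [1..<Suc (levels I)])"
proof -
  have zip_map: "zip xs (map h xs) = map (\<lambda>x. (x, h x)) xs" for xs :: "'a list" and h :: "'a \<Rightarrow> 'b"
    by (induction xs) auto
  have "cost_entries vs (map (\<lambda>v. map (\<lambda>i. h v i) [1..<Suc n]) vs) =
      map (\<lambda>k. (k, h (fst k) (snd k))) (List.product vs [1..<Suc n])" for vs n and h :: "nat \<Rightarrow> nat \<Rightarrow> nat \<times> nat"
    unfolding cost_entries_def zip_map product_concat_map map_concat map_map comp_def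
      fst_conv snd_conv length_map length_upt
    by (simp add: zip_map comp_def del: upt_Suc)
  then show ?thesis unfolding cost_lists_def .
qed

lemma sum_list_lookup:
  "distinct ks \<Longrightarrow> sum_list (map snd (filter (\<lambda>e. fst e = k) (map (\<lambda>k. (k, h k)) ks))) = (if k \<in> set ks then h k else 0)"
  for h :: "'a \<Rightarrow> nat"
  by (induction ks) auto

text \<open>Exchanging one denominator for its numerator in the product of all denominators yields
  the fraction times that product.\<close>

lemma mcost_scaled:
  assumes "distinct ks" "k \<in> set ks" "\<And>k. k \<in> set ks \<Longrightarrow> 0 < snd (h k)"
  shows "real (mcost (scaled (map (\<lambda>k. (k, h k)) ks)) [k]) =
    (\<Prod>k\<in>set ks. real (snd (h k))) * (real (fst (h k)) / real (snd (h k)))"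
proof -
  have "mcost (scaled (map (\<lambda>k. (k, h k)) ks)) [k] = prod_list (map (\<lambda>k'. if k' = k then fst (h k') else snd (h k')) ks)"
    using sum_list_lookup[OF assms(1), of k "\<lambda>k. prod_list (map (\<lambda>k'. if k' = k then fst (h k') else snd (h k')) ks)"] assms(2)
    by (simp add: mcost_def scaled_def comp_def cong: if_cong)
  also have "\<dots> = (\<Prod>k'\<in>set ks. if k' = k then fst (h k') else snd (h k'))"
    using assms(1) by (rule prod.distinct_set_conv_list[symmetric])
  also have "\<dots> = fst (h k) * (\<Prod>k'\<in>set ks - {k}. snd (h k'))"
    using assms(2) by (subst prod.remove[of _ k]) (auto intro: prod.cong)
  also have "real \<dots> = (\<Prod>k\<in>set ks. real (snd (h k))) * (real (fst (h k)) / real (snd (h k)))"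
    using assms(2,3) by (subst prod.remove[of _ k]) (simp_all add: prod_pos less_imp_neq[symmetric])
  finally show ?thesis .
qed

lemma product_filter:
  "List.product (filter P xs) (filter Q ys) = filter (\<lambda>e. P (fst e) \<and> Q (snd e)) (List.product xs ys)"
proof (induction xs)
  case (Cons x xs)
  have "map (Pair x) (filter Q ys) = filter (\<lambda>e. Q (snd e)) (map (Pair x) ys)"
    by (induction ys) auto
  moreover have "filter (\<lambda>e. P (fst e) \<and> Q (snd e)) (map (Pair x) ys) = (if P x then filter (\<lambda>e. Q (snd e)) (map (Pair x) ys) else [])"
    by (induction ys) auto
  ultimately show ?case using Cons by simp
qed simp

lemma sorted_list_of_subset:
  assumes "finite V" "N \<subseteq> V" shows "sorted_list_of_set N = filter (\<lambda>v. v \<in> N) (sorted_list_of_set V)"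
proof -
  have "finite N" using assms finite_subset by blast
  then show ?thesis
    by (intro sorted_distinct_set_unique) (use assms in \<open>auto intro: sorted_wrt_filter\<close>)
qed

lemma lookup_unique:
  assumes "distinct (map fst U)"
  shows "filter (\<lambda>m. fst m = v) U = (if v \<in> fst ` set U then [(v, the (map_of U v))] else [])"
  using assms
proof (induction U)
  case (Cons m U)
  then show ?case by (cases m) (auto simp: filter_empty_conv image_iff)
qed simp

definition solution :: "(nat \<times> nat) list \<times> (nat \<times> nat) list \<Rightarrow> gsst_solution" where
  "solution s = \<lparr>tverts = fst ` set (fst s), tedges = (\<lambda>a. {fst a, snd a}) ` set (snd s),
     grade = (\<lambda>v. the (map_of (fst s) v))\<rparr>"

lemma enc_solution_eq:
  assumes V: "finite V" and s: "distinct (map fst (fst s))" "fst ` set (fst s) \<subseteq> V"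
    and F: "ugraph (fst ` set (fst s)) (tedges (solution s))" "tedges (solution s) \<subseteq> E"
  shows "enc_solution (solution s) = enc_pair enc_marks enc_marks
    (answer (sorted_list_of_set V) (edge_list (sorted_list_of_set V) E) s)"
proof -
  let ?vs = "sorted_list_of_set V" and ?N = "fst ` set (fst s)"
  have N: "sorted_list_of_set ?N = filter (\<lambda>v. v \<in> ?N) ?vs" by (rule sorted_list_of_subset[OF V s(2)])
  have "concat (map (\<lambda>v. filter (\<lambda>m. fst m = v) (fst s)) ws) =
      map (\<lambda>v. (v, the (map_of (fst s) v))) (filter (\<lambda>v. v \<in> ?N) ws)" for ws
    unfolding lookup_unique[OF s(1)] by (induction ws) auto
  then have 1: "enc_marks (concat (map (\<lambda>v. filter (\<lambda>m. fst m = v) (fst s)) ?vs)) =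
     enc_list (\<lambda>v. Node (enc_nat v) (enc_nat (the (map_of (fst s) v)))) (sorted_list_of_set ?N)"
    by (simp only: enc_list_map enc_pair_apply N)
  have "filter (\<lambda>e. e \<in> set (snd s) \<or> (snd e, fst e) \<in> set (snd s)) (edge_list ?vs E) = edge_list (sorted_list_of_set ?N) (tedges (solution s))"
  proof -
    have edge: "{u, v} \<in> tedges (solution s) \<longleftrightarrow> (u, v) \<in> set (snd s) \<or> (v, u) \<in> set (snd s)" for u v
      by (force simp: solution_def doubleton_eq_iff image_iff)
    have sub: "{u, v} \<in> tedges (solution s) \<Longrightarrow> u \<in> ?N \<and> v \<in> ?N \<and> {u, v} \<in> E" for u v
      using F by (auto simp: ugraph_def)
    show ?thesis
      unfolding edge_list_def N product_filter filter_filter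
    proof (rule filter_cong[OF refl])
      fix e :: "nat \<times> nat"
      obtain u v where e: "e = (u, v)" by fastforce
      show "((case e of (u, v) \<Rightarrow> u < v \<and> {u, v} \<in> E) \<and> (e \<in> set (snd s) \<or> (snd e, fst e) \<in> set (snd s))) =
        ((fst e \<in> ?N \<and> snd e \<in> ?N) \<and> (case e of (u, v) \<Rightarrow> u < v \<and> {u, v} \<in> tedges (solution s)))"
        using edge[of u v] sub[of u v] unfolding e by auto
    qed
  qed
  then have 2: "enc_marks (filter (\<lambda>e. e \<in> set (snd s) \<or> (snd e, fst e) \<in> set (snd s)) (edge_list ?vs E)) = enc_edges ?N (tedges (solution s))"
    by (simp only: enc_edges_def edge_list_def Let_def)
  show ?thesis
    unfolding answer_def enc_pair_apply 1 2 enc_solution_def by (simp add: solution_def)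
qed

theorem theorem1:
  "\<exists>(alg :: com) (p :: nat poly). \<forall>I. gsst_instance I \<longrightarrow>
     (\<exists>t S. outputs_in_time alg (enc_instance I) t (enc_solution S) \<and>
            t \<le> poly p (size (enc_instance I)) \<and>
            feasible I S \<and>
            real_of_rat (sol_cost I S)
              \<le> 2 * ln (real (card (terminals I))) * real_of_rat (OPT I))"
proof -
  obtain alg k T p where alg: "\<And>x s. s 0 = enc_input x \<Longrightarrow>
      runs alg s (T x) (\<lambda>s'. s' 0 = enc_pair enc_marks enc_marks (answer (fst x) (fst (snd x))
        (solve (fst x) (fst (snd x)) (fst (snd (snd x))) (snd (snd (snd (snd x)))))) \<and> (\<forall>i\<ge>k. s' i = s i))"
    and T: "\<And>x. T x \<le> poly p (size (enc_input x))"
    using polyt_algorithm unfolding polyt_def pbound_def by blast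
  have "\<exists>t S. outputs_in_time alg (enc_instance I) t (enc_solution S) \<and> t \<le> poly p (size (enc_instance I)) \<and>
      feasible I S \<and> real_of_rat (sol_cost I S) \<le> 2 * ln (real (card (terminals I))) * real_of_rat (OPT I)"
    if I: "gsst_instance I" for I
  proof -
    let ?V = "verts I" and ?E = "edges I" and ?R = "req I" and ?l = "levels I"
    let ?vs = "vertex_list I" and ?tl = "terminal_list I" and ?es = "edge_list (vertex_list I) (edges I)"
    let ?ts = "map (\<lambda>v. (v, ?R v)) ?tl"
    define C where "C = scaled (cost_entries ?vs (cost_lists I))"
    \<comment> \<open>The common factor of all scaled costs; it is positive and cancels in the
      end.\<close>
    define P where "P = (\<Prod>k\<in>?V \<times> {1..?l}. real (snd (ratio (icost I (snd k) (fst k)))))"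
    have conn: "connected_graph ?V ?E" and ug: "ugraph ?V ?E" and fin: "finite ?V"
      and trm: "terminals I \<subseteq> ?V" "terminals I \<noteq> {}" "\<And>t. t \<in> terminals I \<Longrightarrow> ?R t \<in> {1..?l}"
      and nonneg: "\<And>v i. v \<in> ?V \<Longrightarrow> i \<in> {1..?l} \<Longrightarrow> 0 \<le> icost I i v"
      and mono: "\<And>v i j. v \<in> ?V \<Longrightarrow> 1 \<le> i \<Longrightarrow> i \<le> j \<Longrightarrow> j \<le> ?l \<Longrightarrow> icost I i v \<le> icost I j v"
      and zero: "\<And>v i. v \<in> terminals I \<Longrightarrow> i \<in> {1..?R v} \<Longrightarrow> icost I i v = 0"
      using I by (auto simp: gsst_instance_def connected_graph_def ugraph_def)
    have finT: "finite (terminals I)" using trm(1) fin finite_subset by blast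
    have keys: "set (List.product ?vs [1..<Suc ?l]) = ?V \<times> {1..?l}" "distinct (List.product ?vs [1..<Suc ?l])"
      using fin by (auto simp: vertex_list_def distinct_product)
    have pos: "0 < snd (ratio (icost I (snd k) (fst k)))" if "k \<in> ?V \<times> {1..?l}" for k
      using that by (intro ratio(1) nonneg) auto
    have P: "0 < P" unfolding P_def using pos by (intro prod_pos) auto
    have cost: "real (mcost C [(w, i)]) = P * real_of_rat (icost I i w)" if "w \<in> ?V" "i \<in> {1..?l}" for w i
    proof -
      have "real (mcost C [(w, i)]) = P * (real (fst (ratio (icost I i w))) / real (snd (ratio (icost I i w))))"
        using mcost_scaled[OF keys(2), of "(w, i)" "\<lambda>k. ratio (icost I (snd k) (fst k))"] pos that
        unfolding C_def cost_entries_eq keys(1) P_def by auto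
      then show ?thesis using ratio(2)[OF nonneg[OF that]] by simp
    qed
    have arcs: "(u, v) \<in> set (both_ways ?es) \<longleftrightarrow> {u, v} \<in> ?E" for u v
    proof -
      have "{u, v} \<in> ?E \<Longrightarrow> u \<in> ?V \<and> v \<in> ?V \<and> u \<noteq> v" using ug by (force simp: ugraph_def)
      then show ?thesis using fin
        by (cases u v rule: linorder_cases)
           (auto simp: both_ways_def edge_list_def vertex_list_def insert_commute image_iff)
    qed
    interpret gsst_run ?V ?E ?R ?l C "both_ways ?es" ?vs ?tl
    proof
      show "mcost C [(w, i)] \<le> mcost C [(w, j)]" if "w \<in> ?V" "1 \<le> i" "i \<le> j" "j \<le> ?l" for w i j
      proof -
        have "real (mcost C [(w, i)]) \<le> real (mcost C [(w, j)])"
          using cost[of w i] cost[of w j] mono[OF that] that P by (simp add: of_rat_less_eq)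
        then show ?thesis by simp
      qed
      show "mcost C [(t, ?R t)] = 0" if "t \<in> set ?tl" for t
      proof -
        have t: "t \<in> terminals I" using that finT by (simp add: terminal_list_def)
        then have "icost I (?R t) t = 0" using trm(3)[OF t] by (intro zero) auto
        then show ?thesis using cost[of t "?R t"] trm(1,3) t by auto
      qed
    qed (use conn fin finT trm arcs in \<open>auto simp: vertex_list_def terminal_list_def\<close>)
    define s where "s = solve ?vs ?es ?ts (cost_lists I)"
    have s: "s = grow (both_ways ?es) ?vs (fst (greedy C (both_ways ?es) ?vs ts)) (snd (greedy C (both_ways ?es) ?vs ts))"
      unfolding s_def solve_def Let_def ts_def C_def ..
    note rc = run_correct[folded s]
    define S where "S = solution s"
    have N: "tverts S = fst ` set (fst s)" and F: "tedges S = edge_set (snd s)"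
      by (simp_all add: S_def solution_def edge_set_def)
    have grade: "grade S (fst m) = snd m" if "m \<in> set (fst s)" for m
      using map_of_is_SomeI[OF rc(1), of "fst m" "snd m"] that by (simp add: S_def solution_def)
    have tl: "set ?tl = terminals I" "length ?tl = card (terminals I)"
      using finT by (simp_all add: terminal_list_def)
    have feas: "feasible I S"
      unfolding feasible_def
    proof (intro conjI ballI allI impI)
      show "tree_graph (tverts S) (tedges S)" "tverts S \<subseteq> verts I" "tedges S \<subseteq> edges I" "terminals I \<subseteq> tverts S"
        using rc(2-5) unfolding N F tl by auto
      show "grade S v \<in> {1..?l}" if "v \<in> tverts S" for v
        using that rc(6) grade unfolding N by auto
      show "?R v \<le> grade S v" if "v \<in> terminals I" for v
        using that rc(5,7) grade unfolding tl by fastforce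
      fix u v p w assume uv: "u \<in> terminals I" "v \<in> terminals I" "simple_path (tverts S) (tedges S) u p v" "w \<in> set p"
      have "w \<in> tverts S" using uv(3,4) by (auto simp: simple_path_def)
      then obtain m where "m \<in> set (fst s)" "w = fst m" by (auto simp: N)
      then show "min (?R u) (?R v) \<le> grade S w" using rc(8)[of u v p m] uv grade unfolding tl N F by simp
    qed
    have scaled_cost: "(\<Sum>w\<in>tverts S'. real (mcost C [(w, grade S' w)])) = P * real_of_rat (sol_cost I S')" if "feasible I S'" for S'
    proof -
      have "(\<Sum>w\<in>tverts S'. real (mcost C [(w, grade S' w)])) = (\<Sum>w\<in>tverts S'. P * real_of_rat (icost I (grade S' w) w))"
        using that cost by (intro sum.cong) (auto simp: feasible_def)
      then show ?thesis by (simp add: sol_cost_def of_rat_sum sum_distrib_left)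
    qed
    have approx: "real_of_rat (sol_cost I S) \<le> 2 * ln (real (card (terminals I))) * real_of_rat (sol_cost I S')"
      if S': "feasible I S'" for S'
    proof -
      \<comment> \<open>The scaled cost of the competitor \<open>S'\<close>, one bound for all
        rounds of the greedy phase.\<close>
      define W where "W = (\<Sum>w\<in>tverts S'. mcost C [(w, grade S' w)])"
      have "good_bound W" unfolding good_bound_def W_def
        using S' by (intro allI impI good_spider_exists) (auto simp: feasible_def tree_graph_def tl)
      then have "real (mcost C (fst s)) \<le> 2 * real W * ln (length ?tl)" by (rule rc(9))
      moreover have "real W = P * real_of_rat (sol_cost I S')"
        using scaled_cost[OF S'] by (simp add: W_def)
      moreover have "real (mcost C (fst s)) = P * real_of_rat (sol_cost I S)"
      proof -
        have "mcost C (fst s) = (\<Sum>m\<in>set (fst s). mcost C [m])"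
          using rc(1) by (intro mcost_eq_sum) (simp add: distinct_map)
        also have "\<dots> = (\<Sum>m\<in>set (fst s). mcost C [(fst m, grade S (fst m))])"
          using grade by (intro sum.cong) auto
        also have "\<dots> = (\<Sum>w\<in>tverts S. mcost C [(w, grade S w)])"
          unfolding N using rc(1) by (subst sum.reindex) (auto simp: distinct_map)
        finally show ?thesis using scaled_cost[OF feas] by simp
      qed
      ultimately have "P * real_of_rat (sol_cost I S) \<le> P * (2 * ln (real (card (terminals I))) * real_of_rat (sol_cost I S'))"
        unfolding tl by (simp add: mult_ac)
      then show ?thesis using P by (simp only: mult_le_cancel_left_pos)
    qed
    \<comment> \<open>The computed solution itself shows that the finite set of costs is non-empty,
      so the minimum is attained.\<close>
    have "OPT I \<in> sol_cost I ` {S. feasible I S}"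
      unfolding OPT_def using finite_feasible_costs[OF I] feas by (intro Min_in) auto
    then have opt: "real_of_rat (sol_cost I S) \<le> 2 * ln (real (card (terminals I))) * real_of_rat (OPT I)"
      using approx by auto
    have enc: "enc_solution S = enc_pair enc_marks enc_marks (answer ?vs ?es s)"
      unfolding S_def vertex_list_def
    proof (rule enc_solution_eq[OF fin rc(1)])
      show "ugraph (fst ` set (fst s)) (tedges (solution s))"
        using rc(2) F by (simp add: S_def tree_graph_def connected_graph_def)
    qed (use rc(3,4) F in \<open>auto simp: S_def\<close>)
    obtain t s' where "exec alg ((\<lambda>_. Atom)(0 := enc_instance I)) t s'" "t \<le> T (?vs, ?es, ?ts, ?l, cost_lists I)"
      "s' 0 = enc_solution S"
      using alg[of "(\<lambda>_. Atom)(0 := enc_instance I)" "(?vs, ?es, ?ts, ?l, cost_lists I)"]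
      unfolding enc_instance_eq runs_def enc s_def by auto
    then have "outputs_in_time alg (enc_instance I) t (enc_solution S)" "t \<le> poly p (size (enc_instance I))"
      using T[of "(?vs, ?es, ?ts, ?l, cost_lists I)"] unfolding outputs_in_time_def enc_instance_eq by auto
    then show ?thesis using feas opt by blast
  qed
  then show ?thesis by blast
qed

end
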